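(* Let $\mu,\nu$ be Borel probability measures on $\mathbb{R}^N$ with supports $\mathcal X=\mathrm{supp}(\mu)$, $\mathcal Y=\mathrm{supp}(\nu)$, and assume that $\mu$ is successively weakly continuous. Let $c:\mathcal X\times\mathcal Y\to\mathbb{R}\cup\{+\infty\}$ be lower semicontinuous and bounded from below. Then there is no duality gap: $$\inf_{\gamma\in\Pi_c(\mu,\nu)}\int c\,d\gamma=\sup_{\substack{\Phi,\Psi\in C_b(\mathbb{R}^N),\,F\in\mathbb F\\ \Phi\oplus\Psi\le c+F}}\Big[\int\Phi\,d\mu+\int\Psi\,d\nu\Big]=\sup_{\substack{\Phi,\Psi\in C_b(\mathbb{R}^N),\,S\in\mathbb S\\ \Phi\oplus\Psi\le c+S}}\Big[\int\Phi\,d\mu+\int\Psi\,d\nu\Big],$$ where the inequality constraints are required to hold at all points of $\mathcal X\times\mathcal Y$, and the infimum on the left-hand side is attained.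
   Context: $\Pi(\mu,\nu)$ is the set of Borel probability measures on $\mathcal X\times\mathcal Y$ with marginals $\mu,\nu$. For $\gamma\in\Pi(\mu,\nu)$, $\gamma^x(dy)$ denotes the regular conditional law of $y$ given $x$. $\mathcal F^{\mathcal X}_t$ (resp. $\mathcal F^{\mathcal Y}_t$) is the $\sigma$-algebra generated by the first $t$ coordinates on $\mathcal X$ (resp. $\mathcal Y$). $\gamma\in\Pi(\mu,\nu)$ is causal if for every $t\in\{1,\dots,N\}$ and $B\in\mathcal F^{\mathcal Y}_t$ the map $x\mapsto\gamma^x(B)$ is $\mathcal F^{\mathcal X}_t$-measurable up to modification on a $\mu$-null set; $\Pi_c(\mu,\nu)$ is the set of causal $\gamma\in\Pi(\mu,\nu)$. $\mu^{x_1,\dots,x_t}(dx_{t+1},\dots,dx_N)$ denotes the regular conditional law under $\mu$ of $(x_{t+1},\dots,x_N)$ given $(x_1,\dots,x_t)$. Let $\mathcal X_t$ be the projection of $\mathcal X$ onto the first $t$ coordinates. $\mu$ is successively weakly continuous if for each $t<N$ there is a version of this kernel such that $(x_1,\dots,x_t)\in\mathcal X_t\mapsto\mu^{x_1,\dots,x_t}(dx_{t+1},\dots,dx_N)\in\mathcal P(\mathbb{R}^{N-t})$ is continuous for the relative topology on $\mathcal X_t$ and the weak topology on $\mathcal P(\mathbb{R}^{N-t})$; these versions are the ones used below. $C_b$ denotes bounded continuous real-valued functions and $(\Phi\oplus\Psi)(x,y)=\Phi(x)+\Psi(y)$. $\mathbb F$ is the set of all functions on $\mathcal X\times\mathcal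 Y$ of the form $$F(x,y)=\sum_{t<N}h_t(y_1,\dots,y_t)\Big[g_t(x_1,\dots,x_N)-\int g_t(x_1,\dots,x_t,\bar x_{t+1},\dots,\bar x_N)\,\mu^{x_1,\dots,x_t}(d\bar x_{t+1},\dots,d\bar x_N)\Big]$$ with $h_t\in C_b(\mathbb{R}^t)$, $g_t\in C_b(\mathbb{R}^N)$ for all $t<N$. $\mathbb S$ is the set of all functions on $\mathcal X\times\mathcal Y$ of the form $$S(x,y)=\sum_{t<N}H_t(y_1,\dots,y_t)\big[M_{t+1}(x_1,\dots,x_{t+1})-M_t(x_1,\dots,x_t)\big]$$ with $H_t\in C_b(\mathbb{R}^t)$ for $t<N$, $M_t\in C_b(\mathcal X_t)$ for $t\le N$, and $(M_t)_{t=1}^N$ a martingale under $\mu$ for the filtration $(\mathcal F^{\mathcal X}_t)_t$.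
   Formalization: The suprema range over the linear spans of 𝔽 and 𝕊, since with the sets as written duality fails: N=2, x₁, y₂ deterministic, x₂, y₁ uniform on {0,1,2}, c=1 if x₂=y₁ and 0 otherwise. *)

theory Defs
  imports "HOL-Probability.Probability"
begin

text \<open>
  For a finite index set \<open>I\<close>, the space $\mathbb{R}^I$ is the set \<open>Pi\<^sub>E I (\<lambda>_. UNIV)\<close> of functions
  that are \<open>undefined\<close> outside \<open>I\<close>, with the product topology and the product of the Borel
  \<open>\<sigma>\<close>-algebras (which is the Borel \<open>\<sigma>\<close>-algebra of the product topology, \<open>I\<close> being finite).
  $\mathbb{R}^t$ is the case \<open>I = {1..t}\<close>, and the last $N-t$ coordinates $(x_{t+1},\dots,x_N)$
  of a point of $\mathbb{R}^N$ live on \<open>I = {t<..N}\<close>.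
\<close>

type_synonym vec = "nat \<Rightarrow> real"

abbreviation top_on :: "nat set \<Rightarrow> vec topology" where
  "top_on I \<equiv> product_topology (\<lambda>_. euclideanreal) I"

abbreviation borel_on :: "nat set \<Rightarrow> vec measure" where
  "borel_on I \<equiv> Pi\<^sub>M I (\<lambda>_. borel)"

abbreviation initial :: "nat \<Rightarrow> vec \<Rightarrow> vec" where
  "initial t x \<equiv> restrict x {1..t}"

definition borel_prob :: "nat \<Rightarrow> vec measure \<Rightarrow> bool" where
  "borel_prob N \<mu> \<longleftrightarrow> prob_space \<mu> \<and> sets \<mu> = sets (borel_on {1..N})"

definition C\<^sub>b :: "'a topology \<Rightarrow> ('a \<Rightarrow> real) set" where
  "C\<^sub>b T = {f. continuous_map T euclideanreal f \<and> bounded (f ` topspace T)}"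

definition lower_semicontinuous :: "'a topology \<Rightarrow> ('a \<Rightarrow> ereal) \<Rightarrow> bool" where
  "lower_semicontinuous T f \<longleftrightarrow> (\<forall>a. openin T {x \<in> topspace T. a < f x})"

definition supp :: "nat \<Rightarrow> vec measure \<Rightarrow> vec set" where
  "supp N \<mu> = {x \<in> topspace (top_on {1..N}).
     \<forall>U. openin (top_on {1..N}) U \<and> x \<in> U \<longrightarrow> 0 < emeasure \<mu> U}"

text \<open>\<open>\<mu>\<close> as a measure on its support:\<close>

abbreviation on_supp :: "nat \<Rightarrow> vec measure \<Rightarrow> vec measure" where
  "on_supp N \<mu> \<equiv> restrict_space \<mu> (supp N \<mu>)"

abbreviation supp_proj :: "nat \<Rightarrow> vec measure \<Rightarrow> nat \<Rightarrow> vec set" where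
  "supp_proj N \<mu> t \<equiv> initial t ` supp N \<mu>"

definition coord_filtration :: "nat \<Rightarrow> vec measure \<Rightarrow> nat \<Rightarrow> vec measure" where
  "coord_filtration N \<mu> t = vimage_algebra (supp N \<mu>) (initial t) (borel_on {1..t})"

text \<open>
  \<open>\<kappa>\<close> is (a version of) the regular conditional law under \<open>M\<close> of \<open>g\<close>, with values in \<open>T\<close>,
  given \<open>f\<close>, with values in \<open>S\<close>.
\<close>

definition regular_cond_law ::
  "'a measure \<Rightarrow> 'b measure \<Rightarrow> ('a \<Rightarrow> 'b) \<Rightarrow> 'c measure \<Rightarrow> ('a \<Rightarrow> 'c) \<Rightarrow> ('b \<Rightarrow> 'c measure) \<Rightarrow> bool" where
  "regular_cond_law M S f T g \<kappa> \<longleftrightarrow>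
     \<kappa> \<in> S \<rightarrow>\<^sub>M prob_algebra T \<and>
     (\<forall>A \<in> sets S. \<forall>B \<in> sets T.
        emeasure M {\<omega> \<in> space M. f \<omega> \<in> A \<and> g \<omega> \<in> B} =
        (\<integral>\<^sup>+\<omega>. emeasure (\<kappa> (f \<omega>)) B * indicator A (f \<omega>) \<partial>M))"


subsection \<open>Causal couplings\<close>

definition couplings :: "nat \<Rightarrow> vec measure \<Rightarrow> vec measure \<Rightarrow> (vec \<times> vec) measure set" where
  "couplings N \<mu> \<nu> = {\<gamma>. prob_space \<gamma> \<and>
     sets \<gamma> = sets (restrict_space (borel_on {1..N}) (supp N \<mu>) \<Otimes>\<^sub>M
                    restrict_space (borel_on {1..N}) (supp N \<nu>)) \<and>
     distr \<gamma> (on_supp N \<mu>) fst = on_supp N \<mu> \<and>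
     distr \<gamma> (on_supp N \<nu>) snd = on_supp N \<nu>}"

text \<open>
  The regular conditional law of \<open>y\<close> given \<open>x\<close> exists and is unique up to a \<open>\<mu>\<close>-null set, so
  that the condition below does not depend on the version \<open>\<kappa>\<close>.
\<close>

definition causal :: "nat \<Rightarrow> vec measure \<Rightarrow> vec measure \<Rightarrow> (vec \<times> vec) measure \<Rightarrow> bool" where
  "causal N \<mu> \<nu> \<gamma> \<longleftrightarrow>
     (\<exists>\<kappa>. regular_cond_law \<gamma> (on_supp N \<mu>) fst (on_supp N \<nu>) snd \<kappa> \<and>
        (\<forall>t \<in> {1..N}. \<forall>B \<in> sets (coord_filtration N \<nu> t).
           \<exists>f \<in> borel_measurable (coord_filtration N \<mu> t).
             AE x in on_supp N \<mu>. measure (\<kappa> x) B = f x))"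

definition causal_couplings :: "nat \<Rightarrow> vec measure \<Rightarrow> vec measure \<Rightarrow> (vec \<times> vec) measure set" where
  "causal_couplings N \<mu> \<nu> = {\<gamma> \<in> couplings N \<mu> \<nu>. causal N \<mu> \<nu> \<gamma>}"

text \<open>
  Integral of an extended-real function as positive minus negative part; \<open>e2ennreal\<close> maps negative
  numbers to \<open>0\<close>. It is used only when the negative part has a finite integral.
\<close>

definition ereal_integral :: "'a measure \<Rightarrow> ('a \<Rightarrow> ereal) \<Rightarrow> ereal" where
  "ereal_integral M f =
     enn2ereal (\<integral>\<^sup>+x. e2ennreal (f x) \<partial>M) - enn2ereal (\<integral>\<^sup>+x. e2ennreal (- f x) \<partial>M)"


subsection \<open>Successive weak continuity\<close>

text \<open>
  The weak topology on the Borel probability measures on $\mathbb{R}^I$: the coarsest one for which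
  \<open>m \<mapsto> \<integral>f dm\<close> is continuous for every bounded continuous \<open>f\<close>.
\<close>

definition weak_topology :: "nat set \<Rightarrow> vec measure topology" where
  "weak_topology I = topology_generated_by
     {{m \<in> space (prob_algebra (borel_on I)). (\<integral>x. f x \<partial>m) \<in> U} | f U. f \<in> C\<^sub>b (top_on I) \<and> open U}"

definition continuous_cond_law :: "nat \<Rightarrow> vec measure \<Rightarrow> nat \<Rightarrow> (vec \<Rightarrow> vec measure) \<Rightarrow> bool" where
  "continuous_cond_law N \<mu> t \<kappa> \<longleftrightarrow>
     regular_cond_law (on_supp N \<mu>)
       (restrict_space (borel_on {1..t}) (supp_proj N \<mu> t)) (initial t)
       (borel_on {t<..N}) (\<lambda>x. restrict x {t<..N}) \<kappa> \<and>
     continuous_map (subtopology (top_on {1..t}) (supp_proj N \<mu> t)) (weak_topology {t<..N}) \<kappa>"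

definition successively_weakly_continuous :: "nat \<Rightarrow> vec measure \<Rightarrow> bool" where
  "successively_weakly_continuous N \<mu> \<longleftrightarrow> (\<forall>t \<in> {1..<N}. \<exists>\<kappa>. continuous_cond_law N \<mu> t \<kappa>)"

text \<open>The continuous version is unique on \<open>supp_proj N \<mu> t\<close>; its values elsewhere are irrelevant.\<close>

definition cond_law :: "nat \<Rightarrow> vec measure \<Rightarrow> nat \<Rightarrow> vec \<Rightarrow> vec measure" where
  "cond_law N \<mu> t = (SOME \<kappa>. continuous_cond_law N \<mu> t \<kappa>)"


subsection \<open>Test functions\<close>

text \<open>
  Functions on the product of the two supports are represented by functions on \<^typ>\<open>vec \<times> vec\<close>
  with arbitrary values elsewhere.
\<close>

definition FF :: "nat \<Rightarrow> vec measure \<Rightarrow> vec measure \<Rightarrow> (vec \<times> vec \<Rightarrow> real) set" where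
  "FF N \<mu> \<nu> = {F. \<exists>h g.
     (\<forall>t \<in> {1..<N}. h t \<in> C\<^sub>b (top_on {1..t}) \<and> g t \<in> C\<^sub>b (top_on {1..N})) \<and>
     (\<forall>x \<in> supp N \<mu>. \<forall>y \<in> supp N \<nu>.
        F (x, y) = (\<Sum>t \<in> {1..<N}. h t (initial t y) *
          (g t x - (\<integral>x'. g t (merge {1..t} {t<..N} (x, x')) \<partial>cond_law N \<mu> t (initial t x)))))}"

definition martingale ::
  "'a measure \<Rightarrow> (nat \<Rightarrow> 'a measure) \<Rightarrow> nat set \<Rightarrow> (nat \<Rightarrow> 'a \<Rightarrow> real) \<Rightarrow> bool" where
  "martingale M F T X \<longleftrightarrow>
     (\<forall>t \<in> T. X t \<in> borel_measurable (F t) \<and> integrable M (X t)) \<and>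
     (\<forall>s \<in> T. \<forall>t \<in> T. s \<le> t \<longrightarrow> (AE \<omega> in M. real_cond_exp M (F s) (X t) \<omega> = X s \<omega>))"

definition SS :: "nat \<Rightarrow> vec measure \<Rightarrow> vec measure \<Rightarrow> (vec \<times> vec \<Rightarrow> real) set" where
  "SS N \<mu> \<nu> = {S. \<exists>H M.
     (\<forall>t \<in> {1..<N}. H t \<in> C\<^sub>b (top_on {1..t})) \<and>
     (\<forall>t \<in> {1..N}. M t \<in> C\<^sub>b (subtopology (top_on {1..t}) (supp_proj N \<mu> t))) \<and>
     martingale (on_supp N \<mu>) (coord_filtration N \<mu>) {1..N} (\<lambda>t x. M t (initial t x)) \<and>
     (\<forall>x \<in> supp N \<mu>. \<forall>y \<in> supp N \<nu>.
        S (x, y) = (\<Sum>t \<in> {1..<N}. H t (initial t y) *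
          (M (Suc t) (initial (Suc t) x) - M t (initial t x))))}"

text \<open>
  The dual problems range over the linear spans of \<open>FF\<close> and \<open>SS\<close>. These sets are closed under
  scalar multiplication but not under addition (each \<open>t\<close> contributes a single product
  $h_t \cdot [\dots]$, and in \<open>SS\<close> there is a single martingale), and without the spans duality
  fails. For example, let $N = 2$, let $x_1$ and $y_2$ be deterministic and let $x_2$ and $y_1$ be
  uniform on \<open>{0, 1, 2}\<close>. The only causal coupling is the product, which charges all nine points.
  Hence the absence of a gap for a cost $c(x_2, y_1)$ would make $c$ a limit of functions
  \<open>\<Phi> \<oplus> \<Psi> - F\<close>. The doubly centred matrix of such a function has rank at most one if \<open>F\<close> is
  in \<open>FF\<close> or \<open>SS\<close>, whereas that of the indicator of $x_2 = y_1$ has rank two.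
\<close>

definition linear_span :: "('a \<Rightarrow> real) set \<Rightarrow> ('a \<Rightarrow> real) set" where
  "linear_span A = {\<lambda>z. \<Sum>j<n. a j * G j z | (n::nat) a G. \<forall>j<n. G j \<in> A}"

definition dual_value ::
  "nat \<Rightarrow> vec measure \<Rightarrow> vec measure \<Rightarrow> (vec \<times> vec \<Rightarrow> ereal) \<Rightarrow> (vec \<times> vec \<Rightarrow> real) set \<Rightarrow> ereal" where
  "dual_value N \<mu> \<nu> c \<F> =
     Sup {ereal ((\<integral>x. \<Phi> x \<partial>\<mu>) + (\<integral>y. \<Psi> y \<partial>\<nu>)) | \<Phi> \<Psi> F.
       \<Phi> \<in> C\<^sub>b (top_on {1..N}) \<and> \<Psi> \<in> C\<^sub>b (top_on {1..N}) \<and> F \<in> \<F> \<and>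
       (\<forall>x \<in> supp N \<mu>. \<forall>y \<in> supp N \<nu>. ereal (\<Phi> x + \<Psi> y) \<le> c (x, y) + ereal (F (x, y)))}"

end

theory Submission
  imports Defs
begin

text \<open>
  Write \<open>X\<close> and \<open>Y\<close> for the supports of \<open>\<mu>\<close> and \<open>\<nu>\<close>, and call the coordinate filtrations \<open>F\<^sub>t\<close>.

  \<^bold>\<open>The dual values are lower bounds.\<close> Under a causal coupling the conditional probability of an event
  about \<open>y\<^sub>1, \<dots>, y\<^sub>t\<close> given \<open>x\<close> is a function of \<open>x\<^sub>1, \<dots>, x\<^sub>t\<close>, so a bounded function of
  \<open>y\<^sub>1, \<dots>, y\<^sub>t\<close> is uncorrelated with every \<open>D(x)\<close> whose conditional expectation given \<open>F\<^sub>t\<close> vanishes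
  (\<open>causal_orthogonal\<close>). Taking for \<open>D\<close> a martingale increment shows that the functions in \<open>SS\<close>
  integrate to zero, and \<open>weak_duality\<close> follows. Moreover \<open>g - E[g | F\<^sub>t]\<close> is the sum of the later increments
  of the martingale \<open>E[g | F\<^sub>s]\<close>, and successive weak continuity makes this martingale continuous.
  Hence every function in \<open>FF\<close> agrees on \<open>X \<times> Y\<close> with an element of the span of \<open>SS\<close>
  (\<open>span_FF_eq_span_SS\<close>), and the \<open>FF\<close> dual is at most the \<open>SS\<close> dual, which is at most the primal value.

  \<^bold>\<open>A coupling that attains the \<open>FF\<close> dual.\<close> Let \<open>d\<close> be the value of the \<open>FF\<close> dual. If it is infinite, the
  product coupling will do. Otherwise a single application of the Hahn-Banach principle takes the
  place of a minimax theorem and of Kantorovich duality: on all bounded functions on \<open>X \<times> Y\<close> put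
  \<open>p f = inf {\<integral>\<Phi> d\<mu> + \<integral>\<Psi> d\<nu> + s d}\<close>, where the infimum is over \<open>s \<ge> 0\<close>, \<open>\<Phi>\<close>, \<open>\<Psi>\<close> and \<open>F\<close> with
  \<open>f \<le> \<Phi> \<oplus> \<Psi> + F + s c\<close>. This is a sublinear functional, and it is finite because \<open>d\<close> is an upper bound
  of the dual problem (\<open>dominates_lower_bound\<close>). Any linear \<open>L \<le> p\<close> is positive, has the
  marginals \<open>\<mu>\<close> and \<open>\<nu>\<close>, annihilates \<open>FF\<close>, and satisfies \<open>L f \<le> d\<close> for all bounded \<open>f \<le> c\<close>.

  The marginals make \<open>L\<close> tight, so that on bounded continuous functions it is integration against
  a probability measure \<open>\<gamma>\<close> (\<open>representing_measure\<close>). This \<open>\<gamma>\<close> is a coupling, and orthogonality to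
  \<open>FF\<close> makes it causal (\<open>causal_if_orthogonal_FF\<close>). Since \<open>c\<close> is an increasing limit
  of bounded continuous functions (\<open>lsc_eq_SUP_continuous\<close>), the integral of \<open>c\<close> under \<open>\<gamma>\<close> is at most \<open>d\<close>.
  So \<open>\<gamma>\<close> is optimal and all three values coincide.

  Causality speaks about regular conditional laws, whose existence is shown in
  \<open>exists_regular_cond_law\<close>.
\<close>

section \<open>Linear functionals below sublinear ones\<close>

definition function_space :: "('a \<Rightarrow> real) set \<Rightarrow> bool" where
  "function_space V \<longleftrightarrow> (\<forall>f\<in>V. \<forall>g\<in>V. (\<lambda>x. f x + g x) \<in> V) \<and> (\<forall>f\<in>V. \<forall>a. (\<lambda>x. a * f x) \<in> V)"

definition sublinear_on :: "('a \<Rightarrow> real) set \<Rightarrow> (('a \<Rightarrow> real) \<Rightarrow> real) \<Rightarrow> bool" where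
  "sublinear_on V p \<longleftrightarrow> (\<forall>f\<in>V. \<forall>g\<in>V. p (\<lambda>x. f x + g x) \<le> p f + p g) \<and>
     (\<forall>f\<in>V. \<forall>a\<ge>0. p (\<lambda>x. a * f x) \<le> a * p f)"

definition linear_on :: "('a \<Rightarrow> real) set \<Rightarrow> (('a \<Rightarrow> real) \<Rightarrow> real) \<Rightarrow> bool" where
  "linear_on V L \<longleftrightarrow> (\<forall>f\<in>V. \<forall>g\<in>V. L (\<lambda>x. f x + g x) = L f + L g) \<and>
     (\<forall>f\<in>V. \<forall>a. L (\<lambda>x. a * f x) = a * L f)"

lemma function_space_add: "function_space V \<Longrightarrow> f \<in> V \<Longrightarrow> g \<in> V \<Longrightarrow> (\<lambda>x. f x + g x) \<in> V"
  and function_space_mult: "function_space V \<Longrightarrow> f \<in> V \<Longrightarrow> (\<lambda>x. a * f x) \<in> V"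
  by (auto simp: function_space_def)

lemma sublinear_on_add: "sublinear_on V p \<Longrightarrow> f \<in> V \<Longrightarrow> g \<in> V \<Longrightarrow> p (\<lambda>x. f x + g x) \<le> p f + p g"
  and sublinear_on_mult: "sublinear_on V p \<Longrightarrow> f \<in> V \<Longrightarrow> 0 \<le> a \<Longrightarrow> p (\<lambda>x. a * f x) \<le> a * p f"
  by (auto simp: sublinear_on_def)

lemma sublinear_on_zero:
  assumes "function_space V" "sublinear_on V p" "f \<in> V"
  shows "p (\<lambda>x. 0) = 0"
proof -
  have z: "(\<lambda>x. 0) \<in> V" using function_space_mult[OF assms(1,3), of 0] by simp
  show ?thesis
    using sublinear_on_mult[OF assms(2,3), of 0] sublinear_on_add[OF assms(2) z z] by simp
qed

lemma sublinear_on_minus: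
  assumes "function_space V" "sublinear_on V p" "f \<in> V"
  shows "- p (\<lambda>x. - f x) \<le> p f"
  using sublinear_on_add[OF assms(2,3) function_space_mult[OF assms(1,3), of "-1"]]
    sublinear_on_zero[OF assms] by simp

text \<open>
This is the Hahn-Banach theorem in the form that extends no functional: a pointwise minimal sublinear functional is
  linear. If \<open>m\<close> is minimal and \<open>y\<close> is given, then \<open>x \<mapsto> inf {m (x + t y) - t m y}\<close> over \<open>t \<ge> 0\<close> is again
  sublinear and below \<open>m\<close>, hence equal to \<open>m\<close>, and \<open>t = 1\<close> gives \<open>m x + m y \<le> m (x + y)\<close>.
\<close>

theorem exists_linear_below_sublinear:
  fixes V :: "('a \<Rightarrow> real) set"
  assumes V: "function_space V" and p: "sublinear_on V p"
  shows "\<exists>L. linear_on V L \<and> (\<forall>f\<in>V. L f \<le> p f)"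
proof -
  define \<S> where "\<S> = {q. sublinear_on V q \<and> (\<forall>f\<in>V. q f \<le> p f) \<and> (\<forall>f. f \<notin> V \<longrightarrow> q f = 0)}"
  define P :: "(('a \<Rightarrow> real) \<Rightarrow> real) \<Rightarrow> (('a \<Rightarrow> real) \<Rightarrow> real) \<Rightarrow> bool"
    where "P = (\<lambda>q r. \<forall>f\<in>V. r f \<le> q f)"
  have lower: "- p (\<lambda>x. - f x) \<le> q f" if "q \<in> \<S>" "f \<in> V" for q f
  proof -
    have "(\<lambda>x. - f x) \<in> V" using function_space_mult[OF V that(2), of "-1"] by simp
    then have "- p (\<lambda>x. - f x) \<le> - q (\<lambda>x. - f x)" using that by (auto simp: \<S>_def)
    also have "\<dots> \<le> q f" using sublinear_on_minus[OF V _ that(2)] that(1) by (auto simp: \<S>_def)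
    finally show ?thesis .
  qed
  have "\<exists>m\<in>\<S>. \<forall>a\<in>\<S>. P m a \<longrightarrow> a = m"
  proof (rule predicate_Zorn)
    show "partial_order_on \<S> (relation_of P \<S>)"
    proof (rule partial_order_on_relation_ofI)
      show "P a a" for a by (auto simp: P_def)
      show "P a c" if "P a b" "P b c" for a b c
        using that by (meson P_def order_trans)
      show "a = b" if "a \<in> \<S>" "b \<in> \<S>" "P a b" "P b a" for a b
      proof
        fix f show "a f = b f" using that by (cases "f \<in> V") (auto simp: P_def \<S>_def intro: antisym)
      qed
    qed
    fix C assume C: "C \<in> Chains (relation_of P \<S>)"
    then have sub: "C \<subseteq> \<S>" and tot: "\<And>q r. q \<in> C \<Longrightarrow> r \<in> C \<Longrightarrow> P q r \<or> P r q"
      by (auto simp: Chains_def relation_of_def)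
    show "\<exists>u\<in>\<S>. \<forall>a\<in>C. P a u"
    proof (cases "C = {}")
      case True
      have "(\<lambda>f. if f \<in> V then p f else 0) \<in> \<S>"
        using p V by (auto simp: \<S>_def sublinear_on_def function_space_def)
      then show ?thesis using True by auto
    next
      case False
      define u where "u = (\<lambda>f. if f \<in> V then (INF q\<in>C. q f) else 0)"
      have bdd: "bdd_below ((\<lambda>q. q f) ` C)" if "f \<in> V" for f
        using lower[OF _ that] sub by (intro bdd_belowI2[where m = "- p (\<lambda>x. - f x)"]) auto
      have ule: "u f \<le> q f" if "f \<in> V" "q \<in> C" for f q
        using bdd[OF that(1)] that by (auto simp: u_def intro: cINF_lower)
      have leu: "a \<le> u f" if "f \<in> V" "\<And>q. q \<in> C \<Longrightarrow> a \<le> q f" for f a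
        using that False by (auto simp: u_def intro: cINF_greatest)
      have "sublinear_on V u"
        unfolding sublinear_on_def
      proof safe
        fix f g assume fg: "f \<in> V" "g \<in> V"
        have "u (\<lambda>x. f x + g x) - q f \<le> r g" if qr: "q \<in> C" "r \<in> C" for q r
        proof -
          have S: "sublinear_on V q" "sublinear_on V r" using qr sub by (auto simp: \<S>_def)
          show ?thesis using tot[OF qr]
          proof
            assume "P q r"
            then have "r f \<le> q f" using fg by (auto simp: P_def)
            then show ?thesis using ule[OF function_space_add[OF V fg] qr(2)]
              sublinear_on_add[OF S(2) fg] by simp
          next
            assume "P r q"
            then have "q g \<le> r g" using fg by (auto simp: P_def)
            then show ?thesis using ule[OF function_space_add[OF V fg] qr(1)]
              sublinear_on_add[OF S(1) fg] by simp
          qed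
        qed
        then have "u (\<lambda>x. f x + g x) - q f \<le> u g" if "q \<in> C" for q
          using that fg by (intro leu) auto
        then have "u (\<lambda>x. f x + g x) - u g \<le> u f"
          using fg by (intro leu) (auto simp: algebra_simps)
        then show "u (\<lambda>x. f x + g x) \<le> u f + u g" by simp
      next
        fix f and a :: real assume f: "f \<in> V" and a: "0 \<le> a"
        have *: "u (\<lambda>x. a * f x) \<le> a * q f" if "q \<in> C" for q
        proof -
          have "sublinear_on V q" using that sub by (auto simp: \<S>_def)
          from ule[OF function_space_mult[OF V f, of a] that] sublinear_on_mult[OF this f a]
          show ?thesis by simp
        qed
        show "u (\<lambda>x. a * f x) \<le> a * u f"
        proof (cases "a = 0")
          case True
          then show ?thesis using * False by auto
        next
          case False
          then have "u (\<lambda>x. a * f x) / a \<le> u f"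
            using * a f by (intro leu) (auto simp: field_simps)
          then show ?thesis using False a by (auto simp: field_simps)
        qed
      qed
      moreover have "u f \<le> p f" if "f \<in> V" for f
      proof -
        obtain q where "q \<in> C" using False by auto
        then show ?thesis using ule[OF that \<open>q \<in> C\<close>] sub that by (force simp: \<S>_def)
      qed
      ultimately have "u \<in> \<S>" by (auto simp: \<S>_def u_def)
      then show ?thesis using ule by (auto simp: P_def intro!: bexI[of _ u])
    qed
  qed
  then obtain m where m: "m \<in> \<S>" and min: "\<And>q. q \<in> \<S> \<Longrightarrow> (\<And>f. f \<in> V \<Longrightarrow> q f \<le> m f) \<Longrightarrow> q = m"
    by (auto simp: P_def)
  have mS: "sublinear_on V m" and mp: "\<And>f. f \<in> V \<Longrightarrow> m f \<le> p f" using m by (auto simp: \<S>_def)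
  \<comment> \<open>Minimality enters through the functional \<open>q\<close>, which competes with \<open>m\<close>.\<close>
  have super: "m x + m y \<le> m (\<lambda>z. x z + y z)" if x: "x \<in> V" and y: "y \<in> V" for x y
  proof -
    define q where "q = (\<lambda>x. if x \<in> V then (INF t\<in>{0..}. m (\<lambda>z. x z + t * y z) - t * m y) else 0)"
    have ty: "(\<lambda>z. x z + t * y z) \<in> V" if "x \<in> V" for x t
      using function_space_add[OF V that function_space_mult[OF V y, of t]] by simp
    have low: "- m (\<lambda>z. - x z) \<le> m (\<lambda>z. x z + t * y z) - t * m y" if "x \<in> V" "0 \<le> t" for x t
    proof (cases "t = 0")
      case True
      then show ?thesis using sublinear_on_minus[OF V mS that(1)] by simp
    next
      case False
      have "m (\<lambda>z. (1/t) * (t * y z)) \<le> (1/t) * m (\<lambda>z. t * y z)"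
        using that by (intro sublinear_on_mult[OF mS] function_space_mult[OF V y]) auto
      then have "t * m y \<le> m (\<lambda>z. t * y z)" using False that(2) by (auto simp: field_simps)
      also have "\<dots> = m (\<lambda>z. (x z + t * y z) + (-1) * x z)" by simp
      also have "\<dots> \<le> m (\<lambda>z. x z + t * y z) + m (\<lambda>z. (-1) * x z)"
        by (intro sublinear_on_add[OF mS] ty function_space_mult[OF V] that)
      finally show ?thesis by simp
    qed
    have bdd: "bdd_below ((\<lambda>t. m (\<lambda>z. x z + t * y z) - t * m y) ` {0..})" if "x \<in> V" for x
      using low[OF that] by (intro bdd_belowI2[where m = "- m (\<lambda>z. - x z)"]) auto
    have qle: "q x \<le> m (\<lambda>z. x z + t * y z) - t * m y" if "x \<in> V" "0 \<le> t" for x t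
      using that cINF_lower[OF bdd[OF that(1)], of t] by (auto simp: q_def)
    have leq: "a \<le> q x" if "x \<in> V" "\<And>t. 0 \<le> t \<Longrightarrow> a \<le> m (\<lambda>z. x z + t * y z) - t * m y" for x a
      using that by (auto simp: q_def intro!: cINF_greatest)
    have "sublinear_on V q"
      unfolding sublinear_on_def
    proof safe
      fix f g assume fg: "f \<in> V" "g \<in> V"
      have "q (\<lambda>x. f x + g x) - (m (\<lambda>z. f z + s * y z) - s * m y) \<le> m (\<lambda>z. g z + t * y z) - t * m y"
        if "0 \<le> s" "0 \<le> t" for s t
      proof -
        have "q (\<lambda>x. f x + g x) \<le> m (\<lambda>z. (f z + g z) + (s + t) * y z) - (s + t) * m y"
          using that by (intro qle function_space_add[OF V] fg) auto
        also have "(\<lambda>z. (f z + g z) + (s + t) * y z) = (\<lambda>z. (f z + s * y z) + (g z + t * y z))"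
          by (auto simp: algebra_simps)
        also have "m \<dots> \<le> m (\<lambda>z. f z + s * y z) + m (\<lambda>z. g z + t * y z)"
          by (intro sublinear_on_add[OF mS] ty fg)
        finally show ?thesis by (simp add: algebra_simps)
      qed
      then have "q (\<lambda>x. f x + g x) - (m (\<lambda>z. f z + s * y z) - s * m y) \<le> q g" if "0 \<le> s" for s
        using that fg by (intro leq) auto
      then have "q (\<lambda>x. f x + g x) - q g \<le> q f"
        using fg by (intro leq) (auto simp: algebra_simps)
      then show "q (\<lambda>x. f x + g x) \<le> q f + q g" by simp
    next
      fix f and a :: real assume f: "f \<in> V" and a: "0 \<le> a"
      have *: "q (\<lambda>x. a * f x) \<le> a * (m (\<lambda>z. f z + t * y z) - t * m y)" if "0 \<le> t" for t
      proof -
        have "q (\<lambda>x. a * f x) \<le> m (\<lambda>z. a * f z + (a * t) * y z) - (a * t) * m y"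
          using that a by (intro qle function_space_mult[OF V] f) auto
        also have "(\<lambda>z. a * f z + (a * t) * y z) = (\<lambda>z. a * (f z + t * y z))"
          by (auto simp: algebra_simps)
        also have "m \<dots> \<le> a * m (\<lambda>z. f z + t * y z)"
          by (intro sublinear_on_mult[OF mS] ty f a)
        finally show ?thesis by (simp add: algebra_simps)
      qed
      show "q (\<lambda>x. a * f x) \<le> a * q f"
      proof (cases "a = 0")
        case True
        then show ?thesis using *[of 0] by auto
      next
        case False
        then have "q (\<lambda>x. a * f x) / a \<le> q f"
          using * a f by (intro leq) (auto simp: field_simps)
        then show ?thesis using False a by (auto simp: field_simps)
      qed
    qed
    moreover have qm: "q f \<le> m f" if "f \<in> V" for f using qle[OF that, of 0] by simp
    moreover have "q f \<le> p f" if "f \<in> V" for f using qm[OF that] mp[OF that] by simp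
    ultimately have "q = m" by (intro min) (auto simp: \<S>_def q_def)
    then show ?thesis using qle[OF x, of 1] by simp
  qed
  have add: "m (\<lambda>z. x z + y z) = m x + m y" if "x \<in> V" "y \<in> V" for x y
    using super[OF that] sublinear_on_add[OF mS that] by simp
  have neg: "m (\<lambda>z. - x z) = - m x" if "x \<in> V" for x
    using add[OF that, of "\<lambda>z. - x z"] function_space_mult[OF V that, of "-1"]
      sublinear_on_zero[OF V mS that] by simp
  have pos: "m (\<lambda>z. a * x z) = a * m x" if "x \<in> V" "0 \<le> a" for x a
  proof -
    have "m (\<lambda>z. - (a * x z)) \<le> a * m (\<lambda>z. - x z)"
      using sublinear_on_mult[OF mS function_space_mult[OF V that(1), of "-1"] that(2)] by simp
    then show ?thesis
      using sublinear_on_mult[OF mS that] neg[OF that(1)] neg[OF function_space_mult[OF V that(1), of a]]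
      by simp
  qed
  have "m (\<lambda>z. a * x z) = a * m x" if "x \<in> V" for x a
  proof (cases "0 \<le> a")
    case False
    then have "m (\<lambda>z. - ((-a) * x z)) = - ((-a) * m x)"
      using pos[OF that, of "-a"] neg[OF function_space_mult[OF V that, of "-a"]] by simp
    then show ?thesis by simp
  qed (use pos that in auto)
  then show ?thesis using add mp by (intro exI[of _ m]) (auto simp: linear_on_def)
qed

section \<open>Measures from tight positive functionals\<close>

text \<open>
Functions on \<open>\<Omega>\<close> are represented by functions on the whole type; only their values on \<open>\<Omega>\<close> are controlled.
\<close>

definition bounded_funs :: "'a set \<Rightarrow> ('a \<Rightarrow> real) set" where
  "bounded_funs \<Omega> = {f. bounded (f ` \<Omega>)}"

lemma bounded_funs_iff: "f \<in> bounded_funs \<Omega> \<longleftrightarrow> (\<exists>B. \<forall>z\<in>\<Omega>. \<bar>f z\<bar> \<le> B)"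
  by (auto simp: bounded_funs_def bounded_iff)

lemma function_space_bounded_funs: "function_space (bounded_funs \<Omega>)"
  unfolding function_space_def
proof safe
  fix f g :: "'a \<Rightarrow> real" assume "f \<in> bounded_funs \<Omega>" "g \<in> bounded_funs \<Omega>"
  then obtain A B where "\<forall>z\<in>\<Omega>. \<bar>f z\<bar> \<le> A" "\<forall>z\<in>\<Omega>. \<bar>g z\<bar> \<le> B" by (auto simp: bounded_funs_iff)
  then have "\<forall>z\<in>\<Omega>. \<bar>f z + g z\<bar> \<le> A + B" by fastforce
  then show "(\<lambda>x. f x + g x) \<in> bounded_funs \<Omega>" unfolding bounded_funs_iff by blast
next
  fix f :: "'a \<Rightarrow> real" and a assume "f \<in> bounded_funs \<Omega>"
  then obtain A where "\<forall>z\<in>\<Omega>. \<bar>f z\<bar> \<le> A" by (auto simp: bounded_funs_iff)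
  then have "\<forall>z\<in>\<Omega>. \<bar>a * f z\<bar> \<le> \<bar>a\<bar> * A" by (simp add: abs_mult mult_left_mono)
  then show "(\<lambda>x. a * f x) \<in> bounded_funs \<Omega>" unfolding bounded_funs_iff by blast
qed

lemma bounded_funs_const: "(\<lambda>_. c) \<in> bounded_funs \<Omega>"
  by (auto simp: bounded_funs_iff)

lemma bounded_funs_indicator: "indicat_real A \<in> bounded_funs \<Omega>"
  unfolding bounded_funs_iff by (intro exI[of _ 1]) (auto simp: indicator_def)

text \<open>
Let \<open>L\<close> be a positive functional on all bounded functions on \<open>\<Omega>\<close>, measurable or not. Then \<open>A \<mapsto> L 1\<^sub>A\<close> is a finitely additive content on all
  subsets of \<open>\<Omega>\<close>. It need not be countably additive, but it is on an algebra of sets that is rich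
  enough to determine \<open>L\<close> on the bounded continuous functions.
\<close>

locale tight_positive_functional =
  fixes \<Omega> :: "'a::metric_space set" and L :: "('a \<Rightarrow> real) \<Rightarrow> real"
  assumes linear: "linear_on (bounded_funs \<Omega>) L"
    and pos: "f \<in> bounded_funs \<Omega> \<Longrightarrow> (\<And>z. z \<in> \<Omega> \<Longrightarrow> 0 \<le> f z) \<Longrightarrow> 0 \<le> L f"
    and one: "L (\<lambda>_. 1) = 1"
    and tight: "0 < e \<Longrightarrow> \<exists>K. compact K \<and> K \<subseteq> \<Omega> \<and> L (indicat_real (\<Omega> - K)) < e"
begin

lemma add: "f \<in> bounded_funs \<Omega> \<Longrightarrow> g \<in> bounded_funs \<Omega> \<Longrightarrow> L (\<lambda>x. f x + g x) = L f + L g"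
  and mult: "f \<in> bounded_funs \<Omega> \<Longrightarrow> L (\<lambda>x. a * f x) = a * L f"
  using linear by (auto simp: linear_on_def)

lemma const: "L (\<lambda>_. c) = c"
  using mult[OF bounded_funs_const, of c 1] one by simp

lemma mono:
  assumes "f \<in> bounded_funs \<Omega>" "g \<in> bounded_funs \<Omega>" "\<And>z. z \<in> \<Omega> \<Longrightarrow> f z \<le> g z"
  shows "L f \<le> L g"
proof -
  have m: "(\<lambda>x. -1 * f x) \<in> bounded_funs \<Omega>" by (rule function_space_mult[OF function_space_bounded_funs assms(1)])
  have "0 \<le> L (\<lambda>x. g x + -1 * f x)"
    using assms by (intro pos function_space_add[OF function_space_bounded_funs] m) auto
  also have "\<dots> = L g + -1 * L f" unfolding add[OF assms(2) m] mult[OF assms(1)] ..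
  finally show ?thesis by simp
qed

lemma diff_bound:
  assumes "f \<in> bounded_funs \<Omega>" "g \<in> bounded_funs \<Omega>" "\<And>z. z \<in> \<Omega> \<Longrightarrow> \<bar>f z - g z\<bar> \<le> e"
  shows "\<bar>L f - L g\<bar> \<le> e"
proof -
  note b = function_space_add[OF function_space_bounded_funs assms(1) bounded_funs_const]
    function_space_add[OF function_space_bounded_funs assms(2) bounded_funs_const]
  have "L f \<le> L (\<lambda>z. g z + e)" "L g \<le> L (\<lambda>z. f z + e)"
    using assms(3) by (intro mono b assms(1,2); force simp: abs_le_iff algebra_simps)+
  then show ?thesis
    using add[OF assms(1) bounded_funs_const, of e] add[OF assms(2) bounded_funs_const, of e] const[of e] by simp
qed

definition content :: "'a set \<Rightarrow> real" where
  "content A = L (indicat_real A)"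

lemma content_nonneg: "0 \<le> content A"
  unfolding content_def by (intro pos bounded_funs_indicator) auto

lemma content_mono: "A \<inter> \<Omega> \<subseteq> B \<Longrightarrow> content A \<le> content B"
  unfolding content_def by (intro mono bounded_funs_indicator) (auto simp: indicator_def)

lemma content_disjoint_Un: "A \<inter> B = {} \<Longrightarrow> content (A \<union> B) = content A + content B"
  using add[OF bounded_funs_indicator[of A] bounded_funs_indicator[of B]]
  by (simp add: content_def indicator_add)

lemma content_Un_le: "content (A \<union> B) \<le> content A + content B"
  using content_disjoint_Un[of A "B - A"] content_mono[of "B - A" B] by auto

lemma content_empty: "content {} = 0"
  using content_disjoint_Un[of "{}" "{}"] by simp

lemma content_UN_le:
  "content (\<Union>i\<in>{..n::nat}. A i) \<le> (\<Sum>i\<le>n. content (A i))"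
proof (induction n)
  case (Suc n)
  have "content (\<Union>i\<in>{..Suc n}. A i) \<le> content (\<Union>i\<in>{..n}. A i) + content (A (Suc n))"
    using content_Un_le[of "\<Union>i\<in>{..n}. A i" "A (Suc n)"] by (simp add: atMost_Suc Un_commute)
  then show ?case using Suc by simp
qed simp

definition inner_approximable :: "'a set \<Rightarrow> bool" where
  "inner_approximable A \<longleftrightarrow> (\<forall>e>0. \<exists>K. compact K \<and> K \<subseteq> A \<and> content (A - K) < e)"

text \<open>
These sets play the role of the sets with negligible boundary. Because approximation is required
  for a set and for its complement, they form an algebra.
\<close>

definition continuity_sets :: "'a set set" where
  "continuity_sets = {A. A \<subseteq> \<Omega> \<and> inner_approximable A \<and> inner_approximable (\<Omega> - A)}"

lemma inner_approximable_Un: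
  assumes "inner_approximable A" "inner_approximable B" shows "inner_approximable (A \<union> B)"
  unfolding inner_approximable_def
proof safe
  fix e :: real assume "0 < e"
  with assms obtain K J where KJ: "compact K" "K \<subseteq> A" "content (A - K) < e/2"
    "compact J" "J \<subseteq> B" "content (B - J) < e/2" by (meson inner_approximable_def half_gt_zero)
  have "content (A \<union> B - (K \<union> J)) \<le> content ((A - K) \<union> (B - J))" by (intro content_mono) auto
  also have "\<dots> < e" using content_Un_le[of "A - K" "B - J"] KJ by simp
  finally show "\<exists>K. compact K \<and> K \<subseteq> A \<union> B \<and> content (A \<union> B - K) < e"
    using KJ by (intro exI[of _ "K \<union> J"]) (auto intro: compact_Un)
qed

lemma inner_approximable_Int:
  assumes "inner_approximable A" "inner_approximable B" shows "inner_approximable (A \<inter> B)"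
  unfolding inner_approximable_def
proof safe
  fix e :: real assume "0 < e"
  with assms obtain K J where KJ: "compact K" "K \<subseteq> A" "content (A - K) < e/2"
    "compact J" "J \<subseteq> B" "content (B - J) < e/2" by (meson inner_approximable_def half_gt_zero)
  have "content (A \<inter> B - (K \<inter> J)) \<le> content ((A - K) \<union> (B - J))" by (intro content_mono) auto
  also have "\<dots> < e" using content_Un_le[of "A - K" "B - J"] KJ by simp
  finally show "\<exists>K. compact K \<and> K \<subseteq> A \<inter> B \<and> content (A \<inter> B - K) < e"
    using KJ by (intro exI[of _ "K \<inter> J"]) (auto intro: compact_Int)
qed

lemma inner_approximable_carrier: "inner_approximable \<Omega>"
  using tight by (auto simp: inner_approximable_def content_def)

lemma algebra_continuity_sets: "algebra \<Omega> continuity_sets"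
  unfolding algebra_iff_Un
proof safe
  show "{} \<in> continuity_sets" using inner_approximable_carrier
    by (auto simp: continuity_sets_def inner_approximable_def content_empty intro!: exI[of _ "{}"])
  fix A B assume A: "A \<in> continuity_sets"
  then show "\<Omega> - A \<in> continuity_sets" by (auto simp: continuity_sets_def double_diff)
  assume B: "B \<in> continuity_sets"
  have "\<Omega> - (A \<union> B) = (\<Omega> - A) \<inter> (\<Omega> - B)" by auto
  then show "A \<union> B \<in> continuity_sets" using A B
    by (auto simp: continuity_sets_def intro: inner_approximable_Un inner_approximable_Int)
qed (auto simp: continuity_sets_def)

text \<open>
Compactness gives countable additivity: if the sets decrease to the empty set, so do
  inner approximating compact sets, finitely many of which already have empty intersection. The
  approximation errors are chosen summable.
\<close>

lemma content_empty_continuous: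
  assumes A: "range A \<subseteq> continuity_sets" "decseq A" "(\<Inter>i. A i) = {}"
  shows "(\<lambda>i::nat. ennreal (content (A i))) \<longlonglongrightarrow> 0"
proof -
  have "(\<lambda>i. content (A i)) \<longlonglongrightarrow> 0"
  proof (rule LIMSEQ_I)
    fix e :: real assume e: "0 < e"
    have "\<exists>K. compact K \<and> K \<subseteq> A i \<and> content (A i - K) < e * (1/2)^Suc i" for i
    proof -
      have "0 < e * (1/2)^Suc i" using e by simp
      moreover have "inner_approximable (A i)" using A(1) by (auto simp: continuity_sets_def)
      ultimately show ?thesis unfolding inner_approximable_def by blast
    qed
    then obtain K where K: "\<And>i. compact (K i)" "\<And>i. K i \<subseteq> A i"
      "\<And>i. content (A i - K i) < e * (1/2)^Suc i" by metis
    have "z \<notin> \<Inter>(range K)" for z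
    proof
      assume "z \<in> \<Inter>(range K)"
      then have "z \<in> A i" for i using subsetD[OF K(2)[of i], of z] by simp
      then have "z \<in> (\<Inter>i. A i)" by simp
      then show False unfolding A(3) by simp
    qed
    then have "\<not> (K 0 \<inter> \<Inter>(range K) \<noteq> {})" by blast
    then have "\<exists>J. finite J \<and> K 0 \<inter> (\<Inter>i\<in>J. K i) = {}"
      using compact_imp_fip_image[OF K(1)[of 0], of UNIV K] compact_imp_closed[OF K(1)] by metis
    then obtain J where J: "finite J" "K 0 \<inter> (\<Inter>i\<in>J. K i) = {}" by blast
    define n where "n = Max (insert 0 J)"
    have Jn: "insert 0 J \<subseteq> {..n}" using J(1) by (auto simp: n_def)
    have "content (A i) < e" if "n \<le> i" for i
    proof -
      have "A i \<subseteq> (\<Union>j\<in>{..n}. A j - K j)"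
      proof
        fix z assume z: "z \<in> A i"
        have "\<exists>j\<in>insert 0 J. z \<notin> K j" using J(2) by auto
        then obtain j where j: "j \<le> n" "z \<notin> K j" using Jn by auto
        have "z \<in> A j" using z decseqD[OF A(2), of j i] j(1) that by auto
        then show "z \<in> (\<Union>j\<in>{..n}. A j - K j)" using j by auto
      qed
      then have "content (A i) \<le> content (\<Union>j\<in>{..n}. A j - K j)" by (intro content_mono) auto
      also have "\<dots> \<le> (\<Sum>j\<le>n. content (A j - K j))" by (rule content_UN_le)
      also have "\<dots> < (\<Sum>j\<le>n. e * (1/2)^Suc j)" by (intro sum_strict_mono K(3)) auto
      also have "\<dots> = e * (\<Sum>j\<le>n. (1/2)^Suc j)" by (simp add: sum_distrib_left)
      also have "(\<Sum>j\<le>n. (1/2::real)^Suc j) \<le> 1"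
      proof -
        have "(\<Sum>j\<le>n. (1/2::real)^Suc j) = 1 - (1/2)^Suc n" by (induction n) auto
        then show ?thesis by simp
      qed
      finally show ?thesis using e by simp
    qed
    then show "\<exists>n0. \<forall>n\<ge>n0. norm (content (A n) - 0) < e"
      using content_nonneg by (intro exI[of _ n]) simp
  qed
  then show ?thesis by (metis ennreal_0 tendsto_ennrealI)
qed

text \<open>
At a continuity point \<open>a\<close> of the content of \<open>{f > a}\<close>, the closed sets \<open>{f \<ge> b}\<close> with
  \<open>b\<close> slightly above \<open>a\<close> exhaust \<open>{f > a}\<close>. The complement \<open>{f \<le> a}\<close> is closed, so tightness
  alone deals with it.
\<close>

lemma level_set_in_continuity_sets:
  fixes f :: "'a \<Rightarrow> real"
  assumes f: "continuous_on \<Omega> f" and a: "isCont (\<lambda>a. content {z\<in>\<Omega>. a < f z}) a"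
  shows "{z\<in>\<Omega>. a < f z} \<in> continuity_sets"
proof -
  have cl: "compact (K \<inter> {z\<in>\<Omega>. f z \<in> S})" if "compact K" "K \<subseteq> \<Omega>" "closed S" for K and S :: "real set"
  proof -
    have "closedin (top_of_set K) (K \<inter> f -` S)"
      using continuous_closedin_preimage[OF continuous_on_subset[OF f that(2)] that(3)] .
    moreover have "K \<inter> f -` S = K \<inter> {z\<in>\<Omega>. f z \<in> S}" using that(2) by auto
    ultimately show ?thesis using closedin_compact[OF that(1)] by auto
  qed
  have "inner_approximable {z\<in>\<Omega>. a < f z}"
    unfolding inner_approximable_def
  proof safe
    fix e :: real assume e: "0 < e"
    obtain d where d: "d > 0" "\<And>b. \<bar>b - a\<bar> < d \<Longrightarrow> \<bar>content {z\<in>\<Omega>. b < f z} - content {z\<in>\<Omega>. a < f z}\<bar> < e/2"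
    proof -
      have "\<exists>d>0. \<forall>b. dist b a < d \<longrightarrow> dist (content {z\<in>\<Omega>. b < f z}) (content {z\<in>\<Omega>. a < f z}) < e/2"
        using a half_gt_zero[OF e] unfolding continuous_at_eps_delta by blast
      then show ?thesis using that unfolding dist_real_def by blast
    qed
    obtain K where K: "compact K" "K \<subseteq> \<Omega>" "content (\<Omega> - K) < e/2"
      using tight[of "e/2"] e by (auto simp: content_def)
    define b where "b = a + d/2"
    have b: "a < b" "content {z\<in>\<Omega>. a < f z} - content {z\<in>\<Omega>. b < f z} < e/2"
      using d(1) d(2)[of b] by (simp_all add: b_def abs_less_iff del: less_divide_eq_numeral1)
    have "{z\<in>\<Omega>. a < f z} = {z\<in>\<Omega>. a < f z \<and> f z \<le> b} \<union> {z\<in>\<Omega>. b < f z}" using b by auto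
    then have "content {z\<in>\<Omega>. a < f z} = content {z\<in>\<Omega>. a < f z \<and> f z \<le> b} + content {z\<in>\<Omega>. b < f z}"
      using content_disjoint_Un[of "{z\<in>\<Omega>. a < f z \<and> f z \<le> b}" "{z\<in>\<Omega>. b < f z}"] by fastforce
    then have 1: "content {z\<in>\<Omega>. a < f z \<and> f z \<le> b} < e/2" using b by simp
    have "content ({z\<in>\<Omega>. a < f z} - (K \<inter> {z\<in>\<Omega>. f z \<in> {b..}}))
        \<le> content ({z\<in>\<Omega>. a < f z \<and> f z \<le> b} \<union> (\<Omega> - K))" by (intro content_mono) auto
    also have "\<dots> < e" using content_Un_le[of "{z\<in>\<Omega>. a < f z \<and> f z \<le> b}" "\<Omega> - K"] 1 K(3) by simp
    finally show "\<exists>K. compact K \<and> K \<subseteq> {z \<in> \<Omega>. a < f z} \<and> content ({z \<in> \<Omega>. a < f z} - K) < e"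
      using cl[OF K(1,2) closed_atLeast[of b]] b(1)
      by (intro exI[of _ "K \<inter> {z\<in>\<Omega>. f z \<in> {b..}}"]) auto
  qed
  moreover have "inner_approximable (\<Omega> - {z\<in>\<Omega>. a < f z})"
    unfolding inner_approximable_def
  proof safe
    fix e :: real assume e: "0 < e"
    obtain K where K: "compact K" "K \<subseteq> \<Omega>" "content (\<Omega> - K) < e"
      using tight[of e] e by (auto simp: content_def)
    have "content (\<Omega> - {z\<in>\<Omega>. a < f z} - (K \<inter> {z\<in>\<Omega>. f z \<in> {..a}})) \<le> content (\<Omega> - K)"
      by (intro content_mono) auto
    then show "\<exists>K. compact K \<and> K \<subseteq> \<Omega> - {z \<in> \<Omega>. a < f z} \<and> content (\<Omega> - {z \<in> \<Omega>. a < f z} - K) < e"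
      using cl[OF K(1,2) closed_atMost[of a]] K(3)
      by (intro exI[of _ "K \<inter> {z\<in>\<Omega>. f z \<in> {..a}}"]) auto
  qed
  ultimately show ?thesis by (auto simp: continuity_sets_def)
qed

text \<open>
The content of \<open>{f > a}\<close> is monotone in \<open>a\<close>, so that all but countably many levels are continuity points.
\<close>

lemma exists_continuity_level:
  fixes f :: "'a \<Rightarrow> real" assumes f: "continuous_on \<Omega> f" and ab: "a < b"
  shows "\<exists>c. a < c \<and> c < b \<and> {z\<in>\<Omega>. c < f z} \<in> continuity_sets"
proof -
  have "mono (\<lambda>c. - content {z\<in>\<Omega>. c < f z})"
    by (intro monoI) (auto intro: content_mono)
  then have "countable {c. \<not> isCont (\<lambda>c. - content {z\<in>\<Omega>. c < f z}) c}" by (rule mono_ctble_discont)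
  then have "\<not> {a<..<b} \<subseteq> {c. \<not> isCont (\<lambda>c. - content {z\<in>\<Omega>. c < f z}) c}"
    using uncountable_open_interval[of a b] ab countable_subset by blast
  then obtain c where c: "a < c" "c < b" "isCont (\<lambda>c. - content {z\<in>\<Omega>. c < f z}) c" by auto
  then have "isCont (\<lambda>c. content {z\<in>\<Omega>. c < f z}) c"
    using continuous_minus[OF c(3)] by simp
  then show ?thesis using c level_set_in_continuity_sets[OF f] by blast
qed

text \<open>
With one continuity level \<open>c k\<close> in each interval \<open>(k e, (k + 1) e)\<close>, the number of levels below
  \<open>f z\<close> is \<open>\<lfloor>f z / e\<rfloor>\<close> or one more. This writes \<open>f\<close> up to \<open>e\<close> as a combination of
  indicators on which \<open>L\<close> and the measure agree.
\<close>

lemma exists_step_approximation: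
  assumes f: "continuous_on \<Omega> f" and B: "\<And>z. z \<in> \<Omega> \<Longrightarrow> 0 \<le> f z \<and> f z < real n * e" and e: "0 < e"
  shows "\<exists>C. (\<forall>k. C k \<in> continuity_sets) \<and>
    (\<forall>z\<in>\<Omega>. \<bar>f z - (\<Sum>k<n. e * indicat_real (C k) z)\<bar> \<le> e)"
proof -
  have "\<exists>c. real k * e < c \<and> c < (real k + 1) * e \<and> {z\<in>\<Omega>. c < f z} \<in> continuity_sets" for k
    using e by (intro exists_continuity_level[OF f]) simp
  then obtain c where c: "\<And>k. real k * e < c k" "\<And>k. c k < (real k + 1) * e"
    "\<And>k. {z\<in>\<Omega>. c k < f z} \<in> continuity_sets" by metis
  have "\<bar>f z - (\<Sum>k<n. e * indicat_real {z\<in>\<Omega>. c k < f z} z)\<bar> \<le> e" if z: "z \<in> \<Omega>" for z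
  proof -
    define j where "j = nat \<lfloor>f z / e\<rfloor>"
    have "0 \<le> f z / e" using B[OF z] e by simp
    then have "real j \<le> f z / e" "f z / e < real j + 1" by (auto simp: j_def)
    then have j: "real j * e \<le> f z" "f z < (real j + 1) * e" using e by (auto simp: field_simps)
    have "real j * e < real n * e" using j B[OF z] by linarith
    then have jn: "j < n" using e by simp
    have small: "c k < f z" if "k < j" for k
    proof -
      have "(real k + 1) * e \<le> real j * e" using that e by (intro mult_right_mono) auto
      then show ?thesis using c(2)[of k] j by linarith
    qed
    have big: "\<not> c k < f z" if "j < k" for k
    proof -
      have "(real j + 1) * e \<le> real k * e" using that e by (intro mult_right_mono) auto
      then show ?thesis using c(1)[of k] j by linarith
    qed
    have "(\<Sum>k<n. e * indicat_real {z\<in>\<Omega>. c k < f z} z) = (\<Sum>k<n. if c k < f z then e else 0)"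
      using z by (intro sum.cong) auto
    also have "\<dots> = e * card {k. k < n \<and> c k < f z}"
      by (simp add: sum.If_cases) (simp add: Int_def lessThan_def)
    finally have s: "(\<Sum>k<n. e * indicat_real {z\<in>\<Omega>. c k < f z} z) = e * card {k. k < n \<and> c k < f z}" .
    have "{..<j} \<subseteq> {k. k < n \<and> c k < f z}" "{k. k < n \<and> c k < f z} \<subseteq> {..j}"
      using small big jn by (auto simp: not_less[symmetric])
    then have "card {..<j} \<le> card {k. k < n \<and> c k < f z}" "card {k. k < n \<and> c k < f z} \<le> card {..j}"
      by (intro card_mono; simp)+
    then have "real j \<le> card {k. k < n \<and> c k < f z}" "card {k. k < n \<and> c k < f z} \<le> real j + 1" by auto
    then have "e * real j \<le> e * card {k. k < n \<and> c k < f z}"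
      "e * card {k. k < n \<and> c k < f z} \<le> e * (real j + 1)"
      using e by (auto intro: mult_left_mono)
    with j show ?thesis unfolding s abs_le_iff
      by (simp only: distrib_left distrib_right mult_1_right mult_1_left mult.commute[of e]) linarith
  qed
  then show ?thesis using c(3) by (intro exI[of _ "\<lambda>k. {z\<in>\<Omega>. c k < f z}"]) auto
qed

lemma L_sum_indicator: "L (\<lambda>z. \<Sum>k<(n::nat). e * indicat_real (C k) z) = (\<Sum>k<n. e * content (C k))"
proof -
  have b: "(\<lambda>z. \<Sum>k<(m::nat). e * indicat_real (C k) z) \<in> bounded_funs \<Omega>" for m
  proof (induction m)
    case (Suc m)
    then show ?case
      using function_space_add[OF function_space_bounded_funs Suc
        function_space_mult[OF function_space_bounded_funs bounded_funs_indicator]] by simp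
  qed (simp add: bounded_funs_const)
  show ?thesis
  proof (induction n)
    case (Suc n)
    have "L (\<lambda>z. \<Sum>k<Suc n. e * indicat_real (C k) z) =
       L (\<lambda>z. \<Sum>k<n. e * indicat_real (C k) z) + L (\<lambda>z. e * indicat_real (C n) z)"
      unfolding sum.lessThan_Suc
      by (intro add b function_space_mult[OF function_space_bounded_funs bounded_funs_indicator])
    then show ?case using Suc mult[OF bounded_funs_indicator, of e "C n"] by (simp add: content_def)
  qed (simp add: const)
qed

text \<open>
Riesz representation. The Caratheodory extension of the content from the algebra of continuity
  sets is a measure; open sets are measurable for it since they are countable unions
  of level sets of distance functions.
\<close>

theorem representing_measure:
  "\<exists>\<gamma>. prob_space \<gamma> \<and> sets \<gamma> = sets (restrict_space borel \<Omega>) \<and>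
     (\<forall>f\<in>bounded_funs \<Omega>. continuous_on \<Omega> f \<longrightarrow> (\<integral>z. f z \<partial>\<gamma>) = L f)"
proof -
  interpret algebra \<Omega> continuity_sets by (rule algebra_continuity_sets)
  have "\<exists>\<mu>. (\<forall>A\<in>continuity_sets. \<mu> A = ennreal (content A)) \<and>
      measure_space \<Omega> (sigma_sets \<Omega> continuity_sets) \<mu>"
  proof (rule caratheodory_empty_continuous)
    show "positive continuity_sets (\<lambda>A. ennreal (content A))"
      by (simp add: positive_def content_empty)
    show "additive continuity_sets (\<lambda>A. ennreal (content A))"
      by (auto simp: additive_def content_disjoint_Un content_nonneg)
  qed (auto intro: content_empty_continuous)
  then obtain \<mu>0 where \<mu>0: "\<And>A. A \<in> continuity_sets \<Longrightarrow> \<mu>0 A = ennreal (content A)"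
    "measure_space \<Omega> (sigma_sets \<Omega> continuity_sets) \<mu>0" by auto
  define M where "M = measure_of \<Omega> continuity_sets \<mu>0"
  have sub: "continuity_sets \<subseteq> Pow \<Omega>" by (auto simp: continuity_sets_def)
  have spM: "space M = \<Omega>" and setsM: "sets M = sigma_sets \<Omega> continuity_sets"
    using sub by (auto simp: M_def)
  have eM: "emeasure M A = ennreal (content A)" if "A \<in> continuity_sets" for A
  proof -
    have "emeasure M A = \<mu>0 A"
      using \<mu>0(2) that sub
      by (intro emeasure_measure_of[OF M_def]) (auto simp: measure_space_def setsM)
    then show ?thesis using \<mu>0(1)[OF that] by simp
  qed
  have "content \<Omega> = L (\<lambda>_. 1)" unfolding content_def
    by (intro antisym mono bounded_funs_indicator bounded_funs_const) auto
  then have "emeasure M (space M) = 1" using eM[OF top] spM one by simp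
  then interpret M: prob_space M by (rule prob_spaceI)
  have mM: "measure M A = content A" "A \<in> sets M" if "A \<in> continuity_sets" for A
    using eM[OF that] content_nonneg that by (auto simp: measure_def setsM)
  have level: "{z\<in>\<Omega>. a < f z} \<in> sets M" if f: "continuous_on \<Omega> f" for f and a :: real
  proof -
    have "\<exists>c. a < c \<and> c < a + inverse (Suc n) \<and> {z\<in>\<Omega>. c < f z} \<in> continuity_sets" for n :: nat
      by (intro exists_continuity_level[OF f]) simp
    then obtain c where c: "\<And>n. a < c n" "\<And>n. c n < a + inverse (Suc n)"
      "\<And>n. {z\<in>\<Omega>. c n < f z} \<in> continuity_sets" by metis
    have "{z\<in>\<Omega>. a < f z} = (\<Union>n. {z\<in>\<Omega>. c n < f z})"
    proof safe
      fix z assume "z \<in> \<Omega>" "a < f z"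
      then obtain n where "inverse (real (Suc n)) < f z - a" using reals_Archimedean[of "f z - a"] by auto
      then have "c n < f z" using c(2)[of n] by simp
      then show "z \<in> (\<Union>n. {z\<in>\<Omega>. c n < f z})" using \<open>z \<in> \<Omega>\<close> by auto
    next
      fix z n assume "c n < f z" then show "a < f z" using c(1)[of n] by simp
    qed
    then show ?thesis using mM(2)[OF c(3)] by auto
  qed
  have id: "(\<lambda>z. z) \<in> M \<rightarrow>\<^sub>M restrict_space borel \<Omega>"
  proof (rule measurable_restrict_space2)
    show "(\<lambda>z. z) \<in> M \<rightarrow>\<^sub>M borel"
    proof (rule borel_measurableI)
      fix S :: "'a set" assume S: "open S"
      show "(\<lambda>z. z) -` S \<inter> space M \<in> sets M"
      proof (cases "S = UNIV")
        case False
        have "{z\<in>\<Omega>. 0 < infdist z (- S)} \<in> sets M"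
          by (intro level continuous_intros)
        moreover have "{z\<in>\<Omega>. 0 < infdist z (- S)} = (\<lambda>z. z) -` S \<inter> space M"
          using in_closed_iff_infdist_zero[of "- S"] S False infdist_nonneg[of _ "- S"]
          by (auto simp: spM closed_def less_le)
        ultimately show ?thesis by simp
      qed simp
    qed
  qed (simp add: spM)
  define \<gamma> where "\<gamma> = distr M (restrict_space borel \<Omega>) (\<lambda>z. z)"
  interpret \<gamma>: prob_space \<gamma> unfolding \<gamma>_def by (rule M.prob_space_distr[OF id])
  have "(\<integral>z. f z \<partial>\<gamma>) = L f" if fb: "f \<in> bounded_funs \<Omega>" and f: "continuous_on \<Omega> f" for f
  proof -
    have fm: "f \<in> borel_measurable (restrict_space borel \<Omega>)"
      using f by (rule borel_measurable_continuous_on_restrict)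
    have fM: "f \<in> borel_measurable M" using measurable_compose[OF id fm] by simp
    have \<gamma>f: "(\<integral>z. f z \<partial>\<gamma>) = (\<integral>z. f z \<partial>M)" unfolding \<gamma>_def by (rule integral_distr[OF id fm])
    obtain B where B: "\<And>z. z \<in> \<Omega> \<Longrightarrow> \<bar>f z\<bar> \<le> B" using fb by (auto simp: bounded_funs_iff)
    have intf: "integrable M f"
      using B fM by (intro M.integrable_const_bound[of _ B]) (auto simp: spM)
    have "\<bar>(\<integral>z. f z \<partial>M) - L f\<bar> \<le> 2 * e" if e: "0 < e" for e
    proof -
      obtain n :: nat where n: "2 * B / e < n" using reals_Archimedean2 by blast
      have cf: "continuous_on \<Omega> (\<lambda>z. f z + B)" using f by (intro continuous_intros)
      have r: "0 \<le> f z + B \<and> f z + B < real n * e" if "z \<in> \<Omega>" for z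
      proof -
        have "2 * B < real n * e" using n e by (simp add: field_simps)
        then show ?thesis using B[OF that] by (auto simp: abs_le_iff)
      qed
      obtain C where C: "\<And>k. C k \<in> continuity_sets"
        "\<And>z. z \<in> \<Omega> \<Longrightarrow> \<bar>f z + B - (\<Sum>k<n. e * indicat_real (C k) z)\<bar> \<le> e"
        using exists_step_approximation[OF cf r e] by blast
      have si: "integrable M (\<lambda>z. \<Sum>k<n. e * indicat_real (C k) z)"
        using mM(2)[OF C(1)] by (intro Bochner_Integration.integrable_sum integrable_mult_right M.integrable_const_bound[of _ 1]) auto
      have "(\<integral>z. (\<Sum>k<n. e * indicat_real (C k) z) \<partial>M) = (\<Sum>k<n. e * content (C k))"
        using mM[OF C(1)] M.emeasure_finite
        by (subst Bochner_Integration.integral_sum) (auto intro!: sum.cong integrable_mult_right M.integrable_const_bound[of _ 1])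
      then have 1: "(\<integral>z. (\<Sum>k<n. e * indicat_real (C k) z) \<partial>M) = L (\<lambda>z. \<Sum>k<n. e * indicat_real (C k) z)"
        unfolding L_sum_indicator .
      have "(\<lambda>z. \<Sum>k<n. e * indicat_real (C k) z) \<in> bounded_funs \<Omega>"
        unfolding bounded_funs_iff
        using e by (intro exI[of _ "\<Sum>k<n. e"] ballI order_trans[OF sum_abs] sum_mono) (auto simp: indicator_def)
      then have 2: "\<bar>L (\<lambda>z. f z + B) - L (\<lambda>z. \<Sum>k<n. e * indicat_real (C k) z)\<bar> \<le> e"
        using C(2) by (intro diff_bound function_space_add[OF function_space_bounded_funs] fb bounded_funs_const)
      have "\<bar>\<integral>z. (f z + B - (\<Sum>k<n. e * indicat_real (C k) z)) \<partial>M\<bar> \<le> (\<integral>z. \<bar>f z + B - (\<Sum>k<n. e * indicat_real (C k) z)\<bar> \<partial>M)"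
        by (rule integral_abs_bound)
      also have "\<dots> \<le> (\<integral>z. e \<partial>M)"
        using C(2) intf si by (intro integral_mono integrable_abs Bochner_Integration.integrable_diff Bochner_Integration.integrable_add) (auto simp: spM)
      also have "\<dots> = e" by (simp add: M.prob_space)
      finally have "\<bar>(\<integral>z. f z \<partial>M) + B - (\<integral>z. (\<Sum>k<n. e * indicat_real (C k) z) \<partial>M)\<bar> \<le> e"
        using intf si by (simp add: M.prob_space)
      then show ?thesis using 1 2 add[OF fb bounded_funs_const, of B] const[of B] by linarith
    qed
    then have "\<bar>(\<integral>z. f z \<partial>M) - L f\<bar> \<le> 0 + e" if "0 < e" for e
      using that by (metis add_0 field_sum_of_halves half_gt_zero mult_2)
    then have "\<bar>(\<integral>z. f z \<partial>M) - L f\<bar> \<le> 0" by (rule field_le_epsilon)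
    then show ?thesis using \<gamma>f by simp
  qed
  then show ?thesis using \<gamma>.prob_space_axioms
    by (intro exI[of _ \<gamma>]) (auto simp: \<gamma>_def)
qed

end

section \<open>Bounded continuous functions, lower semicontinuity and extended-real integrals\<close>

lemma lsc_measurable:
  fixes c :: "'a::topological_space \<Rightarrow> ereal"
  assumes "lower_semicontinuous (top_of_set \<Omega>) c"
  shows "c \<in> borel_measurable (restrict_space borel \<Omega>)"
proof (rule borel_measurableI_greater)
  fix a
  obtain T where T: "open T" "{z\<in>\<Omega>. a < c z} = \<Omega> \<inter> T"
    using assms by (auto simp: lower_semicontinuous_def openin_open)
  have "{w \<in> space (restrict_space borel \<Omega>). a < c w} = \<Omega> \<inter> T"
    using T by (simp add: space_restrict_space)
  then show "{w \<in> space (restrict_space borel \<Omega>). a < c w} \<in> sets (restrict_space borel \<Omega>)"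
    using T(1) by (auto simp: sets_restrict_space)
qed

text \<open>
Points near \<open>z\<close> have cost above \<open>a\<close> by lower semicontinuity, and points far from \<open>z\<close> pay
  at least \<open>a\<close> in the distance term once its weight is large.
\<close>

lemma infimal_convolution_below_lsc:
  fixes c :: "'a::metric_space \<Rightarrow> ereal"
  assumes lsc: "lower_semicontinuous (top_of_set \<Omega>) c" and b: "\<And>z. z \<in> \<Omega> \<Longrightarrow> ereal b \<le> c z"
    and z: "z \<in> \<Omega>" and a: "ereal a < c z"
  defines "f \<equiv> \<lambda>n z. INF w\<in>\<Omega>. real_of_ereal (min (c w) (ereal (real n))) + real n * dist z w"
  shows "\<exists>N. \<forall>n\<ge>N. a \<le> f n z"
proof -
  have "openin (top_of_set \<Omega>) {z\<in>\<Omega>. ereal a < c z}" using lsc by (auto simp: lower_semicontinuous_def)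
  then obtain d where d: "d > 0" "\<And>w. w \<in> \<Omega> \<Longrightarrow> dist w z < d \<Longrightarrow> ereal a < c w"
    using z a by (auto simp: openin_euclidean_subtopology_iff)
  obtain N :: nat where N: "max (max a \<bar>b\<bar>) ((a - b) / d) < real N" using reals_Archimedean2 by blast
  have "a \<le> f n z" if "N \<le> n" for n
  proof -
    have n: "max (max a \<bar>b\<bar>) ((a - b) / d) < real n" using N that by linarith
    have "a \<le> real_of_ereal (min (c w) (ereal (real n))) + real n * dist z w" if w: "w \<in> \<Omega>" for w
    proof (cases "dist w z < d")
      case True
      have "ereal a \<le> min (c w) (ereal (real n))" using d(2)[OF w True] n by (auto simp: less_imp_le)
      then have "a \<le> real_of_ereal (min (c w) (ereal (real n)))"
        by (cases "c w") (auto simp: min_def split: if_splits)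
      then show ?thesis by (simp add: add_increasing2)
    next
      case False
      have "ereal b \<le> min (c w) (ereal (real n))" using b[OF w] n by auto
      then have 1: "b \<le> real_of_ereal (min (c w) (ereal (real n)))"
        by (cases "c w") (auto simp: min_def split: if_splits)
      have "(a - b) / d < real n" using n by simp
      then have "a - b < real n * d" using d(1) by (simp add: field_simps)
      also have "\<dots> \<le> real n * dist z w" using False by (intro mult_left_mono) (auto simp: dist_commute)
      finally show ?thesis using 1 by simp
    qed
    then show ?thesis using z unfolding f_def by (intro cINF_greatest) auto
  qed
  then show ?thesis by blast
qed

text \<open>
The approximants are the infimal convolutions of the truncated function with multiples of the
  distance; they are Lipschitz.
\<close>

theorem lsc_eq_SUP_continuous:
  fixes c :: "'a::metric_space \<Rightarrow> ereal"
  assumes lsc: "lower_semicontinuous (top_of_set \<Omega>) c" and b: "\<And>z. z \<in> \<Omega> \<Longrightarrow> ereal b \<le> c z"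
  shows "\<exists>f. (\<forall>n::nat. continuous_on \<Omega> (f n) \<and> f n \<in> bounded_funs \<Omega>) \<and>
    (\<forall>z\<in>\<Omega>. incseq (\<lambda>n. f n z) \<and> (\<forall>n. b \<le> f n z) \<and> (SUP n. ereal (f n z)) = c z)"
proof -
  define m where "m n w = real_of_ereal (min (c w) (ereal (real n)))" for n w
  define f0 where "f0 n z = (INF w\<in>\<Omega>. m n w + real n * dist z w)" for n z
  obtain k :: nat where k: "\<bar>b\<bar> < real k" using reals_Archimedean2 by blast
  \<comment> \<open>The shift by \<open>k\<close> makes the truncation level exceed \<open>\<bar>b\<bar>\<close>, so that truncation preserves the lower bound \<open>b\<close>.\<close>
  define f where "f n = f0 (n + k)" for n
  have mlow: "b \<le> m n w" if "w \<in> \<Omega>" "k \<le> n" for w n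
  proof -
    have "ereal b \<le> min (c w) (ereal (real n))" using b[OF that(1)] k that(2) by auto
    then show ?thesis unfolding m_def by (cases "c w") (auto simp: min_def split: if_splits)
  qed
  have mupp: "ereal (m n w) \<le> c w" "m n w \<le> real n" if "w \<in> \<Omega>" for w n
    using b[OF that] unfolding m_def by (cases "c w"; auto simp: min_def)+
  have mmono: "m i w \<le> m j w" if "i \<le> j" "w \<in> \<Omega>" for i j w
    using b[OF that(2)] that(1) unfolding m_def by (cases "c w") (auto simp: min_def)
  have bdd: "bdd_below ((\<lambda>w. m (n + k) w + real (n + k) * dist z w) ` \<Omega>)" for n z
    using mlow by (intro bdd_belowI2[of _ b]) (auto intro!: add_increasing2)
  have le: "f n z \<le> m (n + k) w + real (n + k) * dist z w" if "w \<in> \<Omega>" for n z w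
    unfolding f_def f0_def by (intro cINF_lower[OF bdd] that)
  have ge: "a \<le> f n z" if "z \<in> \<Omega>" "\<And>w. w \<in> \<Omega> \<Longrightarrow> a \<le> m (n + k) w + real (n + k) * dist z w" for a n z
    unfolding f_def f0_def using that by (intro cINF_greatest) auto
  have lip: "f n z \<le> f n y + real (n + k) * dist z y" if "z \<in> \<Omega>" "y \<in> \<Omega>" for n z y
  proof -
    have "f n z - real (n + k) * dist z y \<le> f n y"
    proof (rule ge[OF that(2)])
      fix w assume w: "w \<in> \<Omega>"
      have "real (n + k) * dist z w \<le> real (n + k) * (dist z y + dist y w)"
        by (intro mult_left_mono dist_triangle) auto
      then show "f n z - real (n + k) * dist z y \<le> m (n + k) w + real (n + k) * dist y w"
        using le[OF w, of n z] by (simp only: distrib_left)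
    qed
    then show ?thesis by simp
  qed
  have "continuous_on \<Omega> (f n)" for n
  proof (rule lipschitz_on_continuous_on)
    show "(real (n + k))-lipschitz_on \<Omega> (f n)"
    proof (rule lipschitz_onI)
      fix x y assume "x \<in> \<Omega>" "y \<in> \<Omega>"
      then show "dist (f n x) (f n y) \<le> real (n + k) * dist x y"
        using lip[of x y n] lip[of y x n] by (simp add: dist_real_def abs_le_iff dist_commute)
    qed simp
  qed
  moreover have fb: "b \<le> f n z" if "z \<in> \<Omega>" for n z
    using mlow by (intro ge that) (auto intro!: add_increasing2)
  moreover have fm: "f n z \<le> m (n + k) z" if "z \<in> \<Omega>" for n z
    using le[OF that, of n z] by simp
  have "f n \<in> bounded_funs \<Omega>" for n
    unfolding bounded_funs_iff
  proof (intro exI ballI)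
    fix z assume "z \<in> \<Omega>"
    then show "\<bar>f n z\<bar> \<le> real (n + k) + \<bar>b\<bar>"
      using fm[of z n] fb[of z n] mupp(2)[of z "n + k"] by simp
  qed
  moreover have "incseq (\<lambda>n. f n z)" if "z \<in> \<Omega>" for z
  proof (intro monoI ge that)
    fix i j :: nat and w assume ij: "i \<le> j" and w: "w \<in> \<Omega>"
    have "real (i + k) * dist z w \<le> real (j + k) * dist z w" using ij by (intro mult_right_mono) auto
    then show "f i z \<le> m (j + k) w + real (j + k) * dist z w"
      using le[OF w, of i z] mmono[of "i + k" "j + k" w] ij w by simp
  qed
  moreover have "(SUP n. ereal (f n z)) = c z" if z: "z \<in> \<Omega>" for z
  proof (rule antisym)
    show "(SUP n. ereal (f n z)) \<le> c z"
      using fm[OF z] mupp(1)[OF z] by (intro SUP_least) (meson ereal_less_eq(3) order_trans)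
    show "c z \<le> (SUP n. ereal (f n z))"
    proof (rule dense_le)
      fix x assume x: "x < c z"
      show "x \<le> (SUP n. ereal (f n z))"
      proof (cases x)
        case (real a)
        then obtain N where "\<And>n. N \<le> n \<Longrightarrow> a \<le> f0 n z"
          using infimal_convolution_below_lsc[OF lsc b z, of a] x unfolding f0_def m_def by auto
        then have "a \<le> f N z" by (simp add: f_def)
        then show ?thesis using real by (intro SUP_upper2[of N]) auto
      qed (use x in auto)
    qed
  qed
  ultimately show ?thesis by (intro exI[of _ f]) auto
qed


text \<open>
The indicator of a nonempty closed set \<open>C\<close> is the decreasing limit of the functions
  \<open>max 0 (1 - n d(x, C))\<close>, and the closed sets are an intersection-stable generator.
\<close>

lemma measure_eqI_bounded_continuous:
  fixes M1 M2 :: "'a::metric_space measure"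
  assumes M: "finite_measure M1" "finite_measure M2" "sets M1 = sets borel" "sets M2 = sets borel"
    and eq: "\<And>h :: 'a \<Rightarrow> real. continuous_on UNIV h \<Longrightarrow> bounded (range h) \<Longrightarrow> (\<integral>x. h x \<partial>M1) = (\<integral>x. h x \<partial>M2)"
  shows "M1 = M2"
proof (rule measure_eqI_generator_eq[where \<Omega> = UNIV and E = "Collect closed" and A = "\<lambda>_. UNIV"])
  interpret M1: finite_measure M1 by fact
  interpret M2: finite_measure M2 by fact
  show "Int_stable (Collect closed :: 'a set set)" by (auto simp: Int_stable_def)
  show "sets M1 = sigma_sets UNIV (Collect closed)" "sets M2 = sigma_sets UNIV (Collect closed)"
    using M(3,4) by (simp_all add: borel_eq_closed)
  show "emeasure M1 UNIV \<noteq> \<infinity>" by simp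
  fix C :: "'a set" assume "C \<in> Collect closed"
  then have C: "closed C" by simp
  have "measure M1 C = measure M2 C"
  proof (cases "C = {}")
    case False
    define h where "h n x = max 0 (1 - real n * infdist x C)" for n x
    have ch: "continuous_on UNIV (h n)" for n unfolding h_def by (intro continuous_intros)
    have bh: "\<bar>h n x\<bar> \<le> 1" for n x using infdist_nonneg[of x C] by (auto simp: h_def max_def)
    have lim: "(\<lambda>n. h n x) \<longlonglongrightarrow> indicator C x" for x
    proof (cases "x \<in> C")
      case True
      then show ?thesis by (simp add: h_def)
    next
      case False
      then have p: "0 < infdist x C"
        using in_closed_iff_infdist_zero[OF C \<open>C \<noteq> {}\<close>] infdist_nonneg[of x C] by (auto simp: less_le)
      obtain N :: nat where N: "1 / infdist x C < real N" using reals_Archimedean2 by blast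
      have "h n x = 0" if "N \<le> n" for n
      proof -
        have "1 / infdist x C < real n" using N that by linarith
        then have "1 < real n * infdist x C" using p by (simp add: field_simps)
        then show ?thesis by (simp add: h_def)
      qed
      then have "\<forall>\<^sub>F n in sequentially. h n x = 0" by (auto simp: eventually_sequentially)
      then show ?thesis using False by (simp add: tendsto_eventually)
    qed
    have conv: "(\<lambda>n. \<integral>x. h n x \<partial>M) \<longlonglongrightarrow> measure M C" if "finite_measure M" and s: "sets M = sets borel" for M
    proof -
      interpret finite_measure M by fact
      have "(\<lambda>n. \<integral>x. h n x \<partial>M) \<longlonglongrightarrow> (\<integral>x. indicator C x \<partial>M)"
      proof (rule integral_dominated_convergence[where w = "\<lambda>_. 1"])
        show "h n \<in> borel_measurable M" for n
          unfolding measurable_cong_sets[OF s refl] by (rule borel_measurable_continuous_onI[OF ch])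
        show "indicat_real C \<in> borel_measurable M"
          unfolding measurable_cong_sets[OF s refl] using C by (intro borel_measurable_indicator) auto
      qed (use bh lim in auto)
      then show ?thesis using sets_eq_imp_space_eq[OF s] by simp
    qed
    have "(\<integral>x. h n x \<partial>M1) = (\<integral>x. h n x \<partial>M2)" for n
      using bh by (intro eq ch) (auto simp: bounded_iff)
    then show ?thesis
      using LIMSEQ_unique[OF conv[OF M(1,3)]] conv[OF M(2,4)] by simp
  qed simp
  then show "emeasure M1 C = emeasure M2 C"
    by (simp add: M1.emeasure_eq_measure M2.emeasure_eq_measure)
qed auto

text \<open>
The positive and the negative part of \<open>G\<close> are densities whose images under \<open>T\<close> are finite
  measures with the same integrals of bounded continuous functions.
\<close>

lemma integral_indicator_eq_0_if_continuous:
  fixes T :: "'a \<Rightarrow> 'b::metric_space" and G :: "'a \<Rightarrow> real"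
  assumes T: "T \<in> M \<rightarrow>\<^sub>M borel" and G: "integrable M G"
    and zero: "\<And>h :: 'b \<Rightarrow> real. continuous_on UNIV h \<Longrightarrow> bounded (range h) \<Longrightarrow> (\<integral>\<omega>. h (T \<omega>) * G \<omega> \<partial>M) = 0"
    and B: "B \<in> sets borel"
  shows "(\<integral>\<omega>. indicat_real B (T \<omega>) * G \<omega> \<partial>M) = 0"
proof -
  have Gm[measurable]: "G \<in> borel_measurable M" using G by auto
  define P where "P s = distr (density M (\<lambda>\<omega>. ennreal (max 0 (s * G \<omega>)))) borel T" for s :: real
  have mx: "integrable M (\<lambda>\<omega>. max 0 (s * G \<omega>))" for s using G by (intro integrable_max) auto
  have T': "T \<in> density M f \<rightarrow>\<^sub>M borel" for f using T by simp
  have intP: "(\<integral>x. h x \<partial>P s) = (\<integral>\<omega>. max 0 (s * G \<omega>) * h (T \<omega>) \<partial>M)"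
    if h: "h \<in> borel_measurable borel" for h :: "'b \<Rightarrow> real" and s
    unfolding P_def integral_distr[OF T' h] using measurable_compose[OF T h]
    by (intro integral_real_density) auto
  have fin: "finite_measure (P s)" for s
  proof (rule finite_measureI)
    have "emeasure (P s) (space (P s)) = (\<integral>\<^sup>+\<omega>. ennreal (max 0 (s * G \<omega>)) \<partial>M)"
      unfolding P_def using T by (simp add: emeasure_distr emeasure_density measurable_space cong: nn_integral_cong)
    also have "\<dots> < \<infinity>" using mx[of s] by (simp add: integrable_iff_bounded)
    finally show "emeasure (P s) (space (P s)) \<noteq> \<infinity>" by simp
  qed
  have diff: "(\<integral>\<omega>. h (T \<omega>) * G \<omega> \<partial>M) = (\<integral>x. h x \<partial>P 1) - (\<integral>x. h x \<partial>P (-1))"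
    if h: "h \<in> borel_measurable borel" "bounded (range h)" for h :: "'b \<Rightarrow> real"
  proof -
    have [measurable]: "(\<lambda>\<omega>. h (T \<omega>)) \<in> borel_measurable M" by (rule measurable_compose[OF T h(1)])
    obtain C where C: "\<And>x. \<bar>h x\<bar> \<le> C" using h(2) by (auto simp: bounded_iff)
    have i: "integrable M (\<lambda>\<omega>. max 0 (s * G \<omega>) * h (T \<omega>))" for s
    proof (rule Bochner_Integration.integrable_bound)
      show "integrable M (\<lambda>\<omega>. max 0 (s * G \<omega>) * C)" using mx[of s] by simp
      show "AE \<omega> in M. norm (max 0 (s * G \<omega>) * h (T \<omega>)) \<le> norm (max 0 (s * G \<omega>) * C)"
        by (intro AE_I2) (simp add: abs_mult mult_left_mono order_trans[OF C abs_ge_self])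
    qed measurable
    have "(\<integral>\<omega>. h (T \<omega>) * G \<omega> \<partial>M) = (\<integral>\<omega>. max 0 (1 * G \<omega>) * h (T \<omega>) - max 0 (-1 * G \<omega>) * h (T \<omega>) \<partial>M)"
      by (intro Bochner_Integration.integral_cong) (auto simp: max_def)
    also have "\<dots> = (\<integral>\<omega>. max 0 (1 * G \<omega>) * h (T \<omega>) \<partial>M) - (\<integral>\<omega>. max 0 (-1 * G \<omega>) * h (T \<omega>) \<partial>M)"
      by (rule Bochner_Integration.integral_diff[OF i i])
    finally show ?thesis by (simp only: intP[OF h(1)])
  qed
  have "P 1 = P (-1)"
  proof (rule measure_eqI_bounded_continuous[OF fin fin])
    fix h :: "'b \<Rightarrow> real" assume h: "continuous_on UNIV h" "bounded (range h)"
    show "(\<integral>x. h x \<partial>P 1) = (\<integral>x. h x \<partial>P (-1))"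
      using diff[OF borel_measurable_continuous_onI[OF h(1)] h(2)] zero[OF h] by simp
  qed (simp_all add: P_def)
  moreover have "bounded (range (indicat_real B))" by (auto simp: bounded_iff indicator_def intro!: exI[of _ 1])
  ultimately show ?thesis using diff[OF borel_measurable_indicator[OF B]] by simp
qed

text \<open>
Adding a constant to a function that is bounded below reduces its extended-real integral to a
  single nonnegative integral.
\<close>

lemma ereal_integral_eq_shifted:
  assumes "prob_space M" and f: "f \<in> borel_measurable M" and b: "0 \<le> b" "\<And>x. x \<in> space M \<Longrightarrow> ereal (- b) \<le> f x"
  shows "ereal_integral M f = enn2ereal (\<integral>\<^sup>+x. e2ennreal (f x + ereal b) \<partial>M) - ereal b"
proof -
  interpret prob_space M by fact
  have pw: "e2ennreal (x + ereal b) + e2ennreal (- x) = e2ennreal x + ennreal b"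
    if "ereal (- b) \<le> x" for x
  proof (cases x)
    case (real r)
    then have "- b \<le> r" using that by simp
    then show ?thesis using real b(1)
      by (cases "0 \<le> r") (auto simp: e2ennreal_ereal ennreal_neg ennreal_plus[symmetric] simp del: ennreal_plus)
  qed (use that in \<open>auto simp: e2ennreal_infty e2ennreal_neg\<close>)
  have [measurable]: "f \<in> borel_measurable M" by (rule f)
  have "(\<integral>\<^sup>+x. e2ennreal (f x + ereal b) \<partial>M) + (\<integral>\<^sup>+x. e2ennreal (- f x) \<partial>M) =
      (\<integral>\<^sup>+x. e2ennreal (f x + ereal b) + e2ennreal (- f x) \<partial>M)"
    by (intro nn_integral_add[symmetric]) auto
  also have "\<dots> = (\<integral>\<^sup>+x. e2ennreal (f x) + ennreal b \<partial>M)"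
    using pw b(2) by (intro nn_integral_cong) auto
  also have "\<dots> = (\<integral>\<^sup>+x. e2ennreal (f x) \<partial>M) + ennreal b"
    by (subst nn_integral_add) (auto simp: emeasure_space_1)
  finally have eq: "(\<integral>\<^sup>+x. e2ennreal (f x + ereal b) \<partial>M) + (\<integral>\<^sup>+x. e2ennreal (- f x) \<partial>M) =
    (\<integral>\<^sup>+x. e2ennreal (f x) \<partial>M) + ennreal b" .
  have "(\<integral>\<^sup>+x. e2ennreal (- f x) \<partial>M) \<le> (\<integral>\<^sup>+x. ennreal b \<partial>M)"
  proof (rule nn_integral_mono)
    fix x assume "x \<in> space M"
    then have "- f x \<le> ereal b" using b(2)[of x] by (cases "f x") auto
    then show "e2ennreal (- f x) \<le> ennreal b" using e2ennreal_mono[of "- f x" "ereal b"] by (simp add: e2ennreal_ereal)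
  qed
  then have "(\<integral>\<^sup>+x. e2ennreal (- f x) \<partial>M) \<le> ennreal b" by (simp add: emeasure_space_1)
  then obtain q where q: "(\<integral>\<^sup>+x. e2ennreal (- f x) \<partial>M) = ennreal q" "0 \<le> q"
    by (cases "\<integral>\<^sup>+x. e2ennreal (- f x) \<partial>M") (auto simp: top_unique)
  have "enn2ereal (\<integral>\<^sup>+x. e2ennreal (f x + ereal b) \<partial>M) + enn2ereal (\<integral>\<^sup>+x. e2ennreal (- f x) \<partial>M) =
    enn2ereal (\<integral>\<^sup>+x. e2ennreal (f x) \<partial>M) + enn2ereal (ennreal b)"
    using arg_cong[OF eq, of enn2ereal] by (simp add: plus_ennreal.rep_eq)
  then show ?thesis unfolding ereal_integral_def q(1) using q(2) b(1)
    by (cases "enn2ereal (\<integral>\<^sup>+x. e2ennreal (f x) \<partial>M)"; cases "enn2ereal (\<integral>\<^sup>+x. e2ennreal (f x + ereal b) \<partial>M)")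
       (auto simp: enn2ereal_ennreal)
qed

lemma integral_le_ereal_integral:
  assumes M: "prob_space M" and f: "f \<in> borel_measurable M" and b: "\<And>x. x \<in> space M \<Longrightarrow> ereal b \<le> f x"
    and u: "integrable M u" "\<And>x. x \<in> space M \<Longrightarrow> ereal (u x) \<le> f x"
  shows "ereal (\<integral>x. u x \<partial>M) \<le> ereal_integral M f"
proof -
  interpret prob_space M by fact
  have b': "ereal (- \<bar>b\<bar>) \<le> f x" if "x \<in> space M" for x
    using b[OF that] by (intro order_trans[OF _ b[OF that]]) simp
  have "ennreal (\<integral>x. u x + \<bar>b\<bar> \<partial>M) \<le> (\<integral>\<^sup>+x. ennreal (u x + \<bar>b\<bar>) \<partial>M)"
  proof -
    have "(\<integral>x. u x + \<bar>b\<bar> \<partial>M) \<le> (\<integral>x. max 0 (u x + \<bar>b\<bar>) \<partial>M)"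
      using u(1) by (intro integral_mono) auto
    then have "ennreal (\<integral>x. u x + \<bar>b\<bar> \<partial>M) \<le> ennreal (\<integral>x. max 0 (u x + \<bar>b\<bar>) \<partial>M)" by (rule ennreal_leI)
    also have "\<dots> = (\<integral>\<^sup>+x. ennreal (max 0 (u x + \<bar>b\<bar>)) \<partial>M)"
      using u(1) by (intro nn_integral_eq_integral[symmetric]) auto
    finally show ?thesis by (simp add: ennreal_max_0)
  qed
  also have "\<dots> \<le> (\<integral>\<^sup>+x. e2ennreal (f x + ereal \<bar>b\<bar>) \<partial>M)"
  proof (rule nn_integral_mono)
    fix x assume "x \<in> space M"
    then have "ereal (u x + \<bar>b\<bar>) \<le> f x + ereal \<bar>b\<bar>" using u(2)[of x] add_right_mono[of "ereal (u x)" "f x" "ereal \<bar>b\<bar>"] by simp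
    then show "ennreal (u x + \<bar>b\<bar>) \<le> e2ennreal (f x + ereal \<bar>b\<bar>)"
      using e2ennreal_mono by (fastforce simp: e2ennreal_ereal)
  qed
  finally have "ereal ((\<integral>x. u x \<partial>M) + \<bar>b\<bar>) \<le> enn2ereal (\<integral>\<^sup>+x. e2ennreal (f x + ereal \<bar>b\<bar>) \<partial>M)"
    using u(1) by (cases "(\<integral>\<^sup>+x. e2ennreal (f x + ereal \<bar>b\<bar>) \<partial>M)")
      (auto simp: prob_space enn2ereal_ennreal ennreal_le_iff2 intro: order_trans)
  then show ?thesis
    unfolding ereal_integral_eq_shifted[OF M f abs_ge_zero b', simplified]
    by (cases "enn2ereal (\<integral>\<^sup>+x. e2ennreal (f x + ereal \<bar>b\<bar>) \<partial>M)") auto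
qed

lemma ereal_integral_SUP_le:
  assumes M: "prob_space M" and f: "f \<in> borel_measurable M"
    and u: "\<And>n. integrable M (u n)" "\<And>x. x \<in> space M \<Longrightarrow> incseq (\<lambda>n::nat. u n x)"
      "\<And>n x. x \<in> space M \<Longrightarrow> b \<le> u n x" "\<And>x. x \<in> space M \<Longrightarrow> (SUP n. ereal (u n x)) = f x"
    and d: "\<And>n. (\<integral>x. u n x \<partial>M) \<le> d"
  shows "ereal_integral M f \<le> ereal d"
proof -
  interpret prob_space M by fact
  have b': "ereal (- \<bar>b\<bar>) \<le> f x" if "x \<in> space M" for x
  proof -
    have "ereal (- \<bar>b\<bar>) \<le> ereal (u 0 x)" using u(3)[OF that, of 0] by simp
    also have "\<dots> \<le> f x" unfolding u(4)[OF that, symmetric] by (intro SUP_upper) auto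
    finally show ?thesis .
  qed
  have nn: "0 \<le> u n x + \<bar>b\<bar>" if "x \<in> space M" for n x using u(3)[OF that, of n] by simp
  have [measurable]: "u n \<in> borel_measurable M" for n using u(1) by auto
  have "(\<integral>\<^sup>+x. e2ennreal (f x + ereal \<bar>b\<bar>) \<partial>M) = (\<integral>\<^sup>+x. (SUP n. ennreal (u n x + \<bar>b\<bar>)) \<partial>M)"
  proof (rule nn_integral_cong)
    fix x assume x: "x \<in> space M"
    have "f x + ereal \<bar>b\<bar> = (SUP n. ereal (u n x) + ereal \<bar>b\<bar>)"
      unfolding u(4)[OF x, symmetric]
      using nn[OF x] by (intro SUP_ereal_add_left[symmetric]) auto
    also have "e2ennreal \<dots> = (SUP n. e2ennreal (ereal (u n x) + ereal \<bar>b\<bar>))"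
      using u(2)[OF x] by (intro sup_continuousD[OF sup_continuous_e2ennreal[OF sup_continuous_id]])
        (auto simp: incseq_def)
    finally show "e2ennreal (f x + ereal \<bar>b\<bar>) = (SUP n. ennreal (u n x + \<bar>b\<bar>))" by (simp add: e2ennreal_ereal)
  qed
  also have "\<dots> = (SUP n. \<integral>\<^sup>+x. ennreal (u n x + \<bar>b\<bar>) \<partial>M)"
    by (intro nn_integral_monotone_convergence_SUP_AE)
       (auto intro!: AE_I2 ennreal_leI dest: u(2)[THEN incseq_SucD])
  also have "\<dots> \<le> ennreal (d + \<bar>b\<bar>)"
  proof (rule SUP_least)
    fix n
    have "(\<integral>\<^sup>+x. ennreal (u n x + \<bar>b\<bar>) \<partial>M) = ennreal (\<integral>x. u n x + \<bar>b\<bar> \<partial>M)"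
      using u(1) nn by (intro nn_integral_eq_integral) auto
    also have "\<dots> \<le> ennreal (d + \<bar>b\<bar>)" using u(1) d[of n] by (intro ennreal_leI) (simp add: prob_space)
    finally show "(\<integral>\<^sup>+x. ennreal (u n x + \<bar>b\<bar>) \<partial>M) \<le> ennreal (d + \<bar>b\<bar>)" .
  qed
  finally have le: "(\<integral>\<^sup>+x. e2ennreal (f x + ereal \<bar>b\<bar>) \<partial>M) \<le> ennreal (d + \<bar>b\<bar>)" .
  have "- \<bar>b\<bar> \<le> (\<integral>x. u 0 x \<partial>M)"
    using integral_ge_const[OF u(1)[of 0], of "- \<bar>b\<bar>"] u(3)[of _ 0] by force
  then have "0 \<le> d + \<bar>b\<bar>" using d[of 0] by linarith
  then have "enn2ereal (\<integral>\<^sup>+x. e2ennreal (f x + ereal \<bar>b\<bar>) \<partial>M) \<le> ereal (d + \<bar>b\<bar>)"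
    using le by (simp add: less_eq_ennreal.rep_eq enn2ereal_ennreal)
  then show ?thesis
    unfolding ereal_integral_eq_shifted[OF M f abs_ge_zero b', simplified]
    by (cases "enn2ereal (\<integral>\<^sup>+x. e2ennreal (f x + ereal \<bar>b\<bar>) \<partial>M)") auto
qed

section \<open>Regular conditional laws\<close>

text \<open>
The conditional probability is a Radon-Nikodym density on the image space itself, so that it is a
  function of the conditioning value from the start.
\<close>

lemma exists_conditional_probability:
  assumes "prob_space M" and f: "f \<in> M \<rightarrow>\<^sub>M S" and B: "B \<in> sets M"
  shows "\<exists>h. h \<in> borel_measurable S \<and> integrable (distr M S f) h \<and>
    (\<forall>A\<in>sets S. (\<integral>x. indicat_real A x * h x \<partial>distr M S f) = measure M {\<omega>\<in>space M. f \<omega> \<in> A \<and> \<omega> \<in> B})"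
proof -
  interpret prob_space M by fact
  define \<nu> where "\<nu> = distr M S f"
  interpret \<nu>: prob_space \<nu> unfolding \<nu>_def by (rule prob_space_distr[OF f])
  define \<nu>B where "\<nu>B = distr (density M (indicator B)) S f"
  have f': "f \<in> density M (indicator B) \<rightarrow>\<^sub>M S" using f by simp
  have em: "emeasure \<nu>B A = emeasure M {\<omega>\<in>space M. f \<omega> \<in> A \<and> \<omega> \<in> B}" if A: "A \<in> sets S" for A
  proof -
    have [measurable]: "f -` A \<inter> space M \<in> sets M" using f A by (rule measurable_sets)
    have "emeasure \<nu>B A = (\<integral>\<^sup>+\<omega>. indicator B \<omega> * indicator (f -` A \<inter> space M) \<omega> \<partial>M)"
      unfolding \<nu>B_def using A B by (simp add: emeasure_distr[OF f' A] emeasure_density)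
    also have "\<dots> = (\<integral>\<^sup>+\<omega>. indicator {\<omega>\<in>space M. f \<omega> \<in> A \<and> \<omega> \<in> B} \<omega> \<partial>M)"
      by (intro nn_integral_cong) (auto simp: indicator_def)
    also have "\<dots> = emeasure M {\<omega>\<in>space M. f \<omega> \<in> A \<and> \<omega> \<in> B}"
    proof -
      have "{\<omega>\<in>space M. f \<omega> \<in> A \<and> \<omega> \<in> B} = (f -` A \<inter> space M) \<inter> B" by auto
      then show ?thesis using B by simp
    qed
    finally show ?thesis .
  qed
  have "absolutely_continuous \<nu> \<nu>B"
    unfolding absolutely_continuous_def
  proof
    fix A assume "A \<in> null_sets \<nu>"
    then have A: "A \<in> sets S" "emeasure M (f -` A \<inter> space M) = 0"
      by (auto simp: null_sets_def \<nu>_def emeasure_distr[OF f])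
    have "emeasure M {\<omega>\<in>space M. f \<omega> \<in> A \<and> \<omega> \<in> B} \<le> emeasure M (f -` A \<inter> space M)"
      using measurable_sets[OF f A(1)] by (intro emeasure_mono) auto
    then show "A \<in> null_sets \<nu>B" using A em[OF A(1)] by (auto simp: null_sets_def \<nu>B_def)
  qed
  then have dens: "density \<nu> (RN_deriv \<nu> \<nu>B) = \<nu>B"
    by (intro \<nu>.density_RN_deriv) (auto simp: \<nu>_def \<nu>B_def)
  define h where "h x = enn2real (RN_deriv \<nu> \<nu>B x)" for x
  have [measurable]: "RN_deriv \<nu> \<nu>B \<in> borel_measurable S"
    using borel_measurable_RN_deriv[of \<nu> \<nu>B] by (simp add: \<nu>_def)
  have hm: "h \<in> borel_measurable S" unfolding h_def by measurable
  have tot: "(\<integral>\<^sup>+x. RN_deriv \<nu> \<nu>B x * indicator A x \<partial>\<nu>) = emeasure M {\<omega>\<in>space M. f \<omega> \<in> A \<and> \<omega> \<in> B}"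
    if A: "A \<in> sets S" for A
  proof -
    have "emeasure (density \<nu> (RN_deriv \<nu> \<nu>B)) A = (\<integral>\<^sup>+x. RN_deriv \<nu> \<nu>B x * indicator A x \<partial>\<nu>)"
      using A by (intro emeasure_density) (auto simp: \<nu>_def)
    then show ?thesis using em[OF A] dens by simp
  qed
  have "(\<integral>\<^sup>+x. RN_deriv \<nu> \<nu>B x \<partial>\<nu>) = (\<integral>\<^sup>+x. RN_deriv \<nu> \<nu>B x * indicator (space S) x \<partial>\<nu>)"
    by (intro nn_integral_cong) (auto simp: \<nu>_def)
  also have "\<dots> < \<infinity>" by (subst tot) (auto simp: less_top[symmetric])
  finally have "AE x in \<nu>. RN_deriv \<nu> \<nu>B x \<noteq> \<infinity>"
    by (intro nn_integral_PInf_AE) auto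
  then have heq: "AE x in \<nu>. ennreal (h x) = RN_deriv \<nu> \<nu>B x"
    unfolding h_def by eventually_elim (simp add: less_top)
  have nn: "(\<integral>\<^sup>+x. ennreal (indicat_real A x * h x) \<partial>\<nu>) = emeasure M {\<omega>\<in>space M. f \<omega> \<in> A \<and> \<omega> \<in> B}"
    if A: "A \<in> sets S" for A
    unfolding tot[OF A, symmetric] using heq
    by (intro nn_integral_cong_AE, eventually_elim) (auto simp: indicator_def)
  have h0: "0 \<le> h x" for x by (simp add: h_def)
  have "integrable \<nu> h"
  proof (rule integrableI_nonneg)
    have "(\<integral>\<^sup>+x. ennreal (h x) \<partial>\<nu>) = (\<integral>\<^sup>+x. ennreal (indicat_real (space S) x * h x) \<partial>\<nu>)"
      by (intro nn_integral_cong) (auto simp: \<nu>_def)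
    then show "(\<integral>\<^sup>+x. ennreal (h x) \<partial>\<nu>) < \<infinity>" by (simp add: nn less_top[symmetric])
  qed (use hm h0 in \<open>auto simp: \<nu>_def\<close>)
  moreover have "(\<integral>x. indicat_real A x * h x \<partial>\<nu>) = measure M {\<omega>\<in>space M. f \<omega> \<in> A \<and> \<omega> \<in> B}"
    if A: "A \<in> sets S" for A
    using hm A h0 nn[OF A] by (subst integral_eq_nn_integral) (auto simp: \<nu>_def measure_def)
  ultimately show ?thesis using hm unfolding \<nu>_def by blast
qed


text \<open>
Conditional distribution functions: for rational \<open>q\<close> take versions \<open>h q\<close> of the
  conditional probability of \<open>{g \<le> q}\<close>. Outside a null set they are monotone in \<open>q\<close> with limits
  \<open>0\<close> and \<open>1\<close>, so that their right-continuous regularization \<open>F x\<close> is a distribution function and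
  defines the conditional law.
\<close>

lemma exists_regular_cond_law_real:
  fixes g :: "'a \<Rightarrow> real"
  assumes "prob_space M" and f: "f \<in> M \<rightarrow>\<^sub>M S" and g: "g \<in> borel_measurable M"
  shows "\<exists>\<kappa>. regular_cond_law M S f borel g \<kappa>"
proof -
  interpret prob_space M by fact
  have [measurable]: "f \<in> M \<rightarrow>\<^sub>M S" "g \<in> borel_measurable M" by fact+
  define \<nu> where "\<nu> = distr M S f"
  interpret \<nu>: prob_space \<nu> unfolding \<nu>_def by (rule prob_space_distr[OF f])
  have s\<nu>[measurable_cong]: "sets \<nu> = sets S" by (simp add: \<nu>_def)
  have sp\<nu>: "space \<nu> = space S" by (simp add: \<nu>_def)
  have "\<exists>h. h \<in> borel_measurable S \<and> integrable \<nu> h \<and>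
    (\<forall>A\<in>sets S. (\<integral>x. indicat_real A x * h x \<partial>\<nu>) = measure M {\<omega>\<in>space M. f \<omega> \<in> A \<and> g \<omega> \<le> real_of_rat q})" for q
  proof -
    have "{\<omega>\<in>space M. f \<omega> \<in> A \<and> \<omega> \<in> {\<omega>\<in>space M. g \<omega> \<le> real_of_rat q}} = {\<omega>\<in>space M. f \<omega> \<in> A \<and> g \<omega> \<le> real_of_rat q}" for A
      by auto
    then show ?thesis
      using exists_conditional_probability[OF assms(1) f, of "{\<omega>\<in>space M. g \<omega> \<le> real_of_rat q}"]
      unfolding \<nu>_def by simp
  qed
  then have "\<exists>h. \<forall>q. h q \<in> borel_measurable S \<and> integrable \<nu> (h q) \<and>
    (\<forall>A\<in>sets S. (\<integral>x. indicat_real A x * h q x \<partial>\<nu>) = measure M {\<omega>\<in>space M. f \<omega> \<in> A \<and> g \<omega> \<le> real_of_rat q})"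
    by (intro choice allI)
  then obtain h where h[measurable]: "\<And>q. h q \<in> borel_measurable S" and hi: "\<And>q. integrable \<nu> (h q)"
    and hA: "\<And>A q. A \<in> sets S \<Longrightarrow> (\<integral>x. indicat_real A x * h q x \<partial>\<nu>) = measure M {\<omega>\<in>space M. f \<omega> \<in> A \<and> g \<omega> \<le> real_of_rat q}"
    by blast
  have hAs: "(LINT x:A|\<nu>. h q x) = measure M {\<omega>\<in>space M. f \<omega> \<in> A \<and> g \<omega> \<le> real_of_rat q}"
    if "A \<in> sets S" for A q
    using hA[OF that] by (simp add: set_lebesgue_integral_def)
  have hint: "(\<integral>x. h q x \<partial>\<nu>) = measure M {\<omega>\<in>space M. g \<omega> \<le> real_of_rat q}" for q
  proof -
    have "(\<integral>x. h q x \<partial>\<nu>) = (\<integral>x. indicat_real (space S) x * h q x \<partial>\<nu>)"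
      by (intro Bochner_Integration.integral_cong) (auto simp: sp\<nu>)
    also have "\<dots> = measure M {\<omega>\<in>space M. g \<omega> \<le> real_of_rat q}"
      unfolding hA[OF sets.top] using measurable_space[OF f] by (intro arg_cong[where f = "measure M"]) auto
    finally show ?thesis .
  qed
  have si: "set_integrable \<nu> A (h q)" if "A \<in> sets S" for A q
    unfolding set_integrable_def using hi that by (intro integrable_mult_indicator) (auto simp: s\<nu>)
  have "AE x in \<nu>. 0 \<le> h r x - h p x" if "p \<le> r" for p r
  proof (rule \<nu>.density_nonneg)
    fix A assume "A \<in> sets \<nu>"
    then have A: "A \<in> sets S" by (simp add: s\<nu>)
    have "real_of_rat p \<le> real_of_rat r" using that by (simp add: of_rat_less_eq)
    then have "measure M {\<omega>\<in>space M. f \<omega> \<in> A \<and> g \<omega> \<le> real_of_rat p} \<le> measure M {\<omega>\<in>space M. f \<omega> \<in> A \<and> g \<omega> \<le> real_of_rat r}"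
      using A by (intro finite_measure_mono) auto
    then show "0 \<le> (LINT x:A|\<nu>. h r x - h p x)"
      by (simp add: set_integral_diff(2)[OF si[OF A] si[OF A]] hAs[OF A])
  qed (use hi in auto)
  then have AEmono: "AE x in \<nu>. \<forall>p r. p \<le> r \<longrightarrow> h p x \<le> h r x"
    by (simp add: AE_all_countable)
  have "AE x in \<nu>. 0 \<le> h r x" for r
    by (rule \<nu>.density_nonneg) (use hi hAs in \<open>auto simp: s\<nu>\<close>)
  then have AEpos: "AE x in \<nu>. \<forall>r. 0 \<le> h r x" by (simp add: AE_all_countable)
  have "AE x in \<nu>. 0 \<le> 1 - h r x" for r
  proof (rule \<nu>.density_nonneg)
    fix A assume "A \<in> sets \<nu>"
    then have A: "A \<in> sets S" by (simp add: s\<nu>)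
    have fA: "f -` A \<inter> space M \<in> sets M" using A by simp
    have "measure M {\<omega>\<in>space M. f \<omega> \<in> A \<and> g \<omega> \<le> real_of_rat r} \<le> measure M (f -` A \<inter> space M)"
      using fA by (intro finite_measure_mono) auto
    also have "\<dots> = measure \<nu> A" unfolding \<nu>_def using A by (simp add: measure_distr)
    finally show "0 \<le> (LINT x:A|\<nu>. 1 - h r x)"
      using A by (subst set_integral_diff(2)[OF _ si[OF A]])
        (auto simp: hA[OF A] set_integrable_def set_lebesgue_integral_def s\<nu> \<nu>.emeasure_eq_measure)
  qed (use hi in auto)
  then have AE1: "AE x in \<nu>. \<forall>r. h r x \<le> 1" by (simp add: AE_all_countable)
  have inf0: "AE x in \<nu>. (INF n::nat. k n x) = 0"
    if k: "\<And>n. k n \<in> borel_measurable S" "\<And>n. integrable \<nu> (k n)" "AE x in \<nu>. \<forall>n. 0 \<le> k n x"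
      "(\<lambda>n. \<integral>x. k n x \<partial>\<nu>) \<longlonglongrightarrow> 0" for k :: "nat \<Rightarrow> 'b \<Rightarrow> real"
  proof -
    have [measurable]: "k n \<in> borel_measurable S" for n by fact
    have m: "(\<lambda>x. INF n. k n x) \<in> borel_measurable \<nu>" by measurable
    have pos: "AE x in \<nu>. 0 \<le> (INF n. k n x)"
      using k(3) by eventually_elim (auto intro: cINF_greatest)
    have le: "AE x in \<nu>. (INF n. k n x) \<le> k m x" for m
      using k(3) by eventually_elim (auto intro!: cINF_lower bdd_belowI2[of _ 0])
    have i: "integrable \<nu> (\<lambda>x. INF n. k n x)"
      using pos le[of 0] by (intro Bochner_Integration.integrable_bound[OF k(2)[of 0] m], elim AE_mp) (auto intro!: AE_I2)
    have "(\<integral>x. (INF n. k n x) \<partial>\<nu>) \<le> (\<integral>x. k m x \<partial>\<nu>)" for m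
      by (intro integral_mono_AE i k le)
    then have "(\<integral>x. (INF n. k n x) \<partial>\<nu>) \<le> 0" by (intro LIMSEQ_le_const[OF k(4)]) auto
    moreover have "0 \<le> (\<integral>x. (INF n. k n x) \<partial>\<nu>)" by (intro integral_nonneg_AE pos)
    ultimately show ?thesis using integral_nonneg_eq_0_iff_AE[OF i pos] by simp
  qed
  have bot: "AE x in \<nu>. (INF n::nat. h (- of_nat n) x) = 0"
  proof (rule inf0)
    have "(\<lambda>n. measure M {\<omega>\<in>space M. g \<omega> \<le> - real n}) \<longlonglongrightarrow> measure M (\<Inter>n. {\<omega>\<in>space M. g \<omega> \<le> - real n})"
      by (intro finite_Lim_measure_decseq) (auto simp: decseq_def)
    moreover have "(\<Inter>n. {\<omega>\<in>space M. g \<omega> \<le> - real n}) = {}"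
    proof -
      have "\<exists>n. \<not> g \<omega> \<le> - real n" for \<omega>
        using reals_Archimedean2[of "- g \<omega>"] by (auto simp: not_le minus_less_iff)
      then show ?thesis by blast
    qed
    ultimately show "(\<lambda>n. \<integral>x. h (- of_nat n) x \<partial>\<nu>) \<longlonglongrightarrow> 0"
      by (simp add: hint of_rat_minus)
    show "AE x in \<nu>. \<forall>n. 0 \<le> h (- of_nat n) x" using AEpos by eventually_elim auto
  qed (use hi in auto)
  have top: "AE x in \<nu>. (INF n::nat. 1 - h (of_nat n) x) = 0"
  proof (rule inf0)
    have "(\<lambda>n. measure M {\<omega>\<in>space M. g \<omega> \<le> real n}) \<longlonglongrightarrow> measure M (\<Union>n. {\<omega>\<in>space M. g \<omega> \<le> real n})"
      by (intro finite_Lim_measure_incseq) (auto simp: incseq_def)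
    moreover have "(\<Union>n. {\<omega>\<in>space M. g \<omega> \<le> real n}) = space M"
    proof -
      have "\<exists>n. g \<omega> \<le> real n" for \<omega> by (rule real_arch_simple)
      then show ?thesis by blast
    qed
    ultimately have "(\<lambda>n. 1 - measure M {\<omega>\<in>space M. g \<omega> \<le> real n}) \<longlonglongrightarrow> 1 - 1"
      by (intro tendsto_intros) (simp add: prob_space)
    then show "(\<lambda>n. \<integral>x. 1 - h (of_nat n) x \<partial>\<nu>) \<longlonglongrightarrow> 0"
      using hi by (simp add: hint \<nu>.prob_space)
    show "AE x in \<nu>. \<forall>n. 0 \<le> 1 - h (of_nat n) x" using AE1 by eventually_elim auto
  qed (use hi in auto)
  define E where "E = {x\<in>space S. (\<forall>p r. p \<le> r \<longrightarrow> h p x \<le> h r x) \<and> (\<forall>r. 0 \<le> h r x) \<and> (\<forall>r. h r x \<le> 1) \<and>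
     (INF n::nat. h (- of_nat n) x) = 0 \<and> (INF n::nat. 1 - h (of_nat n) x) = 0}"
  have E[measurable]: "E \<in> sets S" unfolding E_def by measurable
  have AEE: "AE x in \<nu>. x \<in> E"
    using AEmono AEpos AE1 bot top AE_space by eventually_elim (auto simp: E_def sp\<nu>)
  define F where "F x r = (INF q\<in>{q. r < real_of_rat q}. h q x)" for x r
  have ne: "{q. r < real_of_rat q} \<noteq> {}" for r
    using of_rat_dense[of r "r + 1"] by auto
  have bdd: "bdd_below ((\<lambda>q. h q x) ` Q)" if "x \<in> E" for x Q
    using that by (intro bdd_belowI2[of _ 0]) (auto simp: E_def)
  have Fle: "F x r \<le> h q x" if "x \<in> E" "r < real_of_rat q" for x r q
    unfolding F_def using that by (intro cINF_lower bdd) auto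
  have leF: "a \<le> F x r" if "\<And>q. r < real_of_rat q \<Longrightarrow> a \<le> h q x" for a x r
    unfolding F_def using that ne by (intro cINF_greatest) auto
  have Fless: "\<exists>q. r < real_of_rat q \<and> h q x < F x r + e" if "x \<in> E" "0 < e" for x r e
    using that(2) cInf_lessD[of "(\<lambda>q. h q x) ` {q. r < real_of_rat q}" "F x r + e"] ne[of r]
    by (auto simp: F_def)
  have Fmono: "F x r \<le> F x s" if "x \<in> E" "r \<le> s" for x r s
    using that by (intro leF Fle) auto
  have hmono: "h p x \<le> h q x" if "x \<in> E" "real_of_rat p \<le> real_of_rat q" for p q x
    using that by (auto simp: E_def of_rat_less_eq)
  have Fright: "continuous (at_right r) (F x)" if x: "x \<in> E" for x r
    unfolding continuous_within
  proof (rule order_tendstoI)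
    fix a assume a: "a < F x r"
    show "\<forall>\<^sub>F s in at_right r. a < F x s"
      unfolding eventually_at_right_field using Fmono[OF x] a
      by (intro exI[of _ "r + 1"]) (auto intro: less_le_trans)
  next
    fix a assume "F x r < a"
    then obtain q where q: "r < real_of_rat q" "h q x < a" using Fless[OF x, of "a - F x r" r] by auto
    then show "\<forall>\<^sub>F s in at_right r. F x s < a"
      unfolding eventually_at_right_field using Fle[OF x]
      by (intro exI[of _ "real_of_rat q"]) (auto intro: le_less_trans)
  qed
  have F01: "0 \<le> F x r" "F x r \<le> 1" if "x \<in> E" for x r
  proof -
    show "0 \<le> F x r" using that by (intro leF) (auto simp: E_def)
    obtain q where "r < real_of_rat q" using ne[of r] by auto
    then have "F x r \<le> h q x" using Fle that by auto
    also have "\<dots> \<le> 1" using that by (auto simp: E_def)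
    finally show "F x r \<le> 1" .
  qed
  have Fbot: "(F x \<longlongrightarrow> 0) at_bot" if x: "x \<in> E" for x
  proof (rule order_tendstoI)
    fix a :: real assume "a < 0"
    then show "\<forall>\<^sub>F r in at_bot. a < F x r" using F01(1)[OF x] by (intro always_eventually) (auto intro: less_le_trans)
  next
    fix a :: real assume "0 < a"
    then have "(INF n::nat. h (- of_nat n) x) < a" using x by (auto simp: E_def)
    then obtain n :: nat where n: "h (- of_nat n) x < a"
      using cInf_lessD[of "range (\<lambda>n::nat. h (- of_nat n) x)" a] by blast
    have "F x r < a" if "r \<le> - real n - 1" for r
      using Fle[OF x, of r "- of_nat n"] n that by (auto simp: of_rat_minus)
    then show "\<forall>\<^sub>F r in at_bot. F x r < a" unfolding eventually_at_bot_linorder by blast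
  qed
  have Ftop: "(F x \<longlongrightarrow> 1) at_top" if x: "x \<in> E" for x
  proof (rule order_tendstoI)
    fix a :: real assume "1 < a"
    then show "\<forall>\<^sub>F r in at_top. F x r < a" using F01(2)[OF x] by (intro always_eventually) (auto intro: le_less_trans)
  next
    fix a :: real assume "a < 1"
    then have "(INF n::nat. 1 - h (of_nat n) x) < 1 - a" using x by (auto simp: E_def)
    then obtain n :: nat where n: "1 - h (of_nat n) x < 1 - a"
      using cInf_lessD[of "range (\<lambda>n::nat. 1 - h (of_nat n) x)" "1 - a"] by blast
    have "a < F x r" if "real n \<le> r" for r
    proof -
      have "h (of_nat n) x \<le> F x r" using that by (intro leF hmono[OF x]) auto
      then show ?thesis using n by simp
    qed
    then show "\<forall>\<^sub>F r in at_top. a < F x r" unfolding eventually_at_top_linorder by blast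
  qed
  \<comment> \<open>The set \<open>E\<close> has full measure; elsewhere any probability measure would do.\<close>
  define \<kappa> where "\<kappa> x = (if x \<in> E then interval_measure (F x) else return borel 0)" for x
  have rd: "real_distribution (interval_measure (F x))" if "x \<in> E" for x
    using that by (intro real_distribution_interval_measure Fmono Fright Fbot Ftop)
  have \<kappa>F: "emeasure (\<kappa> x) {..r} = ennreal (F x r)" if x: "x \<in> E" for x r
  proof -
    interpret F: real_distribution "interval_measure (F x)" by (rule rd[OF x])
    have "cdf (interval_measure (F x)) r = F x r"
      using cdf_interval_measure[of "F x"] Fmono[OF x] Fright[OF x] Fbot[OF x] by simp
    then show ?thesis using x by (simp add: \<kappa>_def cdf_def F.emeasure_eq_measure)
  qed
  have Fm: "(\<lambda>x. F x r) \<in> borel_measurable S" for r unfolding F_def by measurable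
  have \<kappa>m: "\<kappa> \<in> S \<rightarrow>\<^sub>M prob_algebra borel"
  proof (rule measurable_prob_algebra_generated[where \<Omega> = UNIV and G = "range (\<lambda>a. {..a::real})"])
    show "sets borel = sigma_sets UNIV (range (\<lambda>a. {..a::real}))"
      using borel_eq_atMost[where 'a = real] by (metis sets_measure_of top_greatest Pow_UNIV)
    show "Int_stable (range (\<lambda>a. {..a::real}))" by (auto simp: Int_stable_def)
    show "prob_space (\<kappa> x)" for x
      using rd[of x] by (auto simp: \<kappa>_def real_distribution_def intro: prob_space_return)
    show "sets (\<kappa> x) = sets borel" for x by (simp add: \<kappa>_def)
    fix A :: "real set" assume "A \<in> range (\<lambda>a. {..a})"
    then obtain r where A: "A = {..r}" by auto
    have "(\<lambda>x. emeasure (\<kappa> x) A) = (\<lambda>x. if x \<in> E then ennreal (F x r) else emeasure (return borel 0) A)"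
      using \<kappa>F A by (auto simp: \<kappa>_def fun_eq_iff)
    then show "(\<lambda>x. emeasure (\<kappa> x) A) \<in> borel_measurable S" using Fm by simp
  qed simp
  have key: "(\<integral>x. indicat_real A x * F x r \<partial>\<nu>) = measure M {\<omega>\<in>space M. f \<omega> \<in> A \<and> g \<omega> \<le> r}"
    if A[measurable]: "A \<in> sets S" for A r
  proof -
    have "\<exists>q. r < real_of_rat q \<and> real_of_rat q < r + inverse (Suc n)" for n
      by (intro of_rat_dense) simp
    then obtain q where q: "\<And>n. r < real_of_rat (q n)" "\<And>n. real_of_rat (q n) < r + inverse (Suc n)" by metis
    have lim0: "(\<lambda>n. r + inverse (real (Suc n))) \<longlonglongrightarrow> r"
      using tendsto_add[OF tendsto_const LIMSEQ_inverse_real_of_nat, of r] by simp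
    have "(\<lambda>n. h (q n) x) \<longlonglongrightarrow> F x r" if x: "x \<in> E" for x
    proof (rule order_tendstoI)
      fix a assume "a < F x r"
      then show "\<forall>\<^sub>F n in sequentially. a < h (q n) x"
        using Fle[OF x q(1)] by (intro always_eventually) (auto intro: less_le_trans)
    next
      fix a assume "F x r < a"
      then obtain p where p: "r < real_of_rat p" "h p x < a" using Fless[OF x, of "a - F x r" r] by auto
      have "\<forall>\<^sub>F n in sequentially. r + inverse (real (Suc n)) < real_of_rat p"
        using order_tendstoD(2)[OF lim0 p(1)] .
      then show "\<forall>\<^sub>F n in sequentially. h (q n) x < a"
      proof eventually_elim
        case (elim n)
        then have "h (q n) x \<le> h p x" using q(2)[of n] by (intro hmono[OF x]) linarith
        then show ?case using p(2) by linarith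
      qed
    qed
    then have "(\<lambda>n. \<integral>x. indicat_real A x * h (q n) x \<partial>\<nu>) \<longlonglongrightarrow> (\<integral>x. indicat_real A x * F x r \<partial>\<nu>)"
    proof (intro integral_dominated_convergence[where w = "\<lambda>_. 1"])
      show "AE x in \<nu>. norm (indicat_real A x * h (q n) x) \<le> 1" for n
        using AEE by eventually_elim (auto simp: E_def indicator_def)
      assume *: "\<And>x. x \<in> E \<Longrightarrow> (\<lambda>n. h (q n) x) \<longlonglongrightarrow> F x r"
      show "AE x in \<nu>. (\<lambda>n. indicat_real A x * h (q n) x) \<longlonglongrightarrow> indicat_real A x * F x r"
        using AEE by eventually_elim (intro tendsto_intros *)
    qed (use Fm in auto)
    moreover have "(\<lambda>n. \<integral>x. indicat_real A x * h (q n) x \<partial>\<nu>) \<longlonglongrightarrow> measure M {\<omega>\<in>space M. f \<omega> \<in> A \<and> g \<omega> \<le> r}"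
      proof -
      have "(\<lambda>n. measure M {\<omega>\<in>space M. f \<omega> \<in> A \<and> g \<omega> \<le> r + inverse (real (Suc n))})
          \<longlonglongrightarrow> measure M (\<Inter>n. {\<omega>\<in>space M. f \<omega> \<in> A \<and> g \<omega> \<le> r + inverse (real (Suc n))})"
      proof (intro finite_Lim_measure_decseq)
        have "r + inverse (real (Suc n)) \<le> r + inverse (real (Suc m))" if "m \<le> n" for m n
          using that by (auto simp: field_simps)
        then show "decseq (\<lambda>n. {\<omega>\<in>space M. f \<omega> \<in> A \<and> g \<omega> \<le> r + inverse (real (Suc n))})"
          unfolding decseq_def by (auto intro: order_trans)
      qed auto
      moreover have "(\<Inter>n. {\<omega>\<in>space M. f \<omega> \<in> A \<and> g \<omega> \<le> r + inverse (real (Suc n))}) = {\<omega>\<in>space M. f \<omega> \<in> A \<and> g \<omega> \<le> r}"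
      proof -
        have "g \<omega> \<le> r" if "\<forall>n. g \<omega> \<le> r + inverse (real (Suc n))" for \<omega>
          using LIMSEQ_le_const[OF lim0, of "g \<omega>"] that by auto
        moreover have "g \<omega> \<le> r + inverse (real (Suc n))" if "g \<omega> \<le> r" for \<omega> n
          using that by (rule order_trans) simp
        ultimately show ?thesis by fastforce
      qed
      ultimately have lim: "(\<lambda>n. measure M {\<omega>\<in>space M. f \<omega> \<in> A \<and> g \<omega> \<le> r + inverse (real (Suc n))})
          \<longlonglongrightarrow> measure M {\<omega>\<in>space M. f \<omega> \<in> A \<and> g \<omega> \<le> r}" by simp
      have e1: "\<forall>\<^sub>F n in sequentially. measure M {\<omega>\<in>space M. f \<omega> \<in> A \<and> g \<omega> \<le> r} \<le> measure M {\<omega>\<in>space M. f \<omega> \<in> A \<and> g \<omega> \<le> real_of_rat (q n)}"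
        using q(1) by (intro always_eventually allI finite_measure_mono) (auto intro: order_trans[OF _ less_imp_le])
      have e2: "\<forall>\<^sub>F n in sequentially. measure M {\<omega>\<in>space M. f \<omega> \<in> A \<and> g \<omega> \<le> real_of_rat (q n)} \<le> measure M {\<omega>\<in>space M. f \<omega> \<in> A \<and> g \<omega> \<le> r + inverse (real (Suc n))}"
        using q(2) by (intro always_eventually allI finite_measure_mono) (auto intro: order_trans[OF _ less_imp_le])
      show ?thesis unfolding hA[OF A] by (rule tendsto_sandwich[OF e1 e2 tendsto_const lim])
    qed
    ultimately show ?thesis by (rule LIMSEQ_unique)
  qed
  have "emeasure M {\<omega>\<in>space M. f \<omega> \<in> A \<and> g \<omega> \<in> B} = (\<integral>\<^sup>+\<omega>. emeasure (\<kappa> (f \<omega>)) B * indicator A (f \<omega>) \<partial>M)"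
    if A[measurable]: "A \<in> sets S" and B[measurable]: "B \<in> sets borel" for A B
  proof -
    define N1 where "N1 = distr (density M (\<lambda>\<omega>. indicator A (f \<omega>))) borel g"
    define N2 where "N2 = density \<nu> (indicator A) \<bind> \<kappa>"
    have km: "\<kappa> \<in> density \<nu> (indicator A) \<rightarrow>\<^sub>M subprob_algebra borel"
      using measurable_prob_algebraD[OF \<kappa>m] by simp
    have emk[measurable]: "(\<lambda>x. emeasure (\<kappa> x) B) \<in> borel_measurable S" if "B \<in> sets borel" for B
      using measurable_emeasure_kernel[OF measurable_prob_algebraD[OF \<kappa>m] that] .
    have N1: "emeasure N1 B = emeasure M {\<omega>\<in>space M. f \<omega> \<in> A \<and> g \<omega> \<in> B}" if [measurable]: "B \<in> sets borel" for B
    proof -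
      have "emeasure N1 B = (\<integral>\<^sup>+\<omega>. indicator A (f \<omega>) * indicator (g -` B \<inter> space M) \<omega> \<partial>M)"
        unfolding N1_def by (simp add: emeasure_distr emeasure_density)
      also have "\<dots> = (\<integral>\<^sup>+\<omega>. indicator {\<omega>\<in>space M. f \<omega> \<in> A \<and> g \<omega> \<in> B} \<omega> \<partial>M)"
        by (intro nn_integral_cong) (auto simp: indicator_def)
      finally show ?thesis by simp
    qed
    have N2': "emeasure N2 B = (\<integral>\<^sup>+x. indicator A x * emeasure (\<kappa> x) B \<partial>\<nu>)" if B: "B \<in> sets borel" for B
      unfolding N2_def using emk[OF B] \<nu>.not_empty
      by (subst emeasure_bind[OF _ km B]) (simp_all add: nn_integral_density)
    have "N1 = N2"
    proof (rule measure_eqI_generator_eq[where \<Omega> = UNIV and E = "range (\<lambda>a. {..a::real})" and A = "\<lambda>n. {..real n}"])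
      show "Int_stable (range (\<lambda>a. {..a::real}))" by (auto simp: Int_stable_def)
      have sb: "sets borel = sigma_sets UNIV (range (\<lambda>a. {..a::real}))"
        using borel_eq_atMost[where 'a = real] by (metis sets_measure_of top_greatest Pow_UNIV)
      then show "sets N1 = sigma_sets UNIV (range (\<lambda>a. {..a::real}))" by (simp add: N1_def)
      show "sets N2 = sigma_sets UNIV (range (\<lambda>a. {..a::real}))"
        unfolding N2_def sb[symmetric] by (rule sets_bind[OF sets_kernel[OF km]]) (auto simp: \<nu>.not_empty)
      show "emeasure N1 {..real n} \<noteq> \<infinity>" for n by (simp add: N1)
      show "(\<Union>n. {..real n}) = UNIV" using real_arch_simple by auto
      fix X assume "X \<in> range (\<lambda>a. {..a::real})"
      then obtain r where X: "X = {..r}" by auto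
      have "emeasure N2 X = (\<integral>\<^sup>+x. ennreal (indicat_real A x * F x r) \<partial>\<nu>)"
        unfolding X N2'[OF atMost_borel] using AEE
        by (intro nn_integral_cong_AE, eventually_elim) (auto simp: \<kappa>F indicator_def)
      also have "\<dots> = ennreal (\<integral>x. indicat_real A x * F x r \<partial>\<nu>)"
      proof (rule nn_integral_eq_integral)
        show "AE x in \<nu>. 0 \<le> indicat_real A x * F x r" using AEE by eventually_elim (simp add: F01)
        show "integrable \<nu> (\<lambda>x. indicat_real A x * F x r)"
        proof (rule \<nu>.integrable_const_bound)
          show "AE x in \<nu>. norm (indicat_real A x * F x r) \<le> 1"
            using AEE by eventually_elim (auto simp: F01 indicator_def)
        qed (use Fm in auto)
      qed
      also have "\<dots> = emeasure N1 X" using N1[of X] X by (simp add: key emeasure_eq_measure)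
      finally show "emeasure N1 X = emeasure N2 X" ..
    qed auto
    then have "emeasure M {\<omega>\<in>space M. f \<omega> \<in> A \<and> g \<omega> \<in> B} = (\<integral>\<^sup>+x. indicator A x * emeasure (\<kappa> x) B \<partial>\<nu>)"
      using N1[OF B] N2'[OF B] by simp
    also have "\<dots> = (\<integral>\<^sup>+\<omega>. indicator A (f \<omega>) * emeasure (\<kappa> (f \<omega>)) B \<partial>M)"
      unfolding \<nu>_def using emk[OF B] by (intro nn_integral_distr) auto
    finally show ?thesis by (simp add: mult.commute)
  qed
  then show ?thesis using \<kappa>m unfolding regular_cond_law_def by blast
qed

text \<open>
With digits \<open>0\<close> and \<open>1\<close> in base \<open>3\<close> the tail of the expansion is at most one half, so
  that rounding down recovers every digit. In base \<open>2\<close> the expansion would not be unique.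
\<close>

lemma ternary_digit:
  fixes b :: "nat \<Rightarrow> int"
  assumes b: "\<And>k. b k = 0 \<or> b k = 1"
  shows "\<lfloor>3 ^ Suc k * (\<Sum>n. real_of_int (b n) * (1/3) ^ Suc n)\<rfloor> mod 3 = b k"
proof -
  define f where "f n = real_of_int (b n) * (1/3) ^ Suc n" for n
  have b01: "0 \<le> real_of_int (b k)" "real_of_int (b k) \<le> 1" for k using b[of k] by auto
  have f: "0 \<le> f n" "f n \<le> (1/3) ^ Suc n" for n
    using b01[of n] by (auto simp: f_def)
  have gs: "(\<lambda>n. (1/3::real) ^ Suc n) sums (1/2)"
    using sums_mult[OF geometric_sums[of "1/3::real"], of "1/3"] by simp
  have sf: "summable f"
    by (rule summable_comparison_test'[OF sums_summable[OF gs]]) (use f in auto)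
  have int: "\<exists>m::int. 3 ^ k * (\<Sum>i<k. f i) = of_int m" for k
  proof (induction k)
    case (Suc k)
    then obtain m :: int where m: "3 ^ k * (\<Sum>i<k. f i) = of_int m" by auto
    have "3 ^ Suc k * (\<Sum>i<Suc k. f i) = 3 * (3 ^ k * (\<Sum>i<k. f i)) + real_of_int (b k) * (3 ^ Suc k * (1/3) ^ Suc k)"
      by (simp add: f_def algebra_simps)
    also have "3 ^ Suc k * (1/3::real) ^ Suc k = 1" by (simp add: power_one_over)
    finally have "3 ^ Suc k * (\<Sum>i<Suc k. f i) = of_int (3 * m + b k)" by (simp add: m)
    then show ?case ..
  qed (auto intro: exI[of _ 0])
  obtain m :: int where m: "3 ^ k * (\<Sum>i<k. f i) = of_int m" using int by blast
  have eq: "3 ^ Suc k * (\<Sum>i<Suc k. f i) = of_int (3 * m + b k)"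
  proof -
    have "3 ^ Suc k * (\<Sum>i<Suc k. f i) = 3 * (3 ^ k * (\<Sum>i<k. f i)) + real_of_int (b k) * (3 ^ Suc k * (1/3) ^ Suc k)"
      by (simp add: f_def algebra_simps)
    also have "3 ^ Suc k * (1/3::real) ^ Suc k = 1" by (simp add: power_one_over)
    finally show ?thesis by (simp add: m)
  qed
  define t where "t = 3 ^ Suc k * (\<Sum>n. f (n + Suc k))"
  have stail: "summable (\<lambda>n. f (n + Suc k))" using sf by (rule summable_ignore_initial_segment)
  have "(\<Sum>n. f (n + Suc k)) \<le> (\<Sum>n. (1/3) ^ Suc n * (1/3::real) ^ Suc k)"
  proof (rule suminf_le[OF _ stail])
    show "f (n + Suc k) \<le> (1/3) ^ Suc n * (1/3) ^ Suc k" for n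
      using f(2)[of "n + Suc k"] by (simp add: power_add mult_ac)
    show "summable (\<lambda>n. (1/3) ^ Suc n * (1/3::real) ^ Suc k)"
      by (rule summable_mult2[OF sums_summable[OF gs]])
  qed
  also have "\<dots> = 1/2 * (1/3) ^ Suc k" using sums_mult2[OF gs, of "(1/3::real) ^ Suc k"] by (simp add: sums_iff)
  finally have "t \<le> 3 ^ Suc k * (1/2 * (1/3) ^ Suc k)" unfolding t_def by (intro mult_left_mono) auto
  also have "\<dots> = 1/2" by (simp add: power_one_over)
  finally have t1: "t \<le> 1/2" .
  have t0: "0 \<le> t" unfolding t_def using f(1) stail by (intro mult_nonneg_nonneg suminf_nonneg) auto
  have "3 ^ Suc k * (\<Sum>n. f n) = of_int (3 * m + b k) + t"
    unfolding suminf_split_initial_segment[OF sf, of "Suc k"] t_def eq[symmetric] by (simp add: distrib_left)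
  then have "\<lfloor>3 ^ Suc k * (\<Sum>n. f n)\<rfloor> = 3 * m + b k" using t0 t1 by (intro floor_unique) auto
  then have "\<lfloor>3 ^ Suc k * (\<Sum>n. f n)\<rfloor> mod 3 = b k" using b[of k] by auto
  then show ?thesis unfolding f_def .
qed

text \<open>
A sequence \<open>y\<close> is determined by the countably many bits \<open>y i < q\<close> with rational \<open>q\<close>, which are stored as ternary
  digits of a real number. Reading a digit is Borel, and \<open>y i\<close> is the supremum of the \<open>q\<close> whose bit is \<open>0\<close>.
\<close>

lemma exists_borel_coding:
  "\<exists>(e :: (nat \<Rightarrow> real) \<Rightarrow> real) d. e \<in> borel_measurable borel \<and> d \<in> borel_measurable borel \<and> (\<forall>y. d (e y) = y)"
proof -
  define r :: "nat \<Rightarrow> real" where "r j = real_of_rat (from_nat j)" for j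
  define b :: "nat \<Rightarrow> (nat \<Rightarrow> real) \<Rightarrow> int" where "b k y = (if y (fst (prod_decode k)) < r (snd (prod_decode k)) then 1 else 0)" for k y
  define e where "e y = (\<Sum>n. real_of_int (b n y) * (1/3) ^ Suc n)" for y
  define D :: "nat \<Rightarrow> real \<Rightarrow> int" where "D k s = \<lfloor>3 ^ Suc k * s\<rfloor> mod 3" for k s
  define d where "d s i = real_of_ereal (SUP j. if D (prod_encode (i, j)) s = 0 then ereal (r j) else - \<infinity>)" for s and i :: nat
  have De: "D k (e y) = b k y" for k y
    unfolding D_def e_def by (rule ternary_digit) (auto simp: b_def)
  have "d (e y) i = y i" for y i
  proof -
    have "(SUP j. if D (prod_encode (i, j)) (e y) = 0 then ereal (r j) else - \<infinity>) = ereal (y i)"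
    proof (rule antisym)
      show "(SUP j. if D (prod_encode (i, j)) (e y) = 0 then ereal (r j) else - \<infinity>) \<le> ereal (y i)"
        by (rule SUP_least) (auto simp: De b_def)
      show "ereal (y i) \<le> (SUP j. if D (prod_encode (i, j)) (e y) = 0 then ereal (r j) else - \<infinity>)"
      proof (rule dense_le)
        fix x assume x: "x < ereal (y i)"
        show "x \<le> (SUP j. if D (prod_encode (i, j)) (e y) = 0 then ereal (r j) else - \<infinity>)"
        proof (cases x)
          case (real a)
          then obtain q where q: "a < real_of_rat q" "real_of_rat q < y i"
            using of_rat_dense[of a "y i"] x by auto
          have "r (to_nat q) = real_of_rat q" by (simp add: r_def)
          then have "D (prod_encode (i, to_nat q)) (e y) = 0" using q by (simp add: De b_def)
          then show ?thesis using q real by (intro SUP_upper2[of "to_nat q"]) (auto simp: r_def)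
        qed (use x in auto)
      qed
    qed
    then show ?thesis by (simp add: d_def)
  qed
  moreover have "(\<lambda>y::nat \<Rightarrow> real. y i) \<in> borel_measurable borel" for i
    by (intro borel_measurable_continuous_onI continuous_intros) simp
  note [measurable] = this
  have [measurable]: "(\<lambda>y. real_of_int (b n y)) \<in> borel_measurable borel" for n
    unfolding b_def by measurable
  have "e \<in> borel_measurable borel" unfolding e_def by measurable
  moreover have "d \<in> borel_measurable borel"
    unfolding d_def D_def by (rule measurable_coordinatewise_then_product) measurable
  ultimately show ?thesis by (intro exI[of _ e] exI[of _ d]) (auto simp: fun_eq_iff)
qed

text \<open>
The coding reduces the claim to real random variables. The decoding is changed to a fixed point of \<open>Y\<close> wherever
  its value is not in \<open>Y\<close>, so that the conditional laws live on \<open>Y\<close>.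
\<close>

theorem exists_regular_cond_law:
  fixes Y :: "(nat \<Rightarrow> real) set"
  assumes "prob_space M" and f: "f \<in> M \<rightarrow>\<^sub>M S" and g: "g \<in> M \<rightarrow>\<^sub>M T"
    and T: "sets T = sets (restrict_space borel Y)" and Y: "Y \<in> sets borel"
  shows "\<exists>\<kappa>. regular_cond_law M S f T g \<kappa>"
proof -
  interpret prob_space M by fact
  have spT: "space T = Y" using sets_eq_imp_space_eq[OF T] by (simp add: space_restrict_space)
  have g': "g \<in> borel_measurable M"
    using measurable_compose[OF g[unfolded measurable_cong_sets[OF refl T]] measurable_restrict_space1[OF measurable_ident]] by simp
  obtain e :: "(nat \<Rightarrow> real) \<Rightarrow> real" and d where e: "e \<in> borel_measurable borel"
    and d: "d \<in> borel_measurable borel" and de: "\<And>y. d (e y) = y" using exists_borel_coding by blast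
  have eg: "(\<lambda>\<omega>. e (g \<omega>)) \<in> borel_measurable M" using measurable_compose[OF g' e] .
  obtain \<kappa> where \<kappa>: "regular_cond_law M S f borel (\<lambda>\<omega>. e (g \<omega>)) \<kappa>"
    using exists_regular_cond_law_real[OF assms(1) f eg] ..
  then have \<kappa>m: "\<kappa> \<in> S \<rightarrow>\<^sub>M prob_algebra borel" by (simp add: regular_cond_law_def)
  obtain \<omega>0 where "\<omega>0 \<in> space M" using not_empty by auto
  then have y0: "g \<omega>0 \<in> Y" using measurable_space[OF g] spT by auto
  define d' where "d' s = (if d s \<in> Y then d s else g \<omega>0)" for s
  have d': "d' \<in> borel \<rightarrow>\<^sub>M T"
    unfolding measurable_cong_sets[OF refl T]
  proof (rule measurable_restrict_space2)
    have [measurable]: "Y \<in> sets borel" "d \<in> borel_measurable borel" by fact+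
    show "d' \<in> borel_measurable borel" unfolding d'_def by measurable
  qed (use y0 in \<open>auto simp: d'_def\<close>)
  have "(\<lambda>x. distr (\<kappa> x) T d') \<in> S \<rightarrow>\<^sub>M prob_algebra T"
    by (rule measurable_compose[OF \<kappa>m measurable_distr_prob_space[OF d']])
  moreover have "emeasure M {\<omega>\<in>space M. f \<omega> \<in> A \<and> g \<omega> \<in> B} =
      (\<integral>\<^sup>+\<omega>. emeasure (distr (\<kappa> (f \<omega>)) T d') B * indicator A (f \<omega>) \<partial>M)"
    if A: "A \<in> sets S" and B: "B \<in> sets T" for A B
  proof -
    have d'B: "d' -` B \<in> sets borel" using measurable_sets[OF d' B] by simp
    have "{\<omega>\<in>space M. f \<omega> \<in> A \<and> g \<omega> \<in> B} = {\<omega>\<in>space M. f \<omega> \<in> A \<and> e (g \<omega>) \<in> d' -` B}"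
      using measurable_space[OF g] by (auto simp: d'_def de spT)
    also have "emeasure M \<dots> = (\<integral>\<^sup>+\<omega>. emeasure (\<kappa> (f \<omega>)) (d' -` B) * indicator A (f \<omega>) \<partial>M)"
      using \<kappa>[unfolded regular_cond_law_def, THEN conjunct2, rule_format, OF A d'B] .
    also have "\<dots> = (\<integral>\<^sup>+\<omega>. emeasure (distr (\<kappa> (f \<omega>)) T d') B * indicator A (f \<omega>) \<partial>M)"
    proof (rule nn_integral_cong)
      fix \<omega> assume "\<omega> \<in> space M"
      then have "\<kappa> (f \<omega>) \<in> space (prob_algebra borel)" using measurable_space[OF \<kappa>m] measurable_space[OF f] by auto
      then have s: "sets (\<kappa> (f \<omega>)) = sets borel" by (simp add: space_prob_algebra)
      have "emeasure (distr (\<kappa> (f \<omega>)) T d') B = emeasure (\<kappa> (f \<omega>)) (d' -` B)"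
        using d' B sets_eq_imp_space_eq[OF s] by (subst emeasure_distr) (auto simp: measurable_cong_sets[OF s refl])
      then show "emeasure (\<kappa> (f \<omega>)) (d' -` B) * indicator A (f \<omega>) = emeasure (distr (\<kappa> (f \<omega>)) T d') B * indicator A (f \<omega>)" by simp
    qed
    finally show ?thesis .
  qed
  ultimately show ?thesis unfolding regular_cond_law_def by blast
qed

text \<open>
Disintegration: the joint law of \<open>f\<close> and \<open>g\<close> is the law of \<open>f\<close> followed by the kernel,
  because the two measures agree on rectangles.
\<close>

lemma regular_cond_law_integral:
  fixes u :: "'b \<times> 'c \<Rightarrow> real"
  assumes "prob_space M" and f: "f \<in> M \<rightarrow>\<^sub>M S" and g: "g \<in> M \<rightarrow>\<^sub>M T"
    and \<kappa>: "regular_cond_law M S f T g \<kappa>"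
    and u: "u \<in> borel_measurable (S \<Otimes>\<^sub>M T)" "\<And>x y. x \<in> space S \<Longrightarrow> y \<in> space T \<Longrightarrow> \<bar>u (x, y)\<bar> \<le> B"
  shows "(\<lambda>x. \<integral>y. u (x, y) \<partial>\<kappa> x) \<in> borel_measurable S"
    and "(\<integral>\<omega>. u (f \<omega>, g \<omega>) \<partial>M) = (\<integral>\<omega>. (\<integral>y. u (f \<omega>, y) \<partial>\<kappa> (f \<omega>)) \<partial>M)"
proof -
  interpret prob_space M by fact
  have \<kappa>m[measurable]: "\<kappa> \<in> S \<rightarrow>\<^sub>M prob_algebra T" using \<kappa> by (simp add: regular_cond_law_def)
  have s\<kappa>: "sets (\<kappa> x) = sets T" "prob_space (\<kappa> x)" if "x \<in> space S" for x
    using measurable_space[OF \<kappa>m that] by (auto simp: space_prob_algebra)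
  define K where "K x = distr (\<kappa> x) (S \<Otimes>\<^sub>M T) (\<lambda>y. (x, y))" for x
  have Km: "K \<in> S \<rightarrow>\<^sub>M prob_algebra (S \<Otimes>\<^sub>M T)"
    unfolding K_def by (rule measurable_distr_prob_space2[OF \<kappa>m]) measurable
  have Ks: "K \<in> S \<rightarrow>\<^sub>M subprob_algebra (S \<Otimes>\<^sub>M T)" by (rule measurable_prob_algebraD[OF Km])
  have pr: "(\<lambda>y. (x, y)) \<in> \<kappa> x \<rightarrow>\<^sub>M S \<Otimes>\<^sub>M T" if "x \<in> space S" for x
    unfolding measurable_cong_sets[OF s\<kappa>(1)[OF that] refl] by (rule measurable_Pair1'[OF that])
  have uK: "(\<integral>z. u z \<partial>K x) = (\<integral>y. u (x, y) \<partial>\<kappa> x)" if "x \<in> space S" for x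
    unfolding K_def by (rule integral_distr[OF pr[OF that] u(1)])
  have "(\<lambda>x. \<integral>z. u z \<partial>K x) \<in> borel_measurable S"
    by (rule measurable_compose[OF Ks integral_measurable_subprob_algebra[OF u(1)]])
  then show m: "(\<lambda>x. \<integral>y. u (x, y) \<partial>\<kappa> x) \<in> borel_measurable S"
    by (rule measurable_cong[THEN iffD1, rotated]) (rule uK)
  have fg: "(\<lambda>\<omega>. (f \<omega>, g \<omega>)) \<in> M \<rightarrow>\<^sub>M S \<Otimes>\<^sub>M T" using f g by (rule measurable_Pair)
  have ne: "space (distr M S f) \<noteq> {}" using measurable_space[OF f] not_empty by auto
  have "distr M (S \<Otimes>\<^sub>M T) (\<lambda>\<omega>. (f \<omega>, g \<omega>)) = distr M S f \<bind> K" (is "?P = ?Q")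
  proof (rule measure_eqI_generator_eq[OF Int_stable_pair_measure_generator[of S T]])
    show "{a \<times> b |a b. a \<in> sets S \<and> b \<in> sets T} \<subseteq> Pow (space S \<times> space T)" by (rule pair_measure_closed)
    show "sets ?P = sigma_sets (space S \<times> space T) {a \<times> b |a b. a \<in> sets S \<and> b \<in> sets T}"
      by (simp add: sets_pair_measure)
    have "sets ?Q = sets (S \<Otimes>\<^sub>M T)"
      using ne by (intro sets_bind sets_kernel[OF Ks]) auto
    then show "sets ?Q = sigma_sets (space S \<times> space T) {a \<times> b |a b. a \<in> sets S \<and> b \<in> sets T}"
      by (simp add: sets_pair_measure)
    show "range (\<lambda>_::nat. space S \<times> space T) \<subseteq> {a \<times> b |a b. a \<in> sets S \<and> b \<in> sets T}" by auto
    show "(\<Union>i::nat. space S \<times> space T) = space S \<times> space T" by simp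
    show "emeasure ?P (space S \<times> space T) \<noteq> \<infinity>" using fg by (simp add: emeasure_distr)
    fix X assume "X \<in> {a \<times> b |a b. a \<in> sets S \<and> b \<in> sets T}"
    then obtain A B where X: "X = A \<times> B" and A: "A \<in> sets S" and B: "B \<in> sets T" by auto
    have XS: "X \<in> sets (S \<Otimes>\<^sub>M T)" unfolding X using A B by (rule pair_measureI)
    have K: "emeasure (K x) X = emeasure (\<kappa> x) B * indicator A x" if "x \<in> space S" for x
    proof -
      have "(\<lambda>y. (x, y)) -` X \<inter> space (\<kappa> x) = (if x \<in> A then B else {})"
        using sets.sets_into_space[OF B] sets_eq_imp_space_eq[OF s\<kappa>(1)[OF that]] by (auto simp: X)
      then show ?thesis unfolding K_def emeasure_distr[OF pr[OF that] XS] by simp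
    qed
    have em: "(\<lambda>x. emeasure (K x) X) \<in> borel_measurable S" by (rule measurable_emeasure_kernel[OF Ks XS])
    have "emeasure ?Q X = (\<integral>\<^sup>+x. emeasure (K x) X \<partial>distr M S f)"
      using ne XS Ks by (intro emeasure_bind[where N = "S \<Otimes>\<^sub>M T"]) auto
    also have "\<dots> = (\<integral>\<^sup>+\<omega>. emeasure (K (f \<omega>)) X \<partial>M)" using em by (intro nn_integral_distr[OF f]) auto
    also have "\<dots> = (\<integral>\<^sup>+\<omega>. emeasure (\<kappa> (f \<omega>)) B * indicator A (f \<omega>) \<partial>M)"
      using measurable_space[OF f] by (intro nn_integral_cong K) auto
    also have "\<dots> = emeasure M {\<omega>\<in>space M. f \<omega> \<in> A \<and> g \<omega> \<in> B}"
      using \<kappa> A B by (simp add: regular_cond_law_def)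
    also have "\<dots> = emeasure ?P X"
      unfolding emeasure_distr[OF fg XS] by (intro arg_cong[where f = "emeasure M"]) (auto simp: X)
    finally show "emeasure ?P X = emeasure ?Q X" ..
  qed
  then have "(\<integral>z. u z \<partial>?P) = (\<integral>z. u z \<partial>?Q)" by simp
  also have "\<dots> = (\<integral>x. (\<integral>z. u z \<partial>K x) \<partial>distr M S f)"
  proof (rule integral_bind[where B' = 1])
    show "\<bar>u z\<bar> \<le> B" if "z \<in> space (S \<Otimes>\<^sub>M T)" for z
      using u(2) that by (auto simp: space_pair_measure)
    show "K \<in> distr M S f \<rightarrow>\<^sub>M subprob_algebra (S \<Otimes>\<^sub>M T)" using Ks by simp
    show "finite_measure (distr M S f)" using prob_space_distr[OF f] by (rule prob_space.finite_measure)
    show "AE x in distr M S f. emeasure (K x) (space (K x)) \<le> ennreal 1"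
    proof (rule AE_I2)
      fix x assume "x \<in> space (distr M S f)"
      then have "prob_space (K x)" using measurable_space[OF Km] by (simp add: space_prob_algebra)
      then show "emeasure (K x) (space (K x)) \<le> ennreal 1" by (simp add: prob_space.emeasure_space_1)
    qed
  qed (rule u(1))
  also have "\<dots> = (\<integral>x. (\<integral>y. u (x, y) \<partial>\<kappa> x) \<partial>distr M S f)"
    by (intro Bochner_Integration.integral_cong) (auto simp: uK)
  also have "\<dots> = (\<integral>\<omega>. (\<integral>y. u (f \<omega>, y) \<partial>\<kappa> (f \<omega>)) \<partial>M)" by (rule integral_distr[OF f m])
  finally show "(\<integral>\<omega>. u (f \<omega>, g \<omega>) \<partial>M) = (\<integral>\<omega>. (\<integral>y. u (f \<omega>, y) \<partial>\<kappa> (f \<omega>)) \<partial>M)"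
    unfolding integral_distr[OF fg u(1)] .
qed

section \<open>Coordinate spaces, supports and couplings\<close>

abbreviation Rspace :: "nat set \<Rightarrow> vec set" where
  "Rspace I \<equiv> Pi\<^sub>E I (\<lambda>_. UNIV)"

lemma Rspace_iff: "x \<in> Rspace I \<longleftrightarrow> (\<forall>k. k \<notin> I \<longrightarrow> x k = undefined)"
  by (auto simp: PiE_iff extensional_def)

text \<open>
The type of all real sequences carries the product topology, and fixing the coordinates outside
  \<open>I\<close> does not change the topology in the others. So $\mathbb{R}^I$ may be treated as a closed subset of a Polish space,
  which makes the topological and measurable type-class library available.
\<close>

lemma top_on_eq: "top_on I = top_of_set (Rspace I)"
proof (rule topology_eq[THEN iffD2], intro allI iffI)
  fix U assume "openin (top_of_set (Rspace I)) U"
  then obtain V where V: "open V" "U = Rspace I \<inter> V" by (auto simp: openin_open)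
  have "continuous_map (top_on I) (product_topology (\<lambda>_. euclideanreal) UNIV) (\<lambda>x. x)"
    unfolding continuous_map_componentwise_UNIV
  proof
    fix k show "continuous_map (top_on I) euclideanreal (\<lambda>x. x k)"
    proof (cases "k \<in> I")
      case True then show ?thesis by (rule continuous_map_product_projection)
    next
      case False
      have "continuous_map (top_on I) euclideanreal (\<lambda>_. undefined)" by simp
      then show ?thesis
        by (rule continuous_map_eq) (use False in \<open>auto simp: PiE_iff extensional_def\<close>)
    qed
  qed
  then have "continuous_map (top_on I) euclidean (\<lambda>x. x)" by (simp add: euclidean_product_topology)
  from openin_continuous_map_preimage[OF this, of V] V
  show "openin (top_on I) U" by (simp add: Int_def conj_commute)
next
  fix U assume U: "openin (top_on I) U"
  have "continuous_map (product_topology (\<lambda>_. euclideanreal) UNIV) (top_on I) (\<lambda>x. restrict x I)"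
    by (rule continuous_on_restrict) simp
  then have "continuous_map euclidean (top_on I) (\<lambda>x. restrict x I)" by (simp add: euclidean_product_topology)
  from openin_continuous_map_preimage[OF this U] have "open {x. restrict x I \<in> U}" by simp
  moreover have "U = Rspace I \<inter> {x. restrict x I \<in> U}"
    using openin_subset[OF U] by (auto simp: PiE_restrict)
  ultimately show "openin (top_of_set (Rspace I)) U" by (auto simp: openin_open)
qed

lemma continuous_on_proj: "continuous_on A (\<lambda>x::vec. x k)"
  by (rule continuous_on_subset[OF continuous_on_product_coordinates]) simp

lemma continuous_on_restrict_vec: "continuous_on A (\<lambda>x::vec. restrict x I)"
proof (rule continuous_on_coordinatewise_then_product)
  fix i show "continuous_on A (\<lambda>x. restrict x I i)"
    by (cases "i \<in> I") (simp_all add: continuous_on_proj)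
qed

lemma closed_Rspace: "closed (Rspace I)"
proof -
  have "Rspace I = (\<Inter>k\<in>-I. {x. x k = undefined})" by (auto simp: Rspace_iff)
  also have "closed \<dots>"
    by (intro closed_INT ballI closed_Collect_eq continuous_on_proj continuous_intros)
  finally show ?thesis .
qed

lemma sets_borel_on: "sets (borel_on I) = sets (restrict_space borel (Rspace I))"
proof -
  have sp: "space (borel_on I) = Rspace I" by (simp add: space_PiM)
  have spr: "space (restrict_space borel (Rspace I)) = Rspace I" by (simp add: space_restrict_space)
  have 1: "(\<lambda>x. x) \<in> borel_on I \<rightarrow>\<^sub>M restrict_space borel (Rspace I)"
  proof (rule measurable_restrict_space2)
    show "(\<lambda>x. x) \<in> borel_on I \<rightarrow>\<^sub>M borel"
    proof (rule measurable_coordinatewise_then_product)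
      fix k show "(\<lambda>x. x k) \<in> borel_measurable (borel_on I)"
      proof (cases "k \<in> I")
        case False
        have "(\<lambda>x. undefined) \<in> borel_measurable (borel_on I)" by simp
        then show ?thesis using False by (subst measurable_cong[where g = "\<lambda>_. undefined"]) (auto simp: space_PiM Rspace_iff)
      qed simp
    qed
  qed (simp add: space_PiM)
  have 2: "(\<lambda>x. x) \<in> restrict_space borel (Rspace I) \<rightarrow>\<^sub>M borel_on I"
    by (rule measurable_PiM_single') (auto simp: space_restrict_space PiE_iff intro!: measurable_restrict_space1)
  show ?thesis
  proof (intro equalityI subsetI)
    fix A assume A: "A \<in> sets (borel_on I)"
    have "(\<lambda>x. x) -` A \<inter> space (restrict_space borel (Rspace I)) = A"
      using sets.sets_into_space[OF A] by (auto simp: sp spr)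
    then show "A \<in> sets (restrict_space borel (Rspace I))" using measurable_sets[OF 2 A] by metis
  next
    fix A assume A: "A \<in> sets (restrict_space borel (Rspace I))"
    have "(\<lambda>x. x) -` A \<inter> space (borel_on I) = A"
      using sets.sets_into_space[OF A] by (auto simp: sp spr)
    then show "A \<in> sets (borel_on I)" using measurable_sets[OF 1 A] by metis
  qed
qed

lemma sets_restrict_borel_on:
  assumes "A \<subseteq> Rspace I"
  shows "sets (restrict_space (borel_on I) A) = sets (restrict_space borel A)"
proof -
  have "sets (restrict_space (borel_on I) A) = sets (restrict_space (restrict_space borel (Rspace I)) A)"
    by (rule sets_restrict_space_cong[OF sets_borel_on])
  also have "\<dots> = sets (restrict_space borel A)"
    using assms by (simp add: sets_restrict_space image_image) (metis Int_absorb2 inf.assoc inf.commute)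
  finally show ?thesis .
qed

lemma Cb_iff: "f \<in> C\<^sub>b (top_on I) \<longleftrightarrow> continuous_on (Rspace I) f \<and> f \<in> bounded_funs (Rspace I)"
  unfolding C\<^sub>b_def top_on_eq by (auto simp: bounded_funs_def)

lemma Cb_subtopology_iff:
  "A \<subseteq> Rspace I \<Longrightarrow> f \<in> C\<^sub>b (subtopology (top_on I) A) \<longleftrightarrow> continuous_on A f \<and> f \<in> bounded_funs A"
  unfolding C\<^sub>b_def top_on_eq by (auto simp: bounded_funs_def subtopology_subtopology Int_absorb1)

lemma supp_subset: "supp N \<mu> \<subseteq> Rspace {1..N}"
  by (auto simp: supp_def)

lemma supp_eq: "supp N \<mu> = Rspace {1..N} - \<Union>{V. open V \<and> emeasure \<mu> (Rspace {1..N} \<inter> V) = 0}"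
proof -
  have "supp N \<mu> = {x \<in> Rspace {1..N}. \<forall>V. open V \<and> x \<in> V \<longrightarrow> 0 < emeasure \<mu> (Rspace {1..N} \<inter> V)}"
    unfolding supp_def top_on_eq by (auto simp: openin_open)
  then show ?thesis by (auto simp: zero_less_iff_neq_zero)
qed

lemma closed_supp: "closed (supp N \<mu>)"
  unfolding supp_eq by (intro closed_Diff closed_Rspace open_Union) auto

context
  fixes N :: nat and \<mu> :: "vec measure"
  assumes \<mu>: "borel_prob N \<mu>"
begin

lemma borel_prob_sets: "sets \<mu> = sets (restrict_space borel (Rspace {1..N}))"
  using \<mu> by (simp add: borel_prob_def sets_borel_on)

lemma borel_prob_space: "space \<mu> = Rspace {1..N}"
  using sets_eq_imp_space_eq[OF borel_prob_sets] by (simp add: space_restrict_space)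

lemma borel_prob_prob_space: "prob_space \<mu>"
  using \<mu> by (simp add: borel_prob_def)

lemma supp_sets: "supp N \<mu> \<in> sets \<mu>"
  unfolding borel_prob_sets sets_restrict_space using closed_supp[of N \<mu>] supp_subset[of N \<mu>]
  by (intro image_eqI[of _ _ "supp N \<mu>"]) auto

text \<open>
By second countability, the union of all open null sets is a union of countably many of them.
\<close>

lemma AE_in_supp: "AE x in \<mu>. x \<in> supp N \<mu>"
proof -
  let ?\<V> = "{V. open V \<and> emeasure \<mu> (Rspace {1..N} \<inter> V) = 0}"
  obtain \<W> where W: "\<W> \<subseteq> ?\<V>" "countable \<W>" "\<Union>\<W> = \<Union>?\<V>"
    using Lindelof[of ?\<V>] by auto
  have n: "Rspace {1..N} \<inter> V \<in> null_sets \<mu>" if "V \<in> ?\<V>" for V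
    using that by (auto simp: null_sets_def borel_prob_sets sets_restrict_space)
  have "(\<Union>V\<in>\<W>. Rspace {1..N} \<inter> V) \<in> null_sets \<mu>"
    using n W(1) by (intro null_sets_UN' W(2)) auto
  then have "AE x in \<mu>. x \<notin> (\<Union>V\<in>\<W>. Rspace {1..N} \<inter> V)" by (rule AE_not_in)
  with AE_space show ?thesis
  proof eventually_elim
    case (elim x)
    then have "x \<notin> \<Union>?\<V>" unfolding W(3)[symmetric] by (auto simp: borel_prob_space)
    then show ?case using elim(1) unfolding supp_eq borel_prob_space by simp
  qed
qed

lemma sets_on_supp: "sets (on_supp N \<mu>) = sets (restrict_space borel (supp N \<mu>))"
proof -
  have "sets (on_supp N \<mu>) = sets (restrict_space (borel_on {1..N}) (supp N \<mu>))"
    using \<mu> by (intro sets_restrict_space_cong) (simp add: borel_prob_def)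
  then show ?thesis unfolding sets_restrict_borel_on[OF supp_subset] .
qed

lemma space_on_supp: "space (on_supp N \<mu>) = supp N \<mu>"
  using supp_subset[of N \<mu>] by (auto simp: space_restrict_space borel_prob_space)

lemma emeasure_supp: "emeasure \<mu> (supp N \<mu>) = 1"
proof -
  interpret prob_space \<mu> by (rule borel_prob_prob_space)
  show ?thesis using AE_in_supp supp_sets by (simp add: emeasure_eq_1_AE)
qed

lemma prob_space_on_supp: "prob_space (on_supp N \<mu>)"
proof (rule prob_spaceI)
  have "emeasure (on_supp N \<mu>) (supp N \<mu>) = emeasure \<mu> (supp N \<mu>)"
    using supp_sets supp_subset by (intro emeasure_restrict_space) (auto simp: borel_prob_space Int_absorb2)
  then show "emeasure (on_supp N \<mu>) (space (on_supp N \<mu>)) = 1" by (simp add: space_on_supp emeasure_supp)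
qed

text \<open>
The dual problem integrates over \<open>\<mu>\<close> and the couplings live on the support; this lemma reconciles the two.
\<close>

lemma integral_on_supp:
  fixes f :: "vec \<Rightarrow> real"
  assumes "f \<in> borel_measurable \<mu>"
  shows "(\<integral>x. f x \<partial>on_supp N \<mu>) = (\<integral>x. f x \<partial>\<mu>)"
proof -
  have "(\<integral>x. f x \<partial>on_supp N \<mu>) = (\<integral>x. indicator (supp N \<mu>) x *\<^sub>R f x \<partial>\<mu>)"
    using supp_sets supp_subset by (intro integral_restrict_space) (simp add: borel_prob_space Int_absorb2)
  also have "\<dots> = (\<integral>x. f x \<partial>\<mu>)"
  proof (rule integral_cong_AE)
    show "AE x in \<mu>. indicat_real (supp N \<mu>) x *\<^sub>R f x = f x"
      using AE_in_supp by eventually_elim simp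
  qed (use assms supp_sets in auto)
  finally show ?thesis .
qed

lemma id_measurable_on_supp: "(\<lambda>x. x) \<in> on_supp N \<mu> \<rightarrow>\<^sub>M borel"
  unfolding measurable_cong_sets[OF sets_on_supp refl] by (rule measurable_restrict_space1) simp

lemma continuous_measurable_on_supp:
  fixes f :: "vec \<Rightarrow> real"
  assumes "continuous_on (supp N \<mu>) f" shows "f \<in> borel_measurable (on_supp N \<mu>)"
  unfolding measurable_cong_sets[OF sets_on_supp refl] using assms by (rule borel_measurable_continuous_on_restrict)

lemma Cb_measurable:
  assumes "f \<in> C\<^sub>b (top_on {1..N})" shows "f \<in> borel_measurable \<mu>"
  unfolding measurable_cong_sets[OF borel_prob_sets refl]
  using assms by (intro borel_measurable_continuous_on_restrict) (simp add: Cb_iff)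

lemma Cb_continuous_on_supp:
  assumes "f \<in> C\<^sub>b (top_on {1..N})" shows "continuous_on (supp N \<mu>) f"
  using assms continuous_on_subset[OF _ supp_subset] unfolding Cb_iff by blast

end

lemma on_supp_setsE:
  assumes "borel_prob N \<mu>" "A \<in> sets (on_supp N \<mu>)"
  obtains A' where "A' \<in> sets borel" "A = supp N \<mu> \<inter> A'"
proof -
  have "A \<in> sets (restrict_space borel (supp N \<mu>))" using assms sets_on_supp by blast
  then show ?thesis using that by (auto simp: sets_restrict_space)
qed

lemma bounded_funs_subset: "f \<in> bounded_funs A \<Longrightarrow> B \<subseteq> A \<Longrightarrow> f \<in> bounded_funs B"
  by (auto simp: bounded_funs_iff)

lemma (in prob_space) integrable_bounded_funs:
  assumes "f \<in> borel_measurable M" "f \<in> bounded_funs \<Omega>" "space M \<subseteq> \<Omega>"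
  shows "integrable M f"
proof -
  obtain B where "\<forall>z\<in>\<Omega>. \<bar>f z\<bar> \<le> B" using assms(2) by (auto simp: bounded_funs_iff)
  then show ?thesis using assms(1,3) by (intro integrable_const_bound[of _ B]) (auto intro!: AE_I2)
qed

locale marginals =
  fixes N :: nat and \<mu> \<nu> :: "vec measure"
  assumes \<mu>: "borel_prob N \<mu>" and \<nu>: "borel_prob N \<nu>"
begin

abbreviation "X \<equiv> supp N \<mu>"
abbreviation "Y \<equiv> supp N \<nu>"
abbreviation "PX \<equiv> on_supp N \<mu>"
abbreviation "PY \<equiv> on_supp N \<nu>"

lemmas sets_PX = sets_on_supp[OF \<mu>] and sets_PY = sets_on_supp[OF \<nu>]
lemmas space_PX = space_on_supp[OF \<mu>] and space_PY = space_on_supp[OF \<nu>]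

lemma sets_pair_eq:
  "sets (restrict_space (borel_on {1..N}) X \<Otimes>\<^sub>M restrict_space (borel_on {1..N}) Y) = sets (PX \<Otimes>\<^sub>M PY)"
  by (rule sets_pair_measure_cong) (simp_all only: sets_restrict_borel_on[OF supp_subset] sets_PX sets_PY)

lemma sets_pair_eq_restrict_borel: "sets (PX \<Otimes>\<^sub>M PY) = sets (restrict_space borel (X \<times> Y))"
proof -
  have sp: "space (PX \<Otimes>\<^sub>M PY) = X \<times> Y" by (simp add: space_pair_measure space_PX space_PY)
  have spr: "space (restrict_space borel (X \<times> Y)) = X \<times> Y" by (simp add: space_restrict_space)
  have m1: "(\<lambda>z. z) \<in> PX \<Otimes>\<^sub>M PY \<rightarrow>\<^sub>M restrict_space borel (X \<times> Y)"
  proof (rule measurable_restrict_space2)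
    have "(\<lambda>z. (fst z, snd z)) \<in> PX \<Otimes>\<^sub>M PY \<rightarrow>\<^sub>M borel \<Otimes>\<^sub>M borel"
      by (intro measurable_Pair measurable_compose[OF measurable_fst id_measurable_on_supp[OF \<mu>]]
          measurable_compose[OF measurable_snd id_measurable_on_supp[OF \<nu>]])
    then show "(\<lambda>z. z) \<in> PX \<Otimes>\<^sub>M PY \<rightarrow>\<^sub>M borel" by (simp add: borel_prod)
  qed (simp add: sp)
  have m2: "(\<lambda>z. z) \<in> restrict_space borel (X \<times> Y) \<rightarrow>\<^sub>M PX \<Otimes>\<^sub>M PY"
  proof -
    have "(\<lambda>z. (fst z, snd z)) \<in> restrict_space borel (X \<times> Y) \<rightarrow>\<^sub>M PX \<Otimes>\<^sub>M PY"
    proof (rule measurable_Pair)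
      show "fst \<in> restrict_space borel (X \<times> Y) \<rightarrow>\<^sub>M PX"
        unfolding measurable_cong_sets[OF refl sets_PX]
        by (intro measurable_restrict_space2 measurable_restrict_space1 borel_measurable_continuous_onI continuous_intros)
           (auto simp: spr)
      show "snd \<in> restrict_space borel (X \<times> Y) \<rightarrow>\<^sub>M PY"
        unfolding measurable_cong_sets[OF refl sets_PY]
        by (intro measurable_restrict_space2 measurable_restrict_space1 borel_measurable_continuous_onI continuous_intros)
           (auto simp: spr)
    qed
    then show ?thesis by simp
  qed
  show ?thesis
  proof (intro equalityI subsetI)
    fix A assume A: "A \<in> sets (PX \<Otimes>\<^sub>M PY)"
    have "(\<lambda>z. z) -` A \<inter> space (restrict_space borel (X \<times> Y)) = A"
      using sets.sets_into_space[OF A] by (auto simp: sp spr)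
    then show "A \<in> sets (restrict_space borel (X \<times> Y))" using measurable_sets[OF m2 A] by metis
  next
    fix A assume A: "A \<in> sets (restrict_space borel (X \<times> Y))"
    have "(\<lambda>z. z) -` A \<inter> space (PX \<Otimes>\<^sub>M PY) = A"
      using sets.sets_into_space[OF A] by (auto simp: sp spr)
    then show "A \<in> sets (PX \<Otimes>\<^sub>M PY)" using measurable_sets[OF m1 A] by metis
  qed
qed

lemma couplings_iff:
  "\<gamma> \<in> couplings N \<mu> \<nu> \<longleftrightarrow> prob_space \<gamma> \<and> sets \<gamma> = sets (PX \<Otimes>\<^sub>M PY) \<and>
     distr \<gamma> PX fst = PX \<and> distr \<gamma> PY snd = PY"
  unfolding couplings_def sets_pair_eq mem_Collect_eq ..

context
  fixes \<gamma> assumes \<gamma>: "\<gamma> \<in> couplings N \<mu> \<nu>"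
begin

lemma coupling_prob_space: "prob_space \<gamma>" and coupling_sets: "sets \<gamma> = sets (PX \<Otimes>\<^sub>M PY)"
  using \<gamma> by (auto simp: couplings_iff)

lemma coupling_space: "space \<gamma> = X \<times> Y"
  using sets_eq_imp_space_eq[OF coupling_sets] by (simp add: space_pair_measure space_PX space_PY)

lemma coupling_fst: "fst \<in> \<gamma> \<rightarrow>\<^sub>M PX" and coupling_snd: "snd \<in> \<gamma> \<rightarrow>\<^sub>M PY"
  by (auto simp: measurable_cong_sets[OF coupling_sets refl])

lemma coupling_integral_fst:
  fixes f :: "vec \<Rightarrow> real"
  assumes "f \<in> borel_measurable PX"
  shows "(\<integral>z. f (fst z) \<partial>\<gamma>) = (\<integral>x. f x \<partial>PX)"
proof -
  have "(\<integral>x. f x \<partial>PX) = (\<integral>x. f x \<partial>distr \<gamma> PX fst)" using \<gamma> by (simp add: couplings_iff)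
  then show ?thesis using assms by (simp add: integral_distr[OF coupling_fst])
qed

lemma coupling_integral_snd:
  fixes f :: "vec \<Rightarrow> real"
  assumes "f \<in> borel_measurable PY"
  shows "(\<integral>z. f (snd z) \<partial>\<gamma>) = (\<integral>x. f x \<partial>PY)"
proof -
  have "(\<integral>x. f x \<partial>PY) = (\<integral>x. f x \<partial>distr \<gamma> PY snd)" using \<gamma> by (simp add: couplings_iff)
  then show ?thesis using assms by (simp add: integral_distr[OF coupling_snd])
qed

lemma coupling_continuous_measurable:
  fixes f :: "vec \<times> vec \<Rightarrow> real"
  assumes "continuous_on (X \<times> Y) f" shows "f \<in> borel_measurable \<gamma>"
  unfolding measurable_cong_sets[OF coupling_sets[unfolded sets_pair_eq_restrict_borel] refl]
  using assms by (rule borel_measurable_continuous_on_restrict)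

end

end

section \<open>Causal couplings and weak duality\<close>

lemma (in prob_space) sigma_finite_subalgebraI:
  assumes "subalgebra M F" shows "sigma_finite_subalgebra M F"
  using assms by (intro finite_measure_subalgebra_is_sigma_finite)
    (simp add: finite_measure_subalgebra_def finite_measure_axioms finite_measure_subalgebra_axioms_def)

text \<open>
The hypothesis says that \<open>D\<close> has conditional expectation zero given \<open>F\<close>.
\<close>

lemma (in sigma_finite_subalgebra) integral_mult_eq_0:
  fixes D f :: "'a \<Rightarrow> real"
  assumes D: "integrable M D" and zero: "\<And>A. A \<in> sets F \<Longrightarrow> (\<integral>x. indicat_real A x * D x \<partial>M) = 0"
    and f: "f \<in> borel_measurable F" and fD: "integrable M (\<lambda>x. f x * D x)"
  shows "(\<integral>x. f x * D x \<partial>M) = 0"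
proof -
  have "AE x in M. real_cond_exp M F D x = 0"
    using zero D by (intro real_cond_exp_charact) (auto simp: set_lebesgue_integral_def)
  then have "AE x in M. f x * real_cond_exp M F D x = 0" by eventually_elim simp
  then have "(\<integral>x. f x * real_cond_exp M F D x \<partial>M) = 0" by (rule integral_eq_zero_AE)
  then show ?thesis using real_cond_exp_intg(2)[OF fD f] D by simp
qed

lemma initial_Rspace: "initial t x \<in> Rspace {1..t}"
  by simp

lemma coord_filtration_space: "space (coord_filtration N \<mu> t) = supp N \<mu>"
  by (simp add: coord_filtration_def)

lemma coord_filtration_sets:
  "sets (coord_filtration N \<mu> t) = {initial t -` A \<inter> supp N \<mu> | A. A \<in> sets (borel_on {1..t})}"
  unfolding coord_filtration_def by (rule sets_vimage_algebra2) (simp add: space_PiM)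

lemma initial_measurable_coord_filtration: "initial t \<in> coord_filtration N \<mu> t \<rightarrow>\<^sub>M borel_on {1..t}"
  unfolding coord_filtration_def by (rule measurable_vimage_algebra1) (simp add: space_PiM)

lemma restrict_measurable_borel: "(\<lambda>x. restrict x I) \<in> borel \<rightarrow>\<^sub>M borel_on I"
  unfolding measurable_cong_sets[OF refl sets_borel_on]
  by (intro measurable_restrict_space2 borel_measurable_continuous_onI continuous_on_restrict_vec) simp

lemma coord_filtration_sets_borel:
  "sets (coord_filtration N \<mu> t) = {initial t -` A \<inter> supp N \<mu> | A. A \<in> sets borel}"
proof -
  show ?thesis unfolding coord_filtration_sets
  proof (intro equalityI subsetI)
    fix B assume "B \<in> {initial t -` A \<inter> supp N \<mu> | A. A \<in> sets (borel_on {1..t})}"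
    then obtain A where A: "A \<in> sets (borel_on {1..t})" "B = initial t -` A \<inter> supp N \<mu>" by blast
    from A(1) obtain A' where A': "A' \<in> sets borel" "A = Rspace {1..t} \<inter> A'"
      unfolding sets_borel_on sets_restrict_space by blast
    have "B = initial t -` A' \<inter> supp N \<mu>" unfolding A(2) A'(2) using initial_Rspace[of _ t] by blast
    then show "B \<in> {initial t -` A \<inter> supp N \<mu> | A. A \<in> sets borel}" using A'(1) by blast
  next
    fix B assume "B \<in> {initial t -` A \<inter> supp N \<mu> | A. A \<in> sets borel}"
    then obtain A where A: "A \<in> sets borel" "B = initial t -` A \<inter> supp N \<mu>" by blast
    have "B = initial t -` (Rspace {1..t} \<inter> A) \<inter> supp N \<mu>" unfolding A(2) using initial_Rspace[of _ t] by blast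
    moreover have "Rspace {1..t} \<inter> A \<in> sets (borel_on {1..t})"
      unfolding sets_borel_on sets_restrict_space using A(1) by blast
    ultimately show "B \<in> {initial t -` A \<inter> supp N \<mu> | A. A \<in> sets (borel_on {1..t})}" by blast
  qed
qed

context
  fixes N :: nat and \<mu> :: "vec measure"
  assumes \<mu>: "borel_prob N \<mu>"
begin

lemma initial_measurable_on_supp: "initial t \<in> on_supp N \<mu> \<rightarrow>\<^sub>M borel_on {1..t}"
  by (rule measurable_compose[OF id_measurable_on_supp[OF \<mu>] restrict_measurable_borel])

lemma subalgebra_coord_filtration: "subalgebra (on_supp N \<mu>) (coord_filtration N \<mu> t)"
  unfolding subalgebra_def coord_filtration_space space_on_supp[OF \<mu>]
proof safe
  fix B assume "B \<in> sets (coord_filtration N \<mu> t)"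
  then obtain A where "A \<in> sets (borel_on {1..t})" "B = initial t -` A \<inter> supp N \<mu>"
    by (auto simp: coord_filtration_sets)
  then show "B \<in> sets (on_supp N \<mu>)"
    using measurable_sets[OF initial_measurable_on_supp] by (simp add: space_on_supp[OF \<mu>])
qed

lemma coord_filtration_subset: "A \<in> sets (coord_filtration N \<mu> t) \<Longrightarrow> A \<in> sets (on_supp N \<mu>)"
  using subalgebra_coord_filtration by (auto simp: subalgebra_def)

lemma coord_filtration_mono:
  assumes "s \<le> t" shows "sets (coord_filtration N \<mu> s) \<subseteq> sets (coord_filtration N \<mu> t)"
proof
  fix B assume "B \<in> sets (coord_filtration N \<mu> s)"
  then obtain A where A: "A \<in> sets borel" "B = initial s -` A \<inter> supp N \<mu>"
    by (auto simp: coord_filtration_sets_borel)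
  have m: "(\<lambda>x::vec. initial s x) \<in> borel_measurable borel"
    by (intro borel_measurable_continuous_onI continuous_on_restrict_vec)
  have "initial s -` A \<in> sets borel" using measurable_sets[OF m A(1)] by simp
  moreover have "B = initial t -` (initial s -` A) \<inter> supp N \<mu>"
    using assms by (simp add: A(2) vimage_def Int_absorb1)
  ultimately show "B \<in> sets (coord_filtration N \<mu> t)" unfolding coord_filtration_sets_borel by blast
qed

lemma sigma_finite_subalgebra_coord_filtration: "sigma_finite_subalgebra (on_supp N \<mu>) (coord_filtration N \<mu> t)"
  using prob_space_on_supp[OF \<mu>] subalgebra_coord_filtration
  by (intro prob_space.sigma_finite_subalgebraI)

end

lemma Cb_initial_measurable_coord_filtration:
  assumes "h \<in> C\<^sub>b (top_on {1..t})"
  shows "(\<lambda>y. h (initial t y)) \<in> borel_measurable (coord_filtration N \<nu> t)"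
proof -
  have "h \<in> borel_measurable (borel_on {1..t})"
    unfolding measurable_cong_sets[OF sets_borel_on refl]
    using assms unfolding Cb_iff by (intro borel_measurable_continuous_on_restrict) simp
  then show ?thesis by (rule measurable_compose[OF initial_measurable_coord_filtration])
qed

lemma Cb_initial_bounded:
  assumes "h \<in> C\<^sub>b (top_on {1..t})" shows "(\<lambda>y. h (initial t y)) \<in> bounded_funs A"
proof -
  obtain B where "\<And>y. y \<in> Rspace {1..t} \<Longrightarrow> \<bar>h y\<bar> \<le> B" using assms unfolding Cb_iff bounded_funs_iff by blast
  then show ?thesis unfolding bounded_funs_iff using initial_Rspace by blast
qed

lemma continuous_on_Cb_initial:
  fixes h :: "vec \<Rightarrow> real"
  assumes "h \<in> C\<^sub>b (top_on {1..t})" shows "continuous_on A (\<lambda>y. h (initial t y))"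
  using assms unfolding Cb_iff
  by (intro continuous_on_compose2[OF _ continuous_on_restrict_vec, of "Rspace {1..t}" h]) auto

context marginals
begin

text \<open>
This expresses an integral under a coupling through the conditional probabilities that
  the definition of causality constrains.
\<close>

lemma kernel_indicator_integral:
  fixes D :: "vec \<Rightarrow> real"
  assumes \<gamma>: "\<gamma> \<in> couplings N \<mu> \<nu>" and \<kappa>: "regular_cond_law \<gamma> PX fst PY snd \<kappa>"
    and B: "B \<in> sets PY" and D: "D \<in> borel_measurable PX" "D \<in> bounded_funs X"
  shows "(\<integral>z. indicat_real B (snd z) * D (fst z) \<partial>\<gamma>) = (\<integral>x. measure (\<kappa> x) B * D x \<partial>PX)"
proof -
  interpret \<gamma>: prob_space \<gamma> by (rule coupling_prob_space[OF \<gamma>])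
  have fst: "fst \<in> \<gamma> \<rightarrow>\<^sub>M PX" and snd: "snd \<in> \<gamma> \<rightarrow>\<^sub>M PY"
    by (rule coupling_fst[OF \<gamma>]) (rule coupling_snd[OF \<gamma>])
  have \<kappa>m: "\<kappa> \<in> PX \<rightarrow>\<^sub>M prob_algebra PY" using \<kappa> by (simp add: regular_cond_law_def)
  obtain C where C: "\<And>x. x \<in> X \<Longrightarrow> \<bar>D x\<bar> \<le> C" using D(2) by (auto simp: bounded_funs_iff)
  define u where "u z = indicat_real B (snd z) * D (fst z)" for z :: "vec \<times> vec"
  have um: "u \<in> borel_measurable (PX \<Otimes>\<^sub>M PY)"
    unfolding u_def using D(1) B by measurable
  have C0: "\<bar>u (x, y)\<bar> \<le> C" if "x \<in> space PX" "y \<in> space PY" for x y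
    using C[of x] that by (auto simp: u_def space_PX indicator_def)
  have uk: "(\<integral>y. u (x, y) \<partial>\<kappa> x) = measure (\<kappa> x) B * D x" if "x \<in> space PX" for x
  proof -
    have "sets (\<kappa> x) = sets PY" using measurable_space[OF \<kappa>m that] by (simp add: space_prob_algebra)
    then have "B \<inter> space (\<kappa> x) = B" using sets.sets_into_space[OF B] sets_eq_imp_space_eq[of "\<kappa> x" PY] by auto
    then show ?thesis unfolding u_def by simp
  qed
  have "(\<integral>z. indicat_real B (snd z) * D (fst z) \<partial>\<gamma>) = (\<integral>z. (\<integral>y. u (fst z, y) \<partial>\<kappa> (fst z)) \<partial>\<gamma>)"
    using regular_cond_law_integral(2)[OF \<gamma>.prob_space_axioms fst snd \<kappa> um C0] by (simp add: u_def)
  also have "\<dots> = (\<integral>x. (\<integral>y. u (x, y) \<partial>\<kappa> x) \<partial>PX)"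
    by (rule coupling_integral_fst[OF \<gamma> regular_cond_law_integral(1)[OF \<gamma>.prob_space_axioms fst snd \<kappa> um C0]])
  also have "\<dots> = (\<integral>x. measure (\<kappa> x) B * D x \<partial>PX)"
    by (intro Bochner_Integration.integral_cong uk) auto
  finally show ?thesis .
qed

text \<open>
For the indicator of an event \<open>B\<close> about \<open>y\<^sub>1, \<dots>, y\<^sub>t\<close> the integral is that of
  \<open>\<kappa> x B\<close> times \<open>D x\<close>, where the first factor is \<open>F\<^sub>t\<close>-measurable by causality. Hence \<open>D\<close> has conditional expectation zero
  under \<open>\<gamma>\<close> given \<open>y\<^sub>1, \<dots>, y\<^sub>t\<close>, which gives general \<open>h\<close>.
\<close>

lemma causal_orthogonal:
  fixes h D :: "vec \<Rightarrow> real"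
  assumes \<gamma>: "\<gamma> \<in> causal_couplings N \<mu> \<nu>" and t: "t \<in> {1..N}"
    and h: "h \<in> borel_measurable (coord_filtration N \<nu> t)" "h \<in> bounded_funs Y"
    and D: "D \<in> borel_measurable PX" "D \<in> bounded_funs X"
    and zero: "\<And>A. A \<in> sets (coord_filtration N \<mu> t) \<Longrightarrow> (\<integral>x. indicat_real A x * D x \<partial>PX) = 0"
  shows "(\<integral>z. h (snd z) * D (fst z) \<partial>\<gamma>) = 0"
proof -
  have \<gamma>c: "\<gamma> \<in> couplings N \<mu> \<nu>" and "causal N \<mu> \<nu> \<gamma>" using \<gamma> by (auto simp: causal_couplings_def)
  then obtain \<kappa> where \<kappa>: "regular_cond_law \<gamma> PX fst PY snd \<kappa>"
    and ad: "\<And>B. B \<in> sets (coord_filtration N \<nu> t) \<Longrightarrow>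
        \<exists>f\<in>borel_measurable (coord_filtration N \<mu> t). AE x in PX. measure (\<kappa> x) B = f x"
    using t unfolding causal_def by blast
  interpret \<gamma>: prob_space \<gamma> by (rule coupling_prob_space[OF \<gamma>c])
  interpret PX: prob_space PX by (rule prob_space_on_supp[OF \<mu>])
  interpret FX: sigma_finite_subalgebra PX "coord_filtration N \<mu> t"
    by (rule sigma_finite_subalgebra_coord_filtration[OF \<mu>])
  have \<kappa>m: "\<kappa> \<in> PX \<rightarrow>\<^sub>M prob_algebra PY" using \<kappa> by (simp add: regular_cond_law_def)
  obtain C where C: "\<And>x. x \<in> X \<Longrightarrow> \<bar>D x\<bar> \<le> C" using D(2) by (auto simp: bounded_funs_iff)
  have Di: "integrable PX D" by (rule PX.integrable_bounded_funs[OF D]) (simp add: space_PX)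
  have fst: "fst \<in> \<gamma> \<rightarrow>\<^sub>M PX" and snd: "snd \<in> \<gamma> \<rightarrow>\<^sub>M PY"
    by (rule coupling_fst[OF \<gamma>c]) (rule coupling_snd[OF \<gamma>c])
  have D\<gamma>: "(\<lambda>z. D (fst z)) \<in> borel_measurable \<gamma>" by (rule measurable_compose[OF fst D(1)])
  have D\<gamma>i: "integrable \<gamma> (\<lambda>z. D (fst z))"
    using C D\<gamma> by (intro \<gamma>.integrable_const_bound[of _ C]) (auto simp: coupling_space[OF \<gamma>c])
  have ind: "(\<integral>z. indicat_real B (snd z) * D (fst z) \<partial>\<gamma>) = 0" if B: "B \<in> sets (coord_filtration N \<nu> t)" for B
  proof -
    have BY: "B \<in> sets PY" by (rule coord_filtration_subset[OF \<nu> B])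
    obtain f where f: "f \<in> borel_measurable (coord_filtration N \<mu> t)" "AE x in PX. measure (\<kappa> x) B = f x"
      using ad[OF B] by auto
    have "(\<integral>z. indicat_real B (snd z) * D (fst z) \<partial>\<gamma>) = (\<integral>x. measure (\<kappa> x) B * D x \<partial>PX)"
      by (rule kernel_indicator_integral[OF \<gamma>c \<kappa> BY D])
    \<comment> \<open>The version \<open>f\<close> is a probability only almost everywhere; truncation makes it bounded and keeps it measurable.\<close>
    also have "\<dots> = (\<integral>x. max 0 (min 1 (f x)) * D x \<partial>PX)"
    proof (rule integral_cong_AE)
      have "(\<lambda>x. measure (\<kappa> x) B) \<in> borel_measurable PX"
        by (rule measurable_compose[OF measurable_prob_algebraD[OF \<kappa>m] measurable_measure_subprob_algebra[OF BY]])
      then show "(\<lambda>x. measure (\<kappa> x) B * D x) \<in> borel_measurable PX" using D(1) by simp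
      show "(\<lambda>x. max 0 (min 1 (f x)) * D x) \<in> borel_measurable PX"
        using measurable_from_subalg[OF subalgebra_coord_filtration[OF \<mu>] f(1)] D(1) by simp
      show "AE x in PX. measure (\<kappa> x) B * D x = max 0 (min 1 (f x)) * D x"
        using f(2) AE_space
      proof eventually_elim
        case (elim x)
        have "prob_space (\<kappa> x)" using measurable_space[OF \<kappa>m elim(2)] by (simp add: space_prob_algebra)
        then have "0 \<le> f x" "f x \<le> 1" using prob_space.prob_le_1[of "\<kappa> x" B] elim(1)[symmetric] by simp_all
        then show ?case using elim by simp
      qed
    qed
    also have "\<dots> = 0"
    proof (rule FX.integral_mult_eq_0[OF Di zero])
      show "integrable PX (\<lambda>x. max 0 (min 1 (f x)) * D x)"
        using measurable_from_subalg[OF subalgebra_coord_filtration[OF \<mu>] f(1)] D(1)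
        by (intro Bochner_Integration.integrable_bound[OF Di]) (auto simp: abs_mult intro!: AE_I2 mult_left_le_one_le)
    qed (use f(1) in auto)
    finally show ?thesis .
  qed
  define G where "G = vimage_algebra (X \<times> Y) snd (coord_filtration N \<nu> t)"
  have sn: "snd \<in> X \<times> Y \<rightarrow> space (coord_filtration N \<nu> t)" by (auto simp: coord_filtration_space)
  have "subalgebra \<gamma> G"
    unfolding subalgebra_def G_def
  proof safe
    fix B assume "B \<in> sets (vimage_algebra (X \<times> Y) snd (coord_filtration N \<nu> t))"
    then obtain B' where B': "B' \<in> sets (coord_filtration N \<nu> t)" "B = snd -` B' \<inter> (X \<times> Y)"
      by (auto simp: sets_vimage_algebra2[OF sn])
    show "B \<in> sets \<gamma>"
      using measurable_sets[OF snd coord_filtration_subset[OF \<nu> B'(1)]] by (simp add: B'(2) coupling_space[OF \<gamma>c])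
  qed (auto simp: coupling_space[OF \<gamma>c])
  then interpret G: sigma_finite_subalgebra \<gamma> G by (rule \<gamma>.sigma_finite_subalgebraI)
  obtain C' where C': "\<And>y. y \<in> Y \<Longrightarrow> \<bar>h y\<bar> \<le> C'" using h(2) by (auto simp: bounded_funs_iff)
  show ?thesis
  proof (rule G.integral_mult_eq_0[OF D\<gamma>i])
    fix B assume "B \<in> sets G"
    then obtain B' where B': "B' \<in> sets (coord_filtration N \<nu> t)" "B = snd -` B' \<inter> (X \<times> Y)"
      unfolding G_def by (auto simp: sets_vimage_algebra2[OF sn])
    have "(\<integral>z. indicat_real B z * D (fst z) \<partial>\<gamma>) = (\<integral>z. indicat_real B' (snd z) * D (fst z) \<partial>\<gamma>)"
      by (intro Bochner_Integration.integral_cong) (auto simp: B'(2) coupling_space[OF \<gamma>c] indicator_def)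
    then show "(\<integral>z. indicat_real B z * D (fst z) \<partial>\<gamma>) = 0" using ind[OF B'(1)] by simp
  next
    show "(\<lambda>z. h (snd z)) \<in> borel_measurable G"
      unfolding G_def by (rule measurable_compose[OF measurable_vimage_algebra1[OF sn] h(1)])
    have "(\<lambda>z. h (snd z)) \<in> borel_measurable \<gamma>"
      by (rule measurable_compose[OF snd measurable_from_subalg[OF subalgebra_coord_filtration[OF \<nu>] h(1)]])
    moreover have "\<bar>h (snd z) * D (fst z)\<bar> \<le> C' * C" if "z \<in> X \<times> Y" for z
      using C[of "fst z"] C'[of "snd z"] that
      by (auto simp: abs_mult intro!: mult_mono order_trans[OF abs_ge_zero C'])
    ultimately show "integrable \<gamma> (\<lambda>z. h (snd z) * D (fst z))"
      using D\<gamma> by (intro \<gamma>.integrable_const_bound[of _ "C' * C"]) (auto simp: coupling_space[OF \<gamma>c])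
  qed
qed

lemma SS_integral_zero:
  assumes \<gamma>: "\<gamma> \<in> causal_couplings N \<mu> \<nu>" and S: "S \<in> SS N \<mu> \<nu>"
  shows "integrable \<gamma> S" "(\<integral>z. S z \<partial>\<gamma>) = 0"
proof -
  have \<gamma>c: "\<gamma> \<in> couplings N \<mu> \<nu>" using \<gamma> by (auto simp: causal_couplings_def)
  interpret \<gamma>: prob_space \<gamma> by (rule coupling_prob_space[OF \<gamma>c])
  interpret PX: prob_space PX by (rule prob_space_on_supp[OF \<mu>])
  obtain H M where H: "\<And>t. t \<in> {1..<N} \<Longrightarrow> H t \<in> C\<^sub>b (top_on {1..t})"
    and M: "\<And>t. t \<in> {1..N} \<Longrightarrow> M t \<in> C\<^sub>b (subtopology (top_on {1..t}) (supp_proj N \<mu> t))"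
    and mart: "martingale PX (coord_filtration N \<mu>) {1..N} (\<lambda>t x. M t (initial t x))"
    and Seq: "\<And>x y. x \<in> X \<Longrightarrow> y \<in> Y \<Longrightarrow> S (x, y) = (\<Sum>t \<in> {1..<N}. H t (initial t y) *
          (M (Suc t) (initial (Suc t) x) - M t (initial t x)))"
    using S unfolding SS_def by blast
  define D where "D t x = M (Suc t) (initial (Suc t) x) - M t (initial t x)" for t x
  have Mm: "(\<lambda>x. M t (initial t x)) \<in> borel_measurable PX" "integrable PX (\<lambda>x. M t (initial t x))"
    if "t \<in> {1..N}" for t
    using mart that by (auto simp: martingale_def)
  have Mb: "(\<lambda>x. M t (initial t x)) \<in> bounded_funs X" if "t \<in> {1..N}" for t
  proof -
    have "supp_proj N \<mu> t \<subseteq> Rspace {1..t}" using initial_Rspace by blast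
    then show ?thesis using M[OF that] by (simp add: Cb_subtopology_iff bounded_funs_def image_image)
  qed
  have Db: "D t \<in> bounded_funs X" if "t \<in> {1..<N}" for t
    using function_space_add[OF function_space_bounded_funs Mb[of "Suc t"]
        function_space_mult[OF function_space_bounded_funs Mb[of t], of "-1"]] that
    by (simp add: D_def[abs_def])
  have Dm: "D t \<in> borel_measurable PX" if "t \<in> {1..<N}" for t
    unfolding D_def[abs_def] using Mm(1)[of t] Mm(1)[of "Suc t"] that by simp
  have trm: "integrable \<gamma> (\<lambda>z. H t (initial t (snd z)) * D t (fst z))"
    "(\<integral>z. H t (initial t (snd z)) * D t (fst z) \<partial>\<gamma>) = 0" if t: "t \<in> {1..<N}" for t
  proof -
    have t1: "t \<in> {1..N}" "Suc t \<in> {1..N}" using t by auto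
    interpret FX: sigma_finite_subalgebra PX "coord_filtration N \<mu> t"
      by (rule sigma_finite_subalgebra_coord_filtration[OF \<mu>])
    show "(\<integral>z. H t (initial t (snd z)) * D t (fst z) \<partial>\<gamma>) = 0"
    proof (rule causal_orthogonal[OF \<gamma> t1(1)])
      fix A assume A: "A \<in> sets (coord_filtration N \<mu> t)"
      have A': "A \<in> sets PX" by (rule coord_filtration_subset[OF \<mu> A])
      have "AE x in PX. real_cond_exp PX (coord_filtration N \<mu> t) (\<lambda>x. M (Suc t) (initial (Suc t) x)) x = M t (initial t x)"
        using mart t1 by (auto simp: martingale_def)
      then have ae: "AE x in PX. indicat_real A x * real_cond_exp PX (coord_filtration N \<mu> t) (\<lambda>x. M (Suc t) (initial (Suc t) x)) x
          = indicat_real A x * M t (initial t x)"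
        by eventually_elim simp
      have "(\<integral>x. indicat_real A x * M (Suc t) (initial (Suc t) x) \<partial>PX) =
          (\<integral>x. indicat_real A x * real_cond_exp PX (coord_filtration N \<mu> t) (\<lambda>x. M (Suc t) (initial (Suc t) x)) x \<partial>PX)"
        using FX.real_cond_exp_intA[OF Mm(2)[OF t1(2)] A] by (simp add: set_lebesgue_integral_def)
      also have "\<dots> = (\<integral>x. indicat_real A x * M t (initial t x) \<partial>PX)"
        using Mm(1)[OF t1(1)] A' by (intro integral_cong_AE ae) auto
      finally show "(\<integral>x. indicat_real A x * D t x \<partial>PX) = 0"
        unfolding D_def right_diff_distrib
        using integrable_mult_indicator[OF A' Mm(2)[OF t1(1)]] integrable_mult_indicator[OF A' Mm(2)[OF t1(2)]]
        by simp
    qed (rule Cb_initial_measurable_coord_filtration[OF H[OF t]] Cb_initial_bounded[OF H[OF t]] Dm[OF t] Db[OF t])+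
    have "(\<lambda>z. H t (initial t (snd z))) \<in> borel_measurable \<gamma>"
      using Cb_initial_measurable_coord_filtration[OF H[OF t]]
      by (intro measurable_compose[OF coupling_snd[OF \<gamma>c]] measurable_from_subalg[OF subalgebra_coord_filtration[OF \<nu>]])
    moreover have "(\<lambda>z. D t (fst z)) \<in> borel_measurable \<gamma>"
      by (rule measurable_compose[OF coupling_fst[OF \<gamma>c] Dm[OF t]])
    moreover obtain B C where "\<And>y. y \<in> Y \<Longrightarrow> \<bar>H t (initial t y)\<bar> \<le> B" "\<And>x. x \<in> X \<Longrightarrow> \<bar>D t x\<bar> \<le> C"
      using Cb_initial_bounded[OF H[OF t], of Y] Db[OF t] by (auto simp: bounded_funs_iff)
    then have "\<bar>H t (initial t (snd z)) * D t (fst z)\<bar> \<le> B * C" if "z \<in> X \<times> Y" for z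
      unfolding abs_mult using that by (intro mult_mono) (auto intro: order_trans[OF abs_ge_zero])
    ultimately show "integrable \<gamma> (\<lambda>z. H t (initial t (snd z)) * D t (fst z))"
      by (intro \<gamma>.integrable_const_bound[of _ "B * C"]) (auto simp: coupling_space[OF \<gamma>c])
  qed
  have Seq': "S z = (\<Sum>t \<in> {1..<N}. H t (initial t (snd z)) * D t (fst z))" if "z \<in> space \<gamma>" for z
    using Seq[of "fst z" "snd z"] that by (auto simp: D_def coupling_space[OF \<gamma>c])
  have "integrable \<gamma> (\<lambda>z. \<Sum>t \<in> {1..<N}. H t (initial t (snd z)) * D t (fst z))"
    by (intro Bochner_Integration.integrable_sum trm)
  moreover have "integrable \<gamma> S \<longleftrightarrow> integrable \<gamma> (\<lambda>z. \<Sum>t \<in> {1..<N}. H t (initial t (snd z)) * D t (fst z))"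
    by (rule Bochner_Integration.integrable_cong[OF refl]) (rule Seq')
  ultimately show "integrable \<gamma> S" by simp
  have "(\<integral>z. S z \<partial>\<gamma>) = (\<integral>z. (\<Sum>t \<in> {1..<N}. H t (initial t (snd z)) * D t (fst z)) \<partial>\<gamma>)"
    by (rule Bochner_Integration.integral_cong[OF refl Seq'])
  also have "\<dots> = (\<Sum>t \<in> {1..<N}. \<integral>z. H t (initial t (snd z)) * D t (fst z) \<partial>\<gamma>)"
    by (rule Bochner_Integration.integral_sum) (rule trm(1))
  also have "\<dots> = 0" by (intro sum.neutral ballI trm(2))
  finally show "(\<integral>z. S z \<partial>\<gamma>) = 0" .
qed

lemma span_SS_integral_zero:
  assumes \<gamma>: "\<gamma> \<in> causal_couplings N \<mu> \<nu>" and S: "S \<in> linear_span (SS N \<mu> \<nu>)"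
  shows "integrable \<gamma> S" "(\<integral>z. S z \<partial>\<gamma>) = 0"
proof -
  obtain n :: nat and a G where S': "S = (\<lambda>z. \<Sum>j<n. a j * G j z)" and G: "\<And>j. j < n \<Longrightarrow> G j \<in> SS N \<mu> \<nu>"
    using S unfolding linear_span_def by blast
  show "integrable \<gamma> S" unfolding S'
    using SS_integral_zero(1)[OF \<gamma> G] by (intro Bochner_Integration.integrable_sum integrable_mult_right) auto
  show "(\<integral>z. S z \<partial>\<gamma>) = 0" unfolding S'
    using SS_integral_zero[OF \<gamma> G] by (subst Bochner_Integration.integral_sum) (auto intro!: integrable_mult_right)
qed

lemma weak_duality:
  assumes \<gamma>: "\<gamma> \<in> causal_couplings N \<mu> \<nu>"
    and c: "c \<in> borel_measurable \<gamma>" "\<And>z. z \<in> X \<times> Y \<Longrightarrow> ereal b \<le> c z"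
    and \<Phi>: "\<Phi> \<in> C\<^sub>b (top_on {1..N})" and \<Psi>: "\<Psi> \<in> C\<^sub>b (top_on {1..N})"
    and S: "S \<in> linear_span (SS N \<mu> \<nu>)"
    and le: "\<And>x y. x \<in> X \<Longrightarrow> y \<in> Y \<Longrightarrow> ereal (\<Phi> x + \<Psi> y) \<le> c (x, y) + ereal (S (x, y))"
  shows "ereal ((\<integral>x. \<Phi> x \<partial>\<mu>) + (\<integral>y. \<Psi> y \<partial>\<nu>)) \<le> ereal_integral \<gamma> c"
proof -
  have \<gamma>c: "\<gamma> \<in> couplings N \<mu> \<nu>" using \<gamma> by (auto simp: causal_couplings_def)
  interpret \<gamma>: prob_space \<gamma> by (rule coupling_prob_space[OF \<gamma>c])
  have m: "\<Phi> \<in> borel_measurable PX" "\<Psi> \<in> borel_measurable PY"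
    by (rule continuous_measurable_on_supp[OF \<mu> Cb_continuous_on_supp[OF \<mu> \<Phi>]])
       (rule continuous_measurable_on_supp[OF \<nu> Cb_continuous_on_supp[OF \<nu> \<Psi>]])
  have b: "\<Phi> \<in> bounded_funs X" "\<Psi> \<in> bounded_funs Y"
    using bounded_funs_subset[OF _ supp_subset] \<Phi> \<Psi> unfolding Cb_iff by blast+
  obtain B1 B2 where B: "\<And>x. x \<in> X \<Longrightarrow> \<bar>\<Phi> x\<bar> \<le> B1" "\<And>x. x \<in> Y \<Longrightarrow> \<bar>\<Psi> x\<bar> \<le> B2"
    using b by (auto simp: bounded_funs_iff)
  have i1: "integrable \<gamma> (\<lambda>z. \<Phi> (fst z))"
    using measurable_compose[OF coupling_fst[OF \<gamma>c] m(1)] B(1)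
    by (intro \<gamma>.integrable_const_bound[of _ B1] AE_I2) (auto simp: coupling_space[OF \<gamma>c])
  have i2: "integrable \<gamma> (\<lambda>z. \<Psi> (snd z))"
    using measurable_compose[OF coupling_snd[OF \<gamma>c] m(2)] B(2)
    by (intro \<gamma>.integrable_const_bound[of _ B2] AE_I2) (auto simp: coupling_space[OF \<gamma>c])
  note i = i1 i2
  define u where "u z = \<Phi> (fst z) + \<Psi> (snd z) - S z" for z
  have ui: "integrable \<gamma> u" unfolding u_def using i span_SS_integral_zero(1)[OF \<gamma> S] by simp
  have "(\<integral>z. u z \<partial>\<gamma>) = (\<integral>z. \<Phi> (fst z) \<partial>\<gamma>) + (\<integral>z. \<Psi> (snd z) \<partial>\<gamma>)"
    unfolding u_def using i span_SS_integral_zero[OF \<gamma> S] by simp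
  also have "\<dots> = (\<integral>x. \<Phi> x \<partial>\<mu>) + (\<integral>y. \<Psi> y \<partial>\<nu>)"
    by (simp only: coupling_integral_fst[OF \<gamma>c m(1)] coupling_integral_snd[OF \<gamma>c m(2)]
      integral_on_supp[OF \<mu> Cb_measurable[OF \<mu> \<Phi>]] integral_on_supp[OF \<nu> Cb_measurable[OF \<nu> \<Psi>]])
  finally have eq: "(\<integral>z. u z \<partial>\<gamma>) = (\<integral>x. \<Phi> x \<partial>\<mu>) + (\<integral>y. \<Psi> y \<partial>\<nu>)" .
  have "ereal (u z) \<le> c z" if "z \<in> space \<gamma>" for z
    using le[of "fst z" "snd z"] that by (cases "c z") (auto simp: u_def coupling_space[OF \<gamma>c])
  then have "ereal (\<integral>z. u z \<partial>\<gamma>) \<le> ereal_integral \<gamma> c"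
    using c(2) by (intro integral_le_ereal_integral[OF \<gamma>.prob_space_axioms c(1) _ ui]) (auto simp: coupling_space[OF \<gamma>c])
  then show ?thesis by (simp only: eq)
qed

lemma product_coupling_causal: "PX \<Otimes>\<^sub>M PY \<in> causal_couplings N \<mu> \<nu>"
proof -
  interpret PX: prob_space PX by (rule prob_space_on_supp[OF \<mu>])
  interpret PY: prob_space PY by (rule prob_space_on_supp[OF \<nu>])
  interpret P: pair_prob_space PX PY ..
  have "distr (PX \<Otimes>\<^sub>M PY) PX fst = PX" by (rule PY.distr_pair_fst)
  moreover have "distr (PX \<Otimes>\<^sub>M PY) PY snd = PY"
  proof (rule measure_eqI)
    fix A assume "A \<in> sets (distr (PX \<Otimes>\<^sub>M PY) PY snd)"
    then have A: "A \<in> sets PY" by simp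
    have "snd -` A \<inter> space (PX \<Otimes>\<^sub>M PY) = space PX \<times> A"
      using sets.sets_into_space[OF A] by (auto simp: space_pair_measure)
    then show "emeasure (distr (PX \<Otimes>\<^sub>M PY) PY snd) A = emeasure PY A"
      using A by (simp add: emeasure_distr PY.emeasure_pair_measure_Times PX.emeasure_space_1)
  qed simp
  ultimately have c: "PX \<Otimes>\<^sub>M PY \<in> couplings N \<mu> \<nu>"
    by (simp add: couplings_iff P.prob_space_axioms)
  have "regular_cond_law (PX \<Otimes>\<^sub>M PY) PX fst PY snd (\<lambda>_. PY)"
    unfolding regular_cond_law_def
  proof (intro conjI ballI)
    show "(\<lambda>_. PY) \<in> PX \<rightarrow>\<^sub>M prob_algebra PY"
      by (intro measurable_const) (simp add: space_prob_algebra PY.prob_space_axioms)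
    fix A B assume A: "A \<in> sets PX" and B: "B \<in> sets PY"
    have "{\<omega> \<in> space (PX \<Otimes>\<^sub>M PY). fst \<omega> \<in> A \<and> snd \<omega> \<in> B} = A \<times> B"
      using sets.sets_into_space[OF A] sets.sets_into_space[OF B] by (auto simp: space_pair_measure)
    then have "emeasure (PX \<Otimes>\<^sub>M PY) {\<omega> \<in> space (PX \<Otimes>\<^sub>M PY). fst \<omega> \<in> A \<and> snd \<omega> \<in> B} = emeasure PX A * emeasure PY B"
      using A B by (simp add: PY.emeasure_pair_measure_Times)
    also have "\<dots> = (\<integral>\<^sup>+x. emeasure PY B * indicator A x \<partial>PX)"
      using A by (simp add: nn_integral_cmult_indicator mult.commute[of "emeasure PX A"])
    also have "\<dots> = (\<integral>\<^sup>+x. emeasure PY B * indicator A x \<partial>distr (PX \<Otimes>\<^sub>M PY) PX fst)"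
      by (simp add: PY.distr_pair_fst)
    also have "\<dots> = (\<integral>\<^sup>+\<omega>. emeasure PY B * indicator A (fst \<omega>) \<partial>(PX \<Otimes>\<^sub>M PY))"
      using A by (intro nn_integral_distr) auto
    finally show "emeasure (PX \<Otimes>\<^sub>M PY) {\<omega> \<in> space (PX \<Otimes>\<^sub>M PY). fst \<omega> \<in> A \<and> snd \<omega> \<in> B} =
      (\<integral>\<^sup>+\<omega>. emeasure PY B * indicator A (fst \<omega>) \<partial>(PX \<Otimes>\<^sub>M PY))" .
  qed
  then have "causal N \<mu> \<nu> (PX \<Otimes>\<^sub>M PY)"
    unfolding causal_def
  proof (intro exI conjI ballI)
    fix t B show "\<exists>f\<in>borel_measurable (coord_filtration N \<mu> t). AE x in PX. measure PY B = f x"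
      by (rule bexI[of _ "\<lambda>_. measure PY B"]) auto
  qed
  then show ?thesis using c by (simp add: causal_couplings_def)
qed

end

section \<open>Continuity and averaging of the conditional means\<close>

text \<open>
The continuous version of the conditional expectation of \<open>g\<close> given that the first \<open>t\<close> coordinates are those of \<open>a\<close>.
\<close>

definition cond_mean :: "nat \<Rightarrow> vec measure \<Rightarrow> nat \<Rightarrow> (vec \<Rightarrow> real) \<Rightarrow> vec \<Rightarrow> real" where
  "cond_mean N \<mu> t g a = (\<integral>x'. g (merge {1..t} {t<..N} (a, x')) \<partial>cond_law N \<mu> t a)"

lemma continuous_cond_law_cond_law:
  assumes "successively_weakly_continuous N \<mu>" "t \<in> {1..<N}"
  shows "continuous_cond_law N \<mu> t (cond_law N \<mu> t)"
  using someI_ex[of "continuous_cond_law N \<mu> t"] assms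
  unfolding successively_weakly_continuous_def cond_law_def by simp

lemma continuous_on_integral_weak_topology:
  assumes \<kappa>: "continuous_map (top_of_set A) (weak_topology I) \<kappa>"
    and \<kappa>p: "\<And>a. a \<in> A \<Longrightarrow> \<kappa> a \<in> space (prob_algebra (borel_on I))"
    and f: "f \<in> C\<^sub>b (top_on I)"
  shows "continuous_on A (\<lambda>a. \<integral>x. f x \<partial>\<kappa> a)"
proof -
  have "continuous_map (top_of_set A) euclideanreal (\<lambda>a. \<integral>x. f x \<partial>\<kappa> a)"
    unfolding continuous_map_def
  proof (intro conjI allI impI)
    fix U :: "real set" assume "openin euclideanreal U"
    then have U: "open U" by simp
    define W where "W = {m \<in> space (prob_algebra (borel_on I)). (\<integral>x. f x \<partial>m) \<in> U}"
    have "openin (weak_topology I) W"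
      unfolding weak_topology_def W_def using f U by (intro topology_generated_by_Basis) blast
    then have "openin (top_of_set A) {a \<in> topspace (top_of_set A). \<kappa> a \<in> W}"
      by (rule openin_continuous_map_preimage[OF \<kappa>])
    moreover have "{a \<in> topspace (top_of_set A). \<kappa> a \<in> W} = {a \<in> topspace (top_of_set A). (\<integral>x. f x \<partial>\<kappa> a) \<in> U}"
      using \<kappa>p by (auto simp: W_def)
    ultimately show "openin (top_of_set A) {a \<in> topspace (top_of_set A). (\<integral>x. f x \<partial>\<kappa> a) \<in> U}" by simp
  qed auto
  then show ?thesis by simp
qed

lemma compact_box: "compact {x \<in> Rspace I. \<forall>i\<in>I. \<bar>x i\<bar> \<le> (r::real)}"
proof -
  define S where "S i = (if i \<in> I then {-r..r} else {undefined})" for i :: nat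
  have "compactin (product_topology (\<lambda>_. euclideanreal) UNIV) (Pi\<^sub>E UNIV S)"
    unfolding compactin_PiE by (auto simp: S_def)
  then have "compact (Pi\<^sub>E UNIV S)" by (simp add: euclidean_product_topology)
  moreover have "Pi\<^sub>E UNIV S = {x \<in> Rspace I. \<forall>i\<in>I. \<bar>x i\<bar> \<le> r}"
  proof -
    have S: "x i \<in> S i \<longleftrightarrow> (i \<in> I \<longrightarrow> \<bar>x i\<bar> \<le> r) \<and> (i \<notin> I \<longrightarrow> x i = undefined)" for x :: vec and i
      by (auto simp: S_def abs_le_iff)
    have "x \<in> Pi\<^sub>E UNIV S \<longleftrightarrow> (\<forall>i. x i \<in> S i)" for x by (simp add: PiE_iff)
    then show ?thesis unfolding S Rspace_iff by blast
  qed
  ultimately show ?thesis by simp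
qed

text \<open>
A continuous function with values in \<open>[0, 1]\<close> that vanishes outside the cube of radius
  \<open>n + 1\<close> and equals \<open>1\<close> on the cube of radius \<open>n\<close>.
\<close>

definition cutoff :: "nat set \<Rightarrow> nat \<Rightarrow> vec \<Rightarrow> real" where
  "cutoff I n x = (\<Prod>i\<in>I. max 0 (min 1 (real n + 1 - \<bar>x i\<bar>)))"

lemma cutoff_range: "0 \<le> cutoff I n x" "cutoff I n x \<le> 1"
  unfolding cutoff_def by (intro prod_nonneg prod_le_1; simp)+

lemma continuous_on_cutoff: "continuous_on A (cutoff I n)"
  unfolding cutoff_def[abs_def]
  by (intro continuous_intros continuous_on_proj)

lemma cutoff_eq_0:
  assumes "finite I" "i \<in> I" "real n + 1 < \<bar>x i\<bar>" shows "cutoff I n x = 0"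
proof -
  have "max 0 (min 1 (real n + 1 - \<bar>x i\<bar>)) = 0" using assms(3) by simp
  then show ?thesis unfolding cutoff_def using assms(1,2) by (intro prod_zero) blast+
qed

lemma cutoff_tendsto_1:
  assumes "finite I" shows "(\<lambda>n. cutoff I n x) \<longlonglongrightarrow> 1"
proof -
  obtain m :: nat where m: "(\<Sum>i\<in>I. \<bar>x i\<bar>) \<le> real m" using real_arch_simple by blast
  have "cutoff I n x = 1" if "m \<le> n" for n
    unfolding cutoff_def
  proof (rule prod.neutral, intro ballI)
    fix i assume "i \<in> I"
    then have "\<bar>x i\<bar> \<le> (\<Sum>i\<in>I. \<bar>x i\<bar>)" using assms by (intro member_le_sum) auto
    then have "\<bar>x i\<bar> \<le> real n" using m that by linarith
    then show "max 0 (min 1 (real n + 1 - \<bar>x i\<bar>)) = 1" by simp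
  qed
  then have "\<forall>\<^sub>F n in sequentially. cutoff I n x = 1" by (auto simp: eventually_sequentially)
  then show ?thesis by (rule tendsto_eventually)
qed

text \<open>
Weak continuity handles integrands that do not depend on \<open>a\<close>. For a jointly continuous
  integrand, a cutoff with \<open>\<kappa> a0\<close>-integral close to \<open>1\<close> has integral close to \<open>1\<close> for all nearby \<open>a\<close>,
  so that nearly all mass stays in one compact cube, on which \<open>G (a, _)\<close> is uniformly close to \<open>G (a0, _)\<close>.
\<close>

lemma continuous_on_integral_parameter:
  fixes G :: "vec \<times> vec \<Rightarrow> real"
  assumes I: "finite I"
    and \<kappa>: "continuous_map (top_of_set A) (weak_topology I) \<kappa>"
    and \<kappa>p: "\<And>a. a \<in> A \<Longrightarrow> \<kappa> a \<in> space (prob_algebra (borel_on I))"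
    and G: "continuous_on UNIV G" "\<And>z. \<bar>G z\<bar> \<le> B"
  shows "continuous_on A (\<lambda>a. \<integral>x. G (a, x) \<partial>\<kappa> a)"
proof -
  have B0: "0 \<le> B" using G(2)[of undefined] by linarith
  have wk: "continuous_on A (\<lambda>a. \<integral>x. f x \<partial>\<kappa> a)" if "continuous_on UNIV f" "\<And>x. \<bar>f x\<bar> \<le> C" for f :: "vec \<Rightarrow> real" and C
    using that by (intro continuous_on_integral_weak_topology[OF \<kappa> \<kappa>p])
      (auto simp: Cb_iff bounded_funs_iff intro: continuous_on_subset)
  have ps: "prob_space (\<kappa> a)" and sk: "sets (\<kappa> a) = sets (restrict_space borel (Rspace I))" if "a \<in> A" for a
    using \<kappa>p[OF that] by (auto simp: space_prob_algebra sets_borel_on)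
  have spk: "space (\<kappa> a) = Rspace I" if "a \<in> A" for a
    using sets_eq_imp_space_eq[OF sk[OF that]] by (simp add: space_restrict_space)
  have int: "integrable (\<kappa> a) f" if a: "a \<in> A" and f: "continuous_on UNIV f" "\<And>x. \<bar>f x\<bar> \<le> C"
    for a and f :: "vec \<Rightarrow> real" and C
  proof -
    interpret prob_space "\<kappa> a" by (rule ps[OF a])
    have "f \<in> borel_measurable (restrict_space borel (Rspace I))"
      using f(1) by (intro measurable_restrict_space1 borel_measurable_continuous_onI)
    then show ?thesis using f(2)
      by (intro integrable_const_bound[of _ C]) (auto simp: measurable_cong_sets[OF sk[OF a] refl])
  qed
  have Ga: "continuous_on UNIV (\<lambda>x. G (a, x))" for a
    by (rule continuous_on_compose2[OF G(1)]) (auto intro!: continuous_intros)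
  show ?thesis
    unfolding continuous_on_def
  proof (intro ballI tendstoI)
    fix a0 and e :: real assume a0: "a0 \<in> A" and e: "0 < e"
    \<comment> \<open>The error terms below add up to at most \<open>d * (2 + 4 * B)\<close>.\<close>
    define d where "d = e / (3 + 4 * B)"
    have d: "0 < d" using e B0 by (simp add: d_def)
    have c1: "\<bar>cutoff I n x\<bar> \<le> 1" for n x using cutoff_range[of I n x] by simp
    interpret k0: prob_space "\<kappa> a0" by (rule ps[OF a0])
    have "(\<lambda>n. \<integral>x. cutoff I n x \<partial>\<kappa> a0) \<longlonglongrightarrow> (\<integral>x. 1 \<partial>\<kappa> a0)"
    proof (rule integral_dominated_convergence[where w = "\<lambda>_. 1"])
      show "cutoff I n \<in> borel_measurable (\<kappa> a0)" for n
        by (rule borel_measurable_integrable[OF int[OF a0 continuous_on_cutoff c1]])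
    qed (use cutoff_range cutoff_tendsto_1[OF I] in auto)
    then have "(\<lambda>n. \<integral>x. cutoff I n x \<partial>\<kappa> a0) \<longlonglongrightarrow> 1" by (simp add: k0.prob_space)
    then have "\<forall>\<^sub>F n in sequentially. 1 - d < (\<integral>x. cutoff I n x \<partial>\<kappa> a0)"
      using d by (intro order_tendstoD(1)) auto
    then obtain n where n: "1 - d < (\<integral>x. cutoff I n x \<partial>\<kappa> a0)" by (auto simp: eventually_sequentially)
    define K where "K = {x \<in> Rspace I. \<forall>i\<in>I. \<bar>x i\<bar> \<le> real n + 1}"
    have K: "compact K" unfolding K_def by (rule compact_box)
    obtain X0 where X0: "a0 \<in> X0" "open X0" "\<forall>a\<in>X0 \<inter> UNIV. \<forall>x\<in>K. dist (G (a, x)) (G (a0, x)) \<le> d"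
      using continuous_on_prod_compactE[OF continuous_on_subset[OF G(1) subset_UNIV] K UNIV_I d, of a0] by blast
    have ev1: "\<forall>\<^sub>F a in at a0 within A. dist (\<integral>x. cutoff I n x \<partial>\<kappa> a) (\<integral>x. cutoff I n x \<partial>\<kappa> a0) < d"
      by (rule tendstoD[OF wk[OF continuous_on_cutoff c1, unfolded continuous_on_def, rule_format, OF a0] d])
    have ev2: "\<forall>\<^sub>F a in at a0 within A. dist (\<integral>x. G (a0, x) \<partial>\<kappa> a) (\<integral>x. G (a0, x) \<partial>\<kappa> a0) < d"
      by (rule tendstoD[OF wk[OF Ga G(2), unfolded continuous_on_def, rule_format, OF a0] d])
    have ev3: "\<forall>\<^sub>F a in at a0 within A. a \<in> X0"
      using X0 unfolding eventually_at_topological by auto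
    have ev4: "\<forall>\<^sub>F a in at a0 within A. a \<in> A" by (simp add: eventually_at_filter)
    show "\<forall>\<^sub>F a in at a0 within A. dist (\<integral>x. G (a, x) \<partial>\<kappa> a) (\<integral>x. G (a0, x) \<partial>\<kappa> a0) < e"
      using ev1 ev2 ev3 ev4
    proof eventually_elim
      case (elim a)
      interpret k: prob_space "\<kappa> a" by (rule ps[OF elim(4)])
      have iG: "integrable (\<kappa> a) (\<lambda>x. G (a, x))" "integrable (\<kappa> a) (\<lambda>x. G (a0, x))"
        by (rule int[OF elim(4) Ga G(2)])+
      have ic: "integrable (\<kappa> a) (cutoff I n)" by (rule int[OF elim(4) continuous_on_cutoff c1])
      have pw: "\<bar>G (a, x) - G (a0, x)\<bar> \<le> d + 2 * B * (1 - cutoff I n x)" if "x \<in> space (\<kappa> a)" for x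
      proof (cases "x \<in> K")
        case True
        then have "\<bar>G (a, x) - G (a0, x)\<bar> \<le> d" using X0(3) elim(3) by (auto simp: dist_real_def)
        moreover have "0 \<le> 2 * B * (1 - cutoff I n x)" using B0 cutoff_range[of I n x] by simp
        ultimately show ?thesis by linarith
      next
        case False
        moreover have "x \<in> Rspace I" using that spk[OF elim(4)] by simp
        ultimately obtain i where i: "i \<in> I" "\<not> \<bar>x i\<bar> \<le> real n + 1" unfolding K_def by blast
        then have "cutoff I n x = 0" by (intro cutoff_eq_0[OF I i(1)]) simp
        then show ?thesis using G(2)[of "(a, x)"] G(2)[of "(a0, x)"] d by simp
      qed
      have "\<bar>(\<integral>x. G (a, x) \<partial>\<kappa> a) - (\<integral>x. G (a0, x) \<partial>\<kappa> a)\<bar> = \<bar>\<integral>x. G (a, x) - G (a0, x) \<partial>\<kappa> a\<bar>"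
        using iG by simp
      also have "\<dots> \<le> (\<integral>x. \<bar>G (a, x) - G (a0, x)\<bar> \<partial>\<kappa> a)" by (rule integral_abs_bound)
      also have "\<dots> \<le> (\<integral>x. d + 2 * B * (1 - cutoff I n x) \<partial>\<kappa> a)"
        using iG ic by (intro integral_mono pw) auto
      also have "\<dots> = d + 2 * B * (1 - (\<integral>x. cutoff I n x \<partial>\<kappa> a))"
        using ic by (simp add: k.prob_space)
      also have "\<dots> \<le> d + 2 * B * (2 * d)"
        using elim(1) n B0 by (intro add_left_mono mult_left_mono) (auto simp: dist_real_def)
      finally have "\<bar>(\<integral>x. G (a, x) \<partial>\<kappa> a) - (\<integral>x. G (a0, x) \<partial>\<kappa> a0)\<bar> < d + 2 * B * (2 * d) + d"
        using elim(2) by (simp add: dist_real_def)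
      also have "\<dots> \<le> d * (3 + 4 * B)" using d by (simp add: algebra_simps)
      also have "\<dots> = e" using B0 by (simp add: d_def)
      finally show ?case by (simp add: dist_real_def)
    qed
  qed
qed

lemma continuous_on_merge: "continuous_on A (\<lambda>z :: vec \<times> vec. merge I J z)"
proof (rule continuous_on_coordinatewise_then_product)
  fix i
  show "continuous_on A (\<lambda>z :: vec \<times> vec. merge I J z i)"
  proof -
    have eq: "(\<lambda>z :: vec \<times> vec. merge I J z i) = (\<lambda>z. if i \<in> I then fst z i else if i \<in> J then snd z i else undefined)"
      by (simp add: merge_def fun_eq_iff)
    have c: "continuous_on A (\<lambda>z :: vec \<times> vec. fst z i)"
      by (rule continuous_on_compose2[OF continuous_on_proj[of UNIV] continuous_on_fst[OF continuous_on_id]]) simp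
    have c': "continuous_on A (\<lambda>z :: vec \<times> vec. snd z i)"
      by (rule continuous_on_compose2[OF continuous_on_proj[of UNIV] continuous_on_snd[OF continuous_on_id]]) simp
    show ?thesis unfolding eq using c c' by (cases "i \<in> I"; cases "i \<in> J") simp_all
  qed
qed

lemma merge_Rspace: "t \<le> N \<Longrightarrow> merge {1..t} {t<..N} z \<in> Rspace {1..N}"
  by (cases z) (simp add: Rspace_iff merge_def)

context
  fixes N :: nat and \<mu> :: "vec measure" and t :: nat and g :: "vec \<Rightarrow> real"
  assumes \<mu>: "borel_prob N \<mu>" and swc: "successively_weakly_continuous N \<mu>"
    and t: "t \<in> {1..<N}" and g: "g \<in> C\<^sub>b (top_on {1..N})"
begin

lemma g_merge_continuous: "continuous_on UNIV (\<lambda>z. g (merge {1..t} {t<..N} z))"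
  using g t unfolding Cb_iff
  by (intro continuous_on_compose2[OF _ continuous_on_merge, of "Rspace {1..N}" g] image_subsetI merge_Rspace) auto

lemma g_merge_bounded: "\<exists>B. \<forall>z. \<bar>g (merge {1..t} {t<..N} z)\<bar> \<le> B"
proof -
  obtain B where B: "\<And>x. x \<in> Rspace {1..N} \<Longrightarrow> \<bar>g x\<bar> \<le> B" using g unfolding Cb_iff bounded_funs_iff by blast
  have tN: "t \<le> N" using t by simp
  show ?thesis by (intro exI allI) (rule B[OF merge_Rspace[OF tN]])
qed

lemma cond_law_in_prob_algebra:
  assumes "a \<in> supp_proj N \<mu> t" shows "cond_law N \<mu> t a \<in> space (prob_algebra (borel_on {t<..N}))"
proof -
  have "cond_law N \<mu> t \<in> restrict_space (borel_on {1..t}) (supp_proj N \<mu> t) \<rightarrow>\<^sub>M prob_algebra (borel_on {t<..N})"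
    using continuous_cond_law_cond_law[OF swc t] by (simp add: continuous_cond_law_def regular_cond_law_def)
  moreover have "a \<in> space (restrict_space (borel_on {1..t}) (supp_proj N \<mu> t))"
    using assms initial_Rspace by (auto simp: space_restrict_space space_PiM)
  ultimately show ?thesis by (rule measurable_space)
qed

lemma cond_mean_continuous: "continuous_on (supp_proj N \<mu> t) (cond_mean N \<mu> t g)"
proof -
  have sub: "supp_proj N \<mu> t \<subseteq> Rspace {1..t}" using initial_Rspace by blast
  have "continuous_map (subtopology (top_on {1..t}) (supp_proj N \<mu> t)) (weak_topology {t<..N}) (cond_law N \<mu> t)"
    using continuous_cond_law_cond_law[OF swc t] by (simp add: continuous_cond_law_def)
  then have "continuous_map (top_of_set (supp_proj N \<mu> t)) (weak_topology {t<..N}) (cond_law N \<mu> t)"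
    unfolding top_on_eq subtopology_subtopology using sub by (simp add: Int_absorb1)
  moreover obtain B where "\<And>z. \<bar>g (merge {1..t} {t<..N} z)\<bar> \<le> B" using g_merge_bounded by blast
  ultimately show ?thesis
    unfolding cond_mean_def[abs_def]
    by (intro continuous_on_integral_parameter[OF _ _ cond_law_in_prob_algebra g_merge_continuous]) auto
qed

lemma cond_mean_bounded: "cond_mean N \<mu> t g \<in> bounded_funs (supp_proj N \<mu> t)"
proof -
  obtain B where B: "\<And>z. \<bar>g (merge {1..t} {t<..N} z)\<bar> \<le> B" using g_merge_bounded by blast
  have "\<bar>cond_mean N \<mu> t g a\<bar> \<le> B" if "a \<in> supp_proj N \<mu> t" for a
  proof -
    have "prob_space (cond_law N \<mu> t a)" using cond_law_in_prob_algebra[OF that] by (simp add: space_prob_algebra)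
    then interpret prob_space "cond_law N \<mu> t a" .
    show ?thesis
    proof (cases "integrable (cond_law N \<mu> t a) (\<lambda>x'. g (merge {1..t} {t<..N} (a, x')))")
      case True
      have "\<bar>cond_mean N \<mu> t g a\<bar> \<le> (\<integral>x'. \<bar>g (merge {1..t} {t<..N} (a, x'))\<bar> \<partial>cond_law N \<mu> t a)"
        unfolding cond_mean_def by (rule integral_abs_bound)
      also have "\<dots> \<le> (\<integral>x'. B \<partial>cond_law N \<mu> t a)" using True B by (intro integral_mono) auto
      finally show ?thesis by (simp add: prob_space)
    next
      case False
      then show ?thesis using B[of undefined] by (simp add: cond_mean_def not_integrable_integral_eq)
    qed
  qed
  then show ?thesis unfolding bounded_funs_iff by blast
qed

text \<open>
The averaging property that identifies the continuous version as a conditional expectation.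
\<close>

lemma cond_mean_integral:
  assumes A: "A \<in> sets (coord_filtration N \<mu> t)"
  shows "(\<integral>x. indicat_real A x * cond_mean N \<mu> t g (initial t x) \<partial>on_supp N \<mu>) =
    (\<integral>x. indicat_real A x * g x \<partial>on_supp N \<mu>)"
proof -
  interpret P: prob_space "on_supp N \<mu>" by (rule prob_space_on_supp[OF \<mu>])
  let ?S = "restrict_space (borel_on {1..t}) (supp_proj N \<mu> t)"
  obtain A' where A': "A' \<in> sets borel" "A = initial t -` A' \<inter> supp N \<mu>"
    using A unfolding coord_filtration_sets_borel by blast
  obtain B where B: "\<And>z. \<bar>g (merge {1..t} {t<..N} z)\<bar> \<le> B" using g_merge_bounded by blast
  define u where "u z = indicat_real A' (fst z) * g (merge {1..t} {t<..N} z)" for z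
  have sub: "supp_proj N \<mu> t \<subseteq> Rspace {1..t}" using initial_Rspace by blast
  have f: "initial t \<in> on_supp N \<mu> \<rightarrow>\<^sub>M ?S"
    by (rule measurable_restrict_space2[OF _ initial_measurable_on_supp[OF \<mu>]]) (auto simp: space_on_supp[OF \<mu>])
  have r: "(\<lambda>x. restrict x {t<..N}) \<in> on_supp N \<mu> \<rightarrow>\<^sub>M borel_on {t<..N}"
    by (rule measurable_compose[OF id_measurable_on_supp[OF \<mu>] restrict_measurable_borel])
  have um: "u \<in> borel_measurable (?S \<Otimes>\<^sub>M borel_on {t<..N})"
  proof -
    have i1: "(\<lambda>x. x) \<in> ?S \<rightarrow>\<^sub>M borel"
      unfolding measurable_cong_sets[OF sets_restrict_borel_on[OF sub] refl] by (rule measurable_restrict_space1) simp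
    have i2: "(\<lambda>x. x) \<in> borel_on {t<..N} \<rightarrow>\<^sub>M borel"
      unfolding measurable_cong_sets[OF sets_borel_on refl] by (rule measurable_restrict_space1) simp
    have "(\<lambda>z. (fst z, snd z)) \<in> ?S \<Otimes>\<^sub>M borel_on {t<..N} \<rightarrow>\<^sub>M borel \<Otimes>\<^sub>M borel"
      by (intro measurable_Pair measurable_compose[OF measurable_fst i1] measurable_compose[OF measurable_snd i2])
    then have i: "(\<lambda>z. z) \<in> ?S \<Otimes>\<^sub>M borel_on {t<..N} \<rightarrow>\<^sub>M borel" by (simp add: borel_prod)
    have f1: "(\<lambda>z. indicat_real A' (fst z)) \<in> borel_measurable (?S \<Otimes>\<^sub>M borel_on {t<..N})"
      by (rule measurable_compose[OF measurable_compose[OF measurable_fst i1] borel_measurable_indicator[OF A'(1)]])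
    have f2: "(\<lambda>z. g (merge {1..t} {t<..N} z)) \<in> borel_measurable (?S \<Otimes>\<^sub>M borel_on {t<..N})"
      by (rule measurable_compose[OF i borel_measurable_continuous_onI[OF g_merge_continuous]])
    show ?thesis unfolding u_def[abs_def] by (rule borel_measurable_times[OF f1 f2])
  qed
  have ub: "\<bar>u (a, x)\<bar> \<le> B" for a x
    using B[of "(a, x)"] by (auto simp: u_def indicator_def intro: order_trans[OF abs_ge_zero])
  have \<kappa>: "regular_cond_law (on_supp N \<mu>) ?S (initial t) (borel_on {t<..N}) (\<lambda>x. restrict x {t<..N}) (cond_law N \<mu> t)"
    using continuous_cond_law_cond_law[OF swc t] by (simp add: continuous_cond_law_def)
  have mrg: "merge {1..t} {t<..N} (initial t x, restrict x {t<..N}) = x" if "x \<in> supp N \<mu>" for x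
    using that supp_subset[of N \<mu>] t by (fastforce simp: merge_def Rspace_iff fun_eq_iff)
  have "(\<integral>x. indicat_real A x * g x \<partial>on_supp N \<mu>) = (\<integral>x. u (initial t x, restrict x {t<..N}) \<partial>on_supp N \<mu>)"
  proof (intro Bochner_Integration.integral_cong refl)
    fix x assume "x \<in> space (on_supp N \<mu>)"
    then have x: "x \<in> supp N \<mu>" by (simp add: space_on_supp[OF \<mu>])
    show "indicat_real A x * g x = u (initial t x, restrict x {t<..N})"
      unfolding u_def mrg[OF x] using x by (simp add: A'(2) indicator_def)
  qed
  also have "\<dots> = (\<integral>x. (\<integral>x'. u (initial t x, x') \<partial>cond_law N \<mu> t (initial t x)) \<partial>on_supp N \<mu>)"
    by (rule regular_cond_law_integral(2)[OF P.prob_space_axioms f r \<kappa> um ub])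
  also have "\<dots> = (\<integral>x. indicat_real A x * cond_mean N \<mu> t g (initial t x) \<partial>on_supp N \<mu>)"
    by (intro Bochner_Integration.integral_cong refl)
      (simp add: u_def cond_mean_def space_on_supp[OF \<mu>] A'(2) indicator_def)
  finally show ?thesis ..
qed

lemma cond_mean_initial_measurable:
  "(\<lambda>x. cond_mean N \<mu> t g (initial t x)) \<in> borel_measurable (coord_filtration N \<mu> t)"
proof -
  have sub: "supp_proj N \<mu> t \<subseteq> Rspace {1..t}" using initial_Rspace by blast
  have "initial t \<in> coord_filtration N \<mu> t \<rightarrow>\<^sub>M restrict_space (borel_on {1..t}) (supp_proj N \<mu> t)"
    by (rule measurable_restrict_space2[OF _ initial_measurable_coord_filtration]) (auto simp: coord_filtration_space)
  moreover have "cond_mean N \<mu> t g \<in> borel_measurable (restrict_space (borel_on {1..t}) (supp_proj N \<mu> t))"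
    unfolding measurable_cong_sets[OF sets_restrict_borel_on[OF sub] refl]
    by (rule borel_measurable_continuous_on_restrict[OF cond_mean_continuous])
  ultimately show ?thesis by (rule measurable_compose)
qed

lemma cond_mean_initial_bounded: "(\<lambda>x. cond_mean N \<mu> t g (initial t x)) \<in> bounded_funs (supp N \<mu>)"
  using cond_mean_bounded by (simp add: bounded_funs_def image_image)

lemma cond_mean_initial_continuous: "continuous_on (supp N \<mu>) (\<lambda>x. cond_mean N \<mu> t g (initial t x))"
  by (rule continuous_on_compose2[OF cond_mean_continuous continuous_on_restrict_vec]) auto

end

section \<open>Orthogonality to test functions and causality\<close>

lemma linear_span_base: "f \<in> A \<Longrightarrow> f \<in> linear_span A"
  unfolding linear_span_def by (auto intro!: exI[of _ "1::nat"] exI[of _ "\<lambda>_. 1"] exI[of _ "\<lambda>_. f"])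

lemma linear_span_zero: "(\<lambda>_. 0) \<in> linear_span A"
  unfolding linear_span_def by (auto intro!: exI[of _ "0::nat"])

lemma linear_span_mult:
  assumes "f \<in> linear_span A" shows "(\<lambda>z. r * f z) \<in> linear_span A"
proof -
  obtain n :: nat and a G where f: "f = (\<lambda>z. \<Sum>j<n. a j * G j z)" and G: "\<forall>j<n. G j \<in> A"
    using assms unfolding linear_span_def by blast
  have "(\<lambda>z. r * f z) = (\<lambda>z. \<Sum>j<n. (r * a j) * G j z)" by (simp add: f sum_distrib_left mult.assoc)
  then show ?thesis unfolding linear_span_def mem_Collect_eq using G
    by (intro exI[of _ n] exI[of _ "\<lambda>j. r * a j"] exI[of _ G] conjI)
qed

lemma linear_span_add:
  assumes "f \<in> linear_span A" "g \<in> linear_span A" shows "(\<lambda>z. f z + g z) \<in> linear_span A"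
proof -
  obtain n :: nat and a G where f: "f = (\<lambda>z. \<Sum>j<n. a j * G j z)" and G: "\<forall>j<n. G j \<in> A"
    using assms(1) unfolding linear_span_def by blast
  obtain m :: nat and b H where g: "g = (\<lambda>z. \<Sum>j<m. b j * H j z)" and H: "\<forall>j<m. H j \<in> A"
    using assms(2) unfolding linear_span_def by blast
  define c where "c j = (if j < n then a j else b (j - n))" for j
  define K where "K j = (if j < n then G j else H (j - n))" for j
  have "f z + g z = (\<Sum>j<n + m. c j * K j z)" for z
  proof -
    have "(\<Sum>j<n + k. c j * K j z) = (\<Sum>j<n. c j * K j z) + (\<Sum>j<k. c (n + j) * K (n + j) z)" for k
      by (induction k) simp_all
    then show ?thesis by (simp add: f g c_def K_def)
  qed
  moreover have "\<forall>j<n + m. K j \<in> A" using G H by (auto simp: K_def)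
  ultimately show ?thesis unfolding linear_span_def mem_Collect_eq
    by (intro exI[of _ "n + m"] exI[of _ c] exI[of _ K] conjI) (auto simp: fun_eq_iff)
qed

lemma merge_initial: "merge {1..t} J (initial t x, x') = merge {1..t} J (x, x')"
  by (auto simp: merge_def fun_eq_iff)

lemma initial_supp: "x \<in> supp N \<mu> \<Longrightarrow> initial N x = x"
  using supp_subset[of N \<mu>] by (metis PiE_restrict subsetD)

lemma initial_initial: "t \<le> s \<Longrightarrow> initial t (initial s y) = initial t y"
  by (auto simp: fun_eq_iff)

text \<open>
The bracket in the definition of the test functions \<open>FF\<close>.
\<close>

definition cond_deviation :: "nat \<Rightarrow> vec measure \<Rightarrow> nat \<Rightarrow> (vec \<Rightarrow> real) \<Rightarrow> vec \<Rightarrow> real" where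
  "cond_deviation N \<mu> t g x = g x - cond_mean N \<mu> t g (initial t x)"

lemma FF_iff:
  "F \<in> FF N \<mu> \<nu> \<longleftrightarrow> (\<exists>h g. (\<forall>t \<in> {1..<N}. h t \<in> C\<^sub>b (top_on {1..t}) \<and> g t \<in> C\<^sub>b (top_on {1..N})) \<and>
     (\<forall>x \<in> supp N \<mu>. \<forall>y \<in> supp N \<nu>.
        F (x, y) = (\<Sum>t \<in> {1..<N}. h t (initial t y) * cond_deviation N \<mu> t (g t) x)))"
  unfolding FF_def cond_deviation_def cond_mean_def merge_initial by simp

lemma zero_in_Cb: "(\<lambda>_. 0) \<in> C\<^sub>b T"
  by (auto simp: C\<^sub>b_def bounded_iff)

context
  fixes N :: nat and \<mu> :: "vec measure" and g :: "vec \<Rightarrow> real"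
  assumes \<mu>: "borel_prob N \<mu>" and swc: "successively_weakly_continuous N \<mu>"
    and g: "g \<in> C\<^sub>b (top_on {1..N})"
begin

text \<open>
The martingale generated by \<open>g\<close>. At time \<open>N\<close>, where \<open>cond_law\<close> has no meaning, it is \<open>g\<close> itself.
\<close>

definition cond_martingale :: "nat \<Rightarrow> vec \<Rightarrow> real" where
  "cond_martingale s = (if s < N then cond_mean N \<mu> s g else g)"

lemma cond_martingale_Cb:
  assumes s: "s \<in> {1..N}" shows "cond_martingale s \<in> C\<^sub>b (subtopology (top_on {1..s}) (supp_proj N \<mu> s))"
proof -
  have sub: "supp_proj N \<mu> s \<subseteq> Rspace {1..s}" using initial_Rspace by blast
  show ?thesis unfolding Cb_subtopology_iff[OF sub]
  proof (cases "s < N")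
    case True
    then have "s \<in> {1..<N}" using s by simp
    then show "continuous_on (supp_proj N \<mu> s) (cond_martingale s) \<and> cond_martingale s \<in> bounded_funs (supp_proj N \<mu> s)"
      using cond_mean_continuous[OF \<mu> swc _ g] cond_mean_bounded[OF \<mu> swc _ g] True by (simp add: cond_martingale_def)
  next
    case False
    then have "s = N" using s by simp
    then show "continuous_on (supp_proj N \<mu> s) (cond_martingale s) \<and> cond_martingale s \<in> bounded_funs (supp_proj N \<mu> s)"
      using g sub unfolding Cb_iff cond_martingale_def
      by (auto intro: continuous_on_subset bounded_funs_subset)
  qed
qed

lemma cond_martingale_measurable:
  assumes s: "s \<in> {1..N}"
  shows "(\<lambda>x. cond_martingale s (initial s x)) \<in> borel_measurable (coord_filtration N \<mu> s)"
proof (cases "s < N")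
  case True
  then show ?thesis using cond_mean_initial_measurable[OF \<mu> swc _ g, of s] s by (simp add: cond_martingale_def)
next
  case False
  then have "s = N" using s by simp
  then show ?thesis using Cb_initial_measurable_coord_filtration[OF g] by (simp add: cond_martingale_def)
qed

lemma cond_martingale_integrable:
  assumes s: "s \<in> {1..N}"
  shows "integrable (on_supp N \<mu>) (\<lambda>x. cond_martingale s (initial s x))"
proof -
  interpret prob_space "on_supp N \<mu>" by (rule prob_space_on_supp[OF \<mu>])
  have sub: "supp_proj N \<mu> s \<subseteq> Rspace {1..s}" using initial_Rspace by blast
  have "(\<lambda>x. cond_martingale s (initial s x)) \<in> bounded_funs (supp N \<mu>)"
    using cond_martingale_Cb[OF s] unfolding Cb_subtopology_iff[OF sub] by (simp add: bounded_funs_def image_image)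
  then show ?thesis
    using measurable_from_subalg[OF subalgebra_coord_filtration[OF \<mu>] cond_martingale_measurable[OF s]]
    by (intro integrable_bounded_funs) (auto simp: space_on_supp[OF \<mu>])
qed

lemma cond_martingale_integral:
  assumes s: "s \<in> {1..N}" and A: "A \<in> sets (coord_filtration N \<mu> s)"
  shows "(\<integral>x. indicat_real A x * cond_martingale s (initial s x) \<partial>on_supp N \<mu>) = (\<integral>x. indicat_real A x * g x \<partial>on_supp N \<mu>)"
proof (cases "s < N")
  case True
  then show ?thesis using cond_mean_integral[OF \<mu> swc _ g A] s by (simp add: cond_martingale_def)
next
  case False
  then have "s = N" using s by simp
  then show ?thesis
    by (intro Bochner_Integration.integral_cong) (simp_all add: cond_martingale_def space_on_supp[OF \<mu>] initial_supp del: One_nat_def)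
qed

lemma martingale_cond_martingale:
  "martingale (on_supp N \<mu>) (coord_filtration N \<mu>) {1..N} (\<lambda>s x. cond_martingale s (initial s x))"
  unfolding martingale_def
proof (intro conjI ballI impI)
  fix s t assume st: "s \<in> {1..N}" "t \<in> {1..N}" "s \<le> t"
  interpret sigma_finite_subalgebra "on_supp N \<mu>" "coord_filtration N \<mu> s"
    by (rule sigma_finite_subalgebra_coord_filtration[OF \<mu>])
  show "AE x in on_supp N \<mu>. real_cond_exp (on_supp N \<mu>) (coord_filtration N \<mu> s)
      (\<lambda>x. cond_martingale t (initial t x)) x = cond_martingale s (initial s x)"
  proof (rule real_cond_exp_charact)
    fix A assume A: "A \<in> sets (coord_filtration N \<mu> s)"
    then have A': "A \<in> sets (coord_filtration N \<mu> t)" using coord_filtration_mono[OF \<mu> st(3)] by blast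
    show "(LINT x:A|on_supp N \<mu>. cond_martingale t (initial t x)) = (LINT x:A|on_supp N \<mu>. cond_martingale s (initial s x))"
      using cond_martingale_integral[OF st(1) A] cond_martingale_integral[OF st(2) A']
      by (simp add: set_lebesgue_integral_def)
  qed (use st cond_martingale_integrable cond_martingale_measurable in auto)
qed (use cond_martingale_integrable cond_martingale_measurable in auto)

end

context marginals
begin

text \<open>
Telescoping: \<open>g - cond_mean t g\<close> is the sum of the increments from time \<open>t\<close> on of the martingale
  generated by \<open>g\<close>, and \<open>h(y\<^sub>1, \<dots>, y\<^sub>t)\<close> is an admissible integrand for each of these increments. Different \<open>t\<close>
  need different martingales, whence the span.
\<close>

lemma FF_eq_span_SS:
  assumes swc: "successively_weakly_continuous N \<mu>" and F: "F \<in> FF N \<mu> \<nu>"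
  shows "\<exists>S\<in>linear_span (SS N \<mu> \<nu>). \<forall>x\<in>X. \<forall>y\<in>Y. F (x, y) = S (x, y)"
proof -
  obtain h g where h: "\<And>t. t \<in> {1..<N} \<Longrightarrow> h t \<in> C\<^sub>b (top_on {1..t})"
    and g: "\<And>t. t \<in> {1..<N} \<Longrightarrow> g t \<in> C\<^sub>b (top_on {1..N})"
    and Feq: "\<And>x y. x \<in> X \<Longrightarrow> y \<in> Y \<Longrightarrow> F (x, y) = (\<Sum>t \<in> {1..<N}. h t (initial t y) * cond_deviation N \<mu> t (g t) x)"
    using F unfolding FF_iff by blast
  define M where "M t = cond_martingale N \<mu> (g t)" for t
  \<comment> \<open>The integrand for the term of index \<open>t\<close> is switched on at time \<open>t\<close>.\<close>
  define H where "H t s b = (if t \<le> s then h t (initial t b) else 0)" for t s :: nat and b :: vec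
  define S where "S t z = (\<Sum>s \<in> {1..<N}. H t s (initial s (snd z)) *
      (M t (Suc s) (initial (Suc s) (fst z)) - M t s (initial s (fst z))))" for t and z :: "vec \<times> vec"
  have SSt: "S t \<in> SS N \<mu> \<nu>" if t: "t \<in> {1..<N}" for t
    unfolding SS_def mem_Collect_eq
  proof (rule exI[of _ "H t"], rule exI[of _ "M t"], intro conjI ballI)
    fix s assume "s \<in> {1..<N}"
    show "H t s \<in> C\<^sub>b (top_on {1..s})"
    proof (cases "t \<le> s")
      case True
      then show ?thesis
        using continuous_on_Cb_initial[OF h[OF t]] Cb_initial_bounded[OF h[OF t]]
        unfolding Cb_iff H_def[abs_def] by simp
    next
      case False
      then show ?thesis using zero_in_Cb by (simp add: H_def[abs_def])
    qed
  next
    fix s assume "s \<in> {1..N}"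
    then show "M t s \<in> C\<^sub>b (subtopology (top_on {1..s}) (supp_proj N \<mu> s))"
      unfolding M_def by (rule cond_martingale_Cb[OF \<mu> swc g[OF t]])
  next
    show "martingale PX (coord_filtration N \<mu>) {1..N} (\<lambda>s x. M t s (initial s x))"
      unfolding M_def by (rule martingale_cond_martingale[OF \<mu> swc g[OF t]])
  qed (simp add: S_def)
  have St: "S t (x, y) = h t (initial t y) * cond_deviation N \<mu> t (g t) x"
    if t: "t \<in> {1..<N}" and x: "x \<in> X" for t x y
  proof -
    have "S t (x, y) = (\<Sum>s \<in> {1..<N}. if t \<le> s then h t (initial t y) *
      (M t (Suc s) (initial (Suc s) x) - M t s (initial s x)) else 0)"
      unfolding S_def fst_conv snd_conv by (intro sum.cong refl) (simp add: H_def initial_initial del: One_nat_def)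
    also have "\<dots> = (\<Sum>s \<in> {t..<N}. h t (initial t y) * (M t (Suc s) (initial (Suc s) x) - M t s (initial s x)))"
      using t by (intro sum.mono_neutral_cong_right) auto
    also have "\<dots> = h t (initial t y) * (M t N (initial N x) - M t t (initial t x))"
      unfolding sum_distrib_left[symmetric] using t by (subst sum_Suc_diff') auto
    also have "\<dots> = h t (initial t y) * cond_deviation N \<mu> t (g t) x"
      using t by (simp add: M_def cond_martingale_def[OF \<mu> swc g[OF t]] cond_deviation_def initial_supp[OF x] del: One_nat_def)
    finally show ?thesis .
  qed
  define T where "T z = (\<Sum>j<N - 1. 1 * S (Suc j) z)" for z
  have "T \<in> linear_span (SS N \<mu> \<nu>)"
    unfolding linear_span_def T_def[abs_def] using SSt
    by (auto intro!: exI[of _ "N - 1"] exI[of _ "\<lambda>_. 1"] exI[of _ "\<lambda>j. S (Suc j)"])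
  moreover have "F (x, y) = T (x, y)" if "x \<in> X" "y \<in> Y" for x y
  proof -
    have "T (x, y) = (\<Sum>t\<in>{1..<N}. S t (x, y))"
      unfolding T_def by (rule sum.reindex_bij_witness[of _ "\<lambda>t. t - 1" Suc]) auto
    also have "\<dots> = F (x, y)" unfolding Feq[OF that] by (intro sum.cong refl St that)
    finally show ?thesis by simp
  qed
  ultimately show ?thesis by blast
qed

lemma span_FF_eq_span_SS:
  assumes swc: "successively_weakly_continuous N \<mu>" and F: "F \<in> linear_span (FF N \<mu> \<nu>)"
  shows "\<exists>S\<in>linear_span (SS N \<mu> \<nu>). \<forall>x\<in>X. \<forall>y\<in>Y. F (x, y) = S (x, y)"
proof -
  obtain n :: nat and a G where F: "F = (\<lambda>z. \<Sum>j<n. a j * G j z)" and G: "\<And>j. j < n \<Longrightarrow> G j \<in> FF N \<mu> \<nu>"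
    using F unfolding linear_span_def by blast
  have "\<exists>S\<in>linear_span (SS N \<mu> \<nu>). \<forall>x\<in>X. \<forall>y\<in>Y. (\<Sum>j<k. a j * G j (x, y)) = S (x, y)" if "k \<le> n" for k
    using that
  proof (induction k)
    case 0
    then show ?case by (auto intro!: bexI[OF _ linear_span_zero])
  next
    case (Suc k)
    then obtain S where S: "S \<in> linear_span (SS N \<mu> \<nu>)" "\<And>x y. x \<in> X \<Longrightarrow> y \<in> Y \<Longrightarrow> (\<Sum>j<k. a j * G j (x, y)) = S (x, y)"
      by auto
    obtain S' where S': "S' \<in> linear_span (SS N \<mu> \<nu>)" "\<And>x y. x \<in> X \<Longrightarrow> y \<in> Y \<Longrightarrow> G k (x, y) = S' (x, y)"
      using FF_eq_span_SS[OF swc G[of k]] Suc.prems by auto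
    show ?case
      using linear_span_add[OF S(1) linear_span_mult[OF S'(1), of "a k"]] S(2) S'(2)
      by (intro bexI[of _ "\<lambda>z. S z + a k * S' z"]) auto
  qed
  from this[of n] show ?thesis by (simp add: F)
qed

lemma sets_coord_filtration_N: "sets (coord_filtration N \<mu> N) = sets PX"
proof -
  have "initial N -` A \<inter> X = X \<inter> A" for A using initial_supp[of _ N \<mu>] by auto
  then have "sets (coord_filtration N \<mu> N) = sets (restrict_space borel X)"
    unfolding coord_filtration_sets_borel sets_restrict_space by auto
  then show ?thesis by (simp only: sets_PX)
qed

lemma cond_deviation_regular:
  assumes "successively_weakly_continuous N \<mu>" "t \<in> {1..<N}" "g \<in> C\<^sub>b (top_on {1..N})"
  shows "cond_deviation N \<mu> t g \<in> borel_measurable PX" "cond_deviation N \<mu> t g \<in> bounded_funs X"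
    "continuous_on X (cond_deviation N \<mu> t g)"
proof -
  have c: "continuous_on X g" by (rule Cb_continuous_on_supp[OF \<mu> assms(3)])
  show 1: "continuous_on X (cond_deviation N \<mu> t g)"
    unfolding cond_deviation_def[abs_def]
    by (intro continuous_on_diff c cond_mean_initial_continuous[OF \<mu> assms])
  show "cond_deviation N \<mu> t g \<in> borel_measurable PX" by (rule continuous_measurable_on_supp[OF \<mu> 1])
  have "g \<in> bounded_funs X" using bounded_funs_subset[OF _ supp_subset] assms(3) unfolding Cb_iff by blast
  from function_space_add[OF function_space_bounded_funs this
      function_space_mult[OF function_space_bounded_funs cond_mean_initial_bounded[OF \<mu> assms], of "-1"]]
  show "cond_deviation N \<mu> t g \<in> bounded_funs X" by (simp add: cond_deviation_def[abs_def])
qed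

lemma bounded_continuous_Cb:
  fixes h :: "vec \<Rightarrow> real"
  assumes "continuous_on UNIV h" "bounded (range h)" shows "h \<in> C\<^sub>b (top_on I)"
  using assms unfolding Cb_iff bounded_funs_def
  by (auto intro: continuous_on_subset bounded_subset)

text \<open>
Fix an event \<open>B\<close> about \<open>y\<^sub>1, \<dots>, y\<^sub>t\<close>, let \<open>u x\<close> be its conditional probability and
  \<open>v = E[u | F\<^sub>t]\<close>. Orthogonality gives \<open>\<integral>u g = \<integral>u E[g | F\<^sub>t]\<close>, and
  conditional expectations are self-adjoint, so \<open>\<integral>u g = \<integral>v g\<close> for every bounded continuous \<open>g\<close>. Hence \<open>u = v\<close> almost everywhere.
\<close>

lemma causal_if_orthogonal_FF:
  assumes swc: "successively_weakly_continuous N \<mu>" and \<gamma>: "\<gamma> \<in> couplings N \<mu> \<nu>"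
    and orth: "\<And>F. F \<in> FF N \<mu> \<nu> \<Longrightarrow> (\<integral>z. F z \<partial>\<gamma>) = 0"
  shows "causal N \<mu> \<nu> \<gamma>"
proof -
  interpret \<gamma>: prob_space \<gamma> by (rule coupling_prob_space[OF \<gamma>])
  interpret PX: prob_space PX by (rule prob_space_on_supp[OF \<mu>])
  have fst: "fst \<in> \<gamma> \<rightarrow>\<^sub>M PX" and snd: "snd \<in> \<gamma> \<rightarrow>\<^sub>M PY"
    by (rule coupling_fst[OF \<gamma>]) (rule coupling_snd[OF \<gamma>])
  obtain \<kappa> where \<kappa>: "regular_cond_law \<gamma> PX fst PY snd \<kappa>"
    using exists_regular_cond_law[OF \<gamma>.prob_space_axioms fst snd sets_PY] closed_supp by (auto intro: borel_closed)
  have \<kappa>m: "\<kappa> \<in> PX \<rightarrow>\<^sub>M prob_algebra PY" using \<kappa> by (simp add: regular_cond_law_def)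
  have um: "(\<lambda>x. measure (\<kappa> x) B) \<in> borel_measurable PX" if "B \<in> sets PY" for B
    by (rule measurable_compose[OF measurable_prob_algebraD[OF \<kappa>m] measurable_measure_subprob_algebra[OF that]])
  show ?thesis
    unfolding causal_def
  proof (intro exI[of _ \<kappa>] conjI \<kappa> ballI)
    fix t B assume t: "t \<in> {1..N}" and B: "B \<in> sets (coord_filtration N \<nu> t)"
    have BY: "B \<in> sets PY" by (rule coord_filtration_subset[OF \<nu> B])
    define u where "u x = measure (\<kappa> x) B" for x
    have u: "u \<in> borel_measurable PX" unfolding u_def[abs_def] by (rule um[OF BY])
    have u1: "\<bar>u x\<bar> \<le> 1" if "x \<in> space PX" for x
    proof -
      have "prob_space (\<kappa> x)" using measurable_space[OF \<kappa>m that] by (simp add: space_prob_algebra)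
      then show ?thesis using prob_space.prob_le_1[of "\<kappa> x" B] by (simp add: u_def)
    qed
    have ui: "integrable PX u" using u u1 by (intro PX.integrable_const_bound[of _ 1]) auto
    show "\<exists>f\<in>borel_measurable (coord_filtration N \<mu> t). AE x in PX. measure (\<kappa> x) B = f x"
    proof (cases "t = N")
      case True
      then show ?thesis using u unfolding u_def
        by (intro bexI[of _ "\<lambda>x. measure (\<kappa> x) B"]) (auto simp: measurable_cong_sets[OF sets_coord_filtration_N refl])
    next
      case False
      then have tN: "t \<in> {1..<N}" using t by auto
      interpret FX: sigma_finite_subalgebra PX "coord_filtration N \<mu> t"
        by (rule sigma_finite_subalgebra_coord_filtration[OF \<mu>])
      define v where "v = real_cond_exp PX (coord_filtration N \<mu> t) u"
      have vm: "v \<in> borel_measurable (coord_filtration N \<mu> t)" "v \<in> borel_measurable PX" unfolding v_def by auto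
      have vi: "integrable PX v" unfolding v_def by (rule FX.real_cond_exp_int(1)[OF ui])
      obtain B' where B': "B' \<in> sets borel" "B = initial t -` B' \<inter> Y"
        using B unfolding coord_filtration_sets_borel by blast
      have test: "(\<integral>x. g x * (u x - v x) \<partial>PX) = 0"
        if gc: "continuous_on UNIV g" and gb: "bounded (range g)" for g :: "vec \<Rightarrow> real"
      proof -
        have g: "g \<in> C\<^sub>b (top_on {1..N})" by (rule bounded_continuous_Cb[OF gc gb])
        note D = cond_deviation_regular[OF swc tN g]
        define w where "w x = cond_mean N \<mu> t g (initial t x)" for x
        have w: "w \<in> borel_measurable (coord_filtration N \<mu> t)" "w \<in> bounded_funs X" "w \<in> borel_measurable PX"
          unfolding w_def[abs_def]
          by (rule cond_mean_initial_measurable[OF \<mu> swc tN g] cond_mean_initial_bounded[OF \<mu> swc tN g]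
            continuous_measurable_on_supp[OF \<mu> cond_mean_initial_continuous[OF \<mu> swc tN g]])+
        have gm: "g \<in> borel_measurable PX" by (rule continuous_measurable_on_supp[OF \<mu> Cb_continuous_on_supp[OF \<mu> g]])
        obtain C where C: "\<And>x. \<bar>g x\<bar> \<le> C" using gb by (auto simp: bounded_iff)
        obtain C' where C': "\<And>x. x \<in> X \<Longrightarrow> \<bar>w x\<bar> \<le> C'" using w(2) by (auto simp: bounded_funs_iff)
        have Tm: "(\<lambda>z. initial t (snd z)) \<in> borel_measurable \<gamma>"
          by (intro measurable_compose[OF measurable_compose[OF snd id_measurable_on_supp[OF \<nu>]]]
              borel_measurable_continuous_onI continuous_on_restrict_vec)
        have Dg: "integrable \<gamma> (\<lambda>z. cond_deviation N \<mu> t g (fst z))"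
        proof -
          obtain K where "\<And>x. x \<in> X \<Longrightarrow> \<bar>cond_deviation N \<mu> t g x\<bar> \<le> K" using D(2) by (auto simp: bounded_funs_iff)
          then show ?thesis using measurable_compose[OF fst D(1)]
            by (intro \<gamma>.integrable_const_bound[of _ K]) (auto simp: coupling_space[OF \<gamma>])
        qed
        have "(\<integral>z. indicat_real B' (initial t (snd z)) * cond_deviation N \<mu> t g (fst z) \<partial>\<gamma>) = 0"
        proof (rule integral_indicator_eq_0_if_continuous[OF Tm Dg _ B'(1)])
          fix h :: "vec \<Rightarrow> real" assume h: "continuous_on UNIV h" "bounded (range h)"
          have "(\<lambda>z. h (initial t (snd z)) * cond_deviation N \<mu> t g (fst z)) \<in> FF N \<mu> \<nu>"
            unfolding FF_iff
          proof (rule exI[of _ "\<lambda>s. if s = t then h else (\<lambda>_. 0)"], rule exI[of _ "\<lambda>_. g"], intro conjI ballI g)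
            show "(if s = t then h else (\<lambda>_. 0)) \<in> C\<^sub>b (top_on {1..s})" for s
              using bounded_continuous_Cb[OF h] zero_in_Cb by auto
            fix x y
            have "(\<Sum>s\<in>{1..<N}. (if s = t then h else (\<lambda>_. 0)) (initial s y) * cond_deviation N \<mu> s g x) =
              (\<Sum>s\<in>{1..<N}. if s = t then h (initial t y) * cond_deviation N \<mu> t g x else 0)"
              by (intro sum.cong) auto
            then show "h (initial t (snd (x, y))) * cond_deviation N \<mu> t g (fst (x, y)) =
              (\<Sum>s\<in>{1..<N}. (if s = t then h else (\<lambda>_. 0)) (initial s y) * cond_deviation N \<mu> s g x)"
              using tN by simp
          qed
          then show "(\<integral>z. h (initial t (snd z)) * cond_deviation N \<mu> t g (fst z) \<partial>\<gamma>) = 0" by (rule orth)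
        qed
        moreover have "(\<integral>z. indicat_real B' (initial t (snd z)) * cond_deviation N \<mu> t g (fst z) \<partial>\<gamma>) =
          (\<integral>z. indicat_real B (snd z) * cond_deviation N \<mu> t g (fst z) \<partial>\<gamma>)"
          by (intro Bochner_Integration.integral_cong refl) (auto simp: B'(2) coupling_space[OF \<gamma>] indicator_def)
        ultimately have "(\<integral>x. u x * cond_deviation N \<mu> t g x \<partial>PX) = 0"
          using kernel_indicator_integral[OF \<gamma> \<kappa> BY D(1,2)] by (simp add: u_def)
        moreover have iug: "integrable PX (\<lambda>x. g x * u x)"
          using ui C gm by (intro Bochner_Integration.integrable_bound[OF integrable_mult_right[OF ui, of C]])
            (auto simp: abs_mult intro!: AE_I2 mult_right_mono order_trans[OF C abs_ge_self])
        moreover have iuw: "integrable PX (\<lambda>x. w x * u x)"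
          using ui C' w(3) by (intro Bochner_Integration.integrable_bound[OF integrable_mult_right[OF ui, of C']])
            (auto simp: abs_mult space_PX intro!: AE_I2 mult_right_mono order_trans[OF C' abs_ge_self])
        ultimately have 1: "(\<integral>x. g x * u x \<partial>PX) = (\<integral>x. w x * u x \<partial>PX)"
        proof -
          assume 0: "(\<integral>x. u x * cond_deviation N \<mu> t g x \<partial>PX) = 0"
            and i: "integrable PX (\<lambda>x. g x * u x)" "integrable PX (\<lambda>x. w x * u x)"
          have "u x * cond_deviation N \<mu> t g x = g x * u x - w x * u x" for x
            unfolding cond_deviation_def w_def by (simp add: algebra_simps)
          then show ?thesis using 0 Bochner_Integration.integral_diff[OF i] by simp
        qed
        have 2: "(\<integral>x. w x * v x \<partial>PX) = (\<integral>x. w x * u x \<partial>PX)"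
          unfolding v_def by (rule FX.real_cond_exp_intg(2)[OF iuw w(1) u])
        have ivg: "integrable PX (\<lambda>x. v x * g x)"
          using vi C gm by (intro Bochner_Integration.integrable_bound[OF integrable_mult_right[OF vi, of C]])
            (auto simp: abs_mult mult.commute[of "\<bar>v _\<bar>"] intro!: AE_I2 mult_right_mono order_trans[OF C abs_ge_self])
        have gi: "integrable PX g" using gm C by (intro PX.integrable_const_bound[of _ C]) auto
        have wi: "integrable PX w" by (rule PX.integrable_bounded_funs[OF w(3,2)]) (simp add: space_PX)
        have "AE x in PX. real_cond_exp PX (coord_filtration N \<mu> t) g x = w x"
        proof (rule FX.real_cond_exp_charact[OF _ gi wi w(1)])
          fix A assume "A \<in> sets (coord_filtration N \<mu> t)"
          from cond_mean_integral[OF \<mu> swc tN g this]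
          show "(LINT x:A|PX. g x) = (LINT x:A|PX. w x)"
            unfolding set_lebesgue_integral_def w_def by simp
        qed
        then have "AE x in PX. v x * real_cond_exp PX (coord_filtration N \<mu> t) g x = v x * w x"
          by eventually_elim simp
        then have "(\<integral>x. v x * real_cond_exp PX (coord_filtration N \<mu> t) g x \<partial>PX) = (\<integral>x. v x * w x \<partial>PX)"
          using vm w(3) by (intro integral_cong_AE) auto
        then have 3: "(\<integral>x. v x * g x \<partial>PX) = (\<integral>x. v x * w x \<partial>PX)"
          using FX.real_cond_exp_intg(2)[OF ivg vm(1) gm] by simp
        show ?thesis using 1 2 3 iug ivg by (simp add: right_diff_distrib mult.commute[of "v _"])
      qed
      have "AE x in PX. u x - v x = 0"
      proof (rule PX.density_zero)
        show i: "integrable PX (\<lambda>x. u x - v x)" using ui vi by simp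
        fix A assume "A \<in> sets PX"
        then obtain A' where A': "A' \<in> sets borel" "A = X \<inter> A'" by (rule on_supp_setsE[OF \<mu>])
        have "(\<integral>x. indicat_real A' x * (u x - v x) \<partial>PX) = 0"
          by (rule integral_indicator_eq_0_if_continuous[OF id_measurable_on_supp[OF \<mu>] i test A'(1)])
        moreover have "(\<integral>x. indicat_real A x * (u x - v x) \<partial>PX) = (\<integral>x. indicat_real A' x * (u x - v x) \<partial>PX)"
          by (intro Bochner_Integration.integral_cong refl) (auto simp: A'(2) space_PX indicator_def)
        ultimately show "(LINT x:A|PX. u x - v x) = 0" by (simp add: set_lebesgue_integral_def)
      qed
      then have "AE x in PX. measure (\<kappa> x) B = v x" by eventually_elim (simp add: u_def)
      then show ?thesis using vm(1) by blast
    qed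
  qed
qed

end

section \<open>Duality and attainment\<close>

lemma FF_continuous_bounded:
  assumes "borel_prob N \<mu>" "borel_prob N \<nu>" and swc: "successively_weakly_continuous N \<mu>" and F: "F \<in> FF N \<mu> \<nu>"
  shows "continuous_on (supp N \<mu> \<times> supp N \<nu>) F" "F \<in> bounded_funs (supp N \<mu> \<times> supp N \<nu>)"
proof -
  interpret marginals N \<mu> \<nu> using assms by unfold_locales
  obtain h g where h: "\<And>t. t \<in> {1..<N} \<Longrightarrow> h t \<in> C\<^sub>b (top_on {1..t})"
    and g: "\<And>t. t \<in> {1..<N} \<Longrightarrow> g t \<in> C\<^sub>b (top_on {1..N})"
    and Feq: "\<And>x y. x \<in> X \<Longrightarrow> y \<in> Y \<Longrightarrow> F (x, y) = (\<Sum>t \<in> {1..<N}. h t (initial t y) * cond_deviation N \<mu> t (g t) x)"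
    using F unfolding FF_iff by blast
  define F' where "F' z = (\<Sum>t \<in> {1..<N}. h t (initial t (snd z)) * cond_deviation N \<mu> t (g t) (fst z))" for z
  have eq: "F z = F' z" if "z \<in> X \<times> Y" for z using Feq[of "fst z" "snd z"] that by (auto simp: F'_def)
  have "continuous_on (X \<times> Y) F'"
    unfolding F'_def[abs_def]
  proof (intro continuous_on_sum continuous_on_mult)
    fix t assume t: "t \<in> {1..<N}"
    show "continuous_on (X \<times> Y) (\<lambda>z. h t (initial t (snd z)))"
      by (rule continuous_on_compose2[OF continuous_on_Cb_initial[OF h[OF t], of UNIV] continuous_on_snd[OF continuous_on_id]]) simp
    show "continuous_on (X \<times> Y) (\<lambda>z. cond_deviation N \<mu> t (g t) (fst z))"
      by (rule continuous_on_compose2[OF cond_deviation_regular(3)[OF swc t g[OF t]] continuous_on_fst[OF continuous_on_id]]) auto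
  qed
  then show "continuous_on (X \<times> Y) F" using eq by (simp cong: continuous_on_cong)
  have "\<exists>B. \<forall>z\<in>X \<times> Y. \<bar>h t (initial t (snd z)) * cond_deviation N \<mu> t (g t) (fst z)\<bar> \<le> B" if t: "t \<in> {1..<N}" for t
  proof -
    obtain B C where B: "\<And>y. y \<in> Y \<Longrightarrow> \<bar>h t (initial t y)\<bar> \<le> B" and C: "\<And>x. x \<in> X \<Longrightarrow> \<bar>cond_deviation N \<mu> t (g t) x\<bar> \<le> C"
      using Cb_initial_bounded[OF h[OF t], of Y] cond_deviation_regular(2)[OF swc t g[OF t]] unfolding bounded_funs_iff by blast
    have "\<bar>h t (initial t (snd z)) * cond_deviation N \<mu> t (g t) (fst z)\<bar> \<le> B * C" if "z \<in> X \<times> Y" for z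
      unfolding abs_mult using that B[of "snd z"] C[of "fst z"] by (intro mult_mono) auto
    then show ?thesis by blast
  qed
  then obtain B where B: "\<And>t z. t \<in> {1..<N} \<Longrightarrow> z \<in> X \<times> Y \<Longrightarrow> \<bar>h t (initial t (snd z)) * cond_deviation N \<mu> t (g t) (fst z)\<bar> \<le> B t"
    by metis
  have "\<bar>F z\<bar> \<le> (\<Sum>t \<in> {1..<N}. B t)" if "z \<in> X \<times> Y" for z
    unfolding eq[OF that] F'_def by (intro order_trans[OF sum_abs] sum_mono B that)
  then show "F \<in> bounded_funs (X \<times> Y)" unfolding bounded_funs_iff by blast
qed

lemma Cb_lincomb:
  assumes "f \<in> C\<^sub>b (top_on I)" "g \<in> C\<^sub>b (top_on I)" shows "(\<lambda>x. a * f x + b * g x) \<in> C\<^sub>b (top_on I)"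
  using assms unfolding Cb_iff
  by (auto intro!: continuous_intros function_space_add[OF function_space_bounded_funs]
      function_space_mult[OF function_space_bounded_funs])

lemma Cb_const: "(\<lambda>_. c) \<in> C\<^sub>b (top_on I)"
  unfolding Cb_iff by (simp add: bounded_funs_const)

lemma Cb_integrable:
  assumes "borel_prob N \<mu>" "f \<in> C\<^sub>b (top_on {1..N})" shows "integrable \<mu> f"
proof -
  interpret prob_space \<mu> by (rule borel_prob_prob_space[OF assms(1)])
  show ?thesis
    using assms(2) Cb_measurable[OF assms] unfolding Cb_iff
    by (intro integrable_bounded_funs[of f "Rspace {1..N}"]) (auto simp: borel_prob_space[OF assms(1)])
qed

lemma integral_Cb_lincomb:
  assumes "borel_prob N \<mu>" "f \<in> C\<^sub>b (top_on {1..N})" "g \<in> C\<^sub>b (top_on {1..N})"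
  shows "(\<integral>x. a * f x + b * g x \<partial>\<mu>) = a * (\<integral>x. f x \<partial>\<mu>) + b * (\<integral>x. g x \<partial>\<mu>)"
  using Cb_integrable[OF assms(1,2)] Cb_integrable[OF assms(1,3)] by simp

lemma integral_const_borel_prob: "borel_prob N \<mu> \<Longrightarrow> (\<integral>x. c \<partial>\<mu>) = (c :: real)"
  using prob_space.prob_space by (auto simp: borel_prob_def)

text \<open>
Identifies the marginals of the measure that represents the dual functional, about which only integrals of continuous functions are known.
\<close>

lemma distr_eq_on_supp:
  assumes \<mu>: "borel_prob N \<mu>" and \<gamma>: "prob_space \<gamma>" and T: "T \<in> \<gamma> \<rightarrow>\<^sub>M on_supp N \<mu>"
    and eq: "\<And>h :: vec \<Rightarrow> real. continuous_on UNIV h \<Longrightarrow> bounded (range h) \<Longrightarrow> (\<integral>z. h (T z) \<partial>\<gamma>) = (\<integral>x. h x \<partial>on_supp N \<mu>)"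
  shows "distr \<gamma> (on_supp N \<mu>) T = on_supp N \<mu>"
proof (rule measure_eqI)
  interpret \<gamma>: prob_space \<gamma> by (rule \<gamma>)
  interpret P: prob_space "on_supp N \<mu>" by (rule prob_space_on_supp[OF \<mu>])
  have i: "(\<lambda>x. x) \<in> on_supp N \<mu> \<rightarrow>\<^sub>M borel" by (rule id_measurable_on_supp[OF \<mu>])
  have T': "T \<in> \<gamma> \<rightarrow>\<^sub>M borel" by (rule measurable_compose[OF T i])
  have "distr \<gamma> borel T = distr (on_supp N \<mu>) borel (\<lambda>x. x)"
  proof (rule measure_eqI_bounded_continuous)
    show "finite_measure (distr \<gamma> borel T)" by (rule \<gamma>.finite_measure_distr[OF T'])
    show "finite_measure (distr (on_supp N \<mu>) borel (\<lambda>x. x))" by (rule P.finite_measure_distr[OF i])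
    fix h :: "vec \<Rightarrow> real" assume h: "continuous_on UNIV h" "bounded (range h)"
    have hb: "h \<in> borel_measurable borel" by (rule borel_measurable_continuous_onI[OF h(1)])
    show "(\<integral>x. h x \<partial>distr \<gamma> borel T) = (\<integral>x. h x \<partial>distr (on_supp N \<mu>) borel (\<lambda>x. x))"
      unfolding integral_distr[OF T' hb] integral_distr[OF i hb] by (rule eq[OF h])
  qed simp_all
  moreover fix A assume "A \<in> sets (distr \<gamma> (on_supp N \<mu>) T)"
  then have A: "A \<in> sets (on_supp N \<mu>)" by simp
  then obtain A' where A': "A' \<in> sets borel" "A = supp N \<mu> \<inter> A'" by (rule on_supp_setsE[OF \<mu>])
  ultimately have "emeasure (distr \<gamma> borel T) A' = emeasure (distr (on_supp N \<mu>) borel (\<lambda>x. x)) A'" by simp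
  moreover have "emeasure (distr (on_supp N \<mu>) borel (\<lambda>x. x)) A' = emeasure (on_supp N \<mu>) A"
    unfolding emeasure_distr[OF i A'(1)] by (rule arg_cong[where f = "emeasure _"]) (auto simp: A'(2) space_on_supp[OF \<mu>])
  moreover have "T -` A' \<inter> space \<gamma> = T -` A \<inter> space \<gamma>"
    using measurable_space[OF T] by (auto simp: A'(2) space_on_supp[OF \<mu>])
  ultimately show "emeasure (distr \<gamma> (on_supp N \<mu>) T) A = emeasure (on_supp N \<mu>) A"
    by (simp only: emeasure_distr[OF T A] emeasure_distr[OF T' A'(1)])
qed simp

text \<open>
The function \<open>\<phi>\<close> dominates the indicator of the complement of a compact set and is continuous, so that it may be
  used in the dual problem.
\<close>

lemma exists_tight_cutoff:
  assumes \<mu>: "borel_prob N \<mu>" and e: "0 < e"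
  shows "\<exists>\<phi> K. \<phi> \<in> C\<^sub>b (top_on {1..N}) \<and> (\<integral>x. \<phi> x \<partial>\<mu>) < e \<and> (\<forall>x. 0 \<le> \<phi> x) \<and>
    compact K \<and> K \<subseteq> supp N \<mu> \<and> (\<forall>x\<in>supp N \<mu> - K. \<phi> x = 1)"
proof -
  interpret prob_space \<mu> by (rule borel_prob_prob_space[OF \<mu>])
  define \<phi> where "\<phi> n x = 1 - cutoff {1..N} n x" for n x
  have Cb: "\<phi> n \<in> C\<^sub>b (top_on {1..N})" for n
    unfolding Cb_iff bounded_funs_iff
  proof (intro conjI exI ballI)
    show "continuous_on (Rspace {1..N}) (\<phi> n)" unfolding \<phi>_def[abs_def] by (intro continuous_intros continuous_on_cutoff)
    show "\<bar>\<phi> n x\<bar> \<le> 1" for x using cutoff_range[of "{1..N}" n x] by (simp add: \<phi>_def)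
  qed
  have "(\<lambda>n. \<integral>x. \<phi> n x \<partial>\<mu>) \<longlonglongrightarrow> (\<integral>x. 0 \<partial>\<mu>)"
  proof (rule integral_dominated_convergence[where w = "\<lambda>_. 1"])
    show "\<phi> n \<in> borel_measurable \<mu>" for n by (rule Cb_measurable[OF \<mu> Cb])
    show "AE x in \<mu>. (\<lambda>n. \<phi> n x) \<longlonglongrightarrow> 0"
    proof (rule AE_I2)
      fix x show "(\<lambda>n. \<phi> n x) \<longlonglongrightarrow> 0"
        unfolding \<phi>_def using tendsto_diff[OF tendsto_const cutoff_tendsto_1[of "{1..N}" x], of 1] by simp
    qed
    show "AE x in \<mu>. norm (\<phi> n x) \<le> 1" for n
      using cutoff_range[of "{1..N}" n] by (auto simp: \<phi>_def)
  qed auto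
  then have "\<forall>\<^sub>F n in sequentially. (\<integral>x. \<phi> n x \<partial>\<mu>) < e" using e by (intro order_tendstoD(2)) auto
  then obtain n where n: "(\<integral>x. \<phi> n x \<partial>\<mu>) < e" by (auto simp: eventually_sequentially)
  define K where "K = supp N \<mu> \<inter> {x \<in> Rspace {1..N}. \<forall>i\<in>{1..N}. \<bar>x i\<bar> \<le> real n + 1}"
  have "compact K" unfolding K_def by (intro closed_Int_compact closed_supp compact_box)
  moreover have "\<phi> n x = 1" if x: "x \<in> supp N \<mu> - K" for x
  proof -
    have "x \<in> Rspace {1..N}" using x supp_subset by blast
    then obtain i where i: "i \<in> {1..N}" "\<not> \<bar>x i\<bar> \<le> real n + 1" using x unfolding K_def by blast
    have "cutoff {1..N} n x = 0" using i(2) by (intro cutoff_eq_0[OF finite_atLeastAtMost i(1)]) simp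
    then show ?thesis by (simp add: \<phi>_def)
  qed
  moreover have "0 \<le> \<phi> n x" for x using cutoff_range[of "{1..N}" n x] by (simp add: \<phi>_def)
  moreover have "K \<subseteq> supp N \<mu>" by (auto simp: K_def)
  ultimately show ?thesis using Cb n by blast
qed

context marginals
begin

text \<open>
The number \<open>r\<close> is the price of a bound of \<open>f\<close> from above when a copy of the cost \<open>c\<close> can be had for \<open>d\<close>. If \<open>s = 0\<close>,
  the product \<open>s * c\<close> is \<open>0\<close> also where \<open>c\<close> is infinite.
\<close>

definition dominates :: "(vec \<times> vec \<Rightarrow> ereal) \<Rightarrow> real \<Rightarrow> (vec \<times> vec \<Rightarrow> real) \<Rightarrow> real \<Rightarrow> bool" where
  "dominates c d f r \<longleftrightarrow> (\<exists>\<Phi> \<Psi> F s. \<Phi> \<in> C\<^sub>b (top_on {1..N}) \<and> \<Psi> \<in> C\<^sub>b (top_on {1..N}) \<and>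
     F \<in> linear_span (FF N \<mu> \<nu>) \<and> 0 \<le> s \<and>
     (\<forall>x\<in>X. \<forall>y\<in>Y. ereal (f (x, y)) \<le> ereal (\<Phi> x + \<Psi> y + F (x, y)) + ereal s * c (x, y)) \<and>
     r = (\<integral>x. \<Phi> x \<partial>\<mu>) + (\<integral>y. \<Psi> y \<partial>\<nu>) + s * d)"

definition dual_bound :: "(vec \<times> vec \<Rightarrow> ereal) \<Rightarrow> real \<Rightarrow> bool" where
  "dual_bound c d \<longleftrightarrow> (\<forall>\<Phi> \<Psi> F. \<Phi> \<in> C\<^sub>b (top_on {1..N}) \<longrightarrow> \<Psi> \<in> C\<^sub>b (top_on {1..N}) \<longrightarrow> F \<in> linear_span (FF N \<mu> \<nu>) \<longrightarrow>
     (\<forall>x\<in>X. \<forall>y\<in>Y. ereal (\<Phi> x + \<Psi> y) \<le> c (x, y) + ereal (F (x, y))) \<longrightarrow>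
     (\<integral>x. \<Phi> x \<partial>\<mu>) + (\<integral>y. \<Psi> y \<partial>\<nu>) \<le> d)"

lemma dominatesI:
  assumes "\<Phi> \<in> C\<^sub>b (top_on {1..N})" "\<Psi> \<in> C\<^sub>b (top_on {1..N})" "F \<in> linear_span (FF N \<mu> \<nu>)" "0 \<le> s"
    "\<And>x y. x \<in> X \<Longrightarrow> y \<in> Y \<Longrightarrow> ereal (f (x, y)) \<le> ereal (\<Phi> x + \<Psi> y + F (x, y)) + ereal s * c (x, y)"
    "r = (\<integral>x. \<Phi> x \<partial>\<mu>) + (\<integral>y. \<Psi> y \<partial>\<nu>) + s * d"
  shows "dominates c d f r"
  unfolding dominates_def using assms by blast

lemma dominates_add:
  assumes c: "\<And>z. z \<in> X \<times> Y \<Longrightarrow> ereal b \<le> c z"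
    and "dominates c d f r" "dominates c d f' r'"
  shows "dominates c d (\<lambda>z. f z + f' z) (r + r')"
proof -
  obtain \<Phi> \<Psi> F s where 1: "\<Phi> \<in> C\<^sub>b (top_on {1..N})" "\<Psi> \<in> C\<^sub>b (top_on {1..N})" "F \<in> linear_span (FF N \<mu> \<nu>)" "0 \<le> s"
    "\<And>x y. x \<in> X \<Longrightarrow> y \<in> Y \<Longrightarrow> ereal (f (x, y)) \<le> ereal (\<Phi> x + \<Psi> y + F (x, y)) + ereal s * c (x, y)"
    "r = (\<integral>x. \<Phi> x \<partial>\<mu>) + (\<integral>y. \<Psi> y \<partial>\<nu>) + s * d" using assms(2) unfolding dominates_def by blast
  obtain \<Phi>' \<Psi>' F' s' where 2: "\<Phi>' \<in> C\<^sub>b (top_on {1..N})" "\<Psi>' \<in> C\<^sub>b (top_on {1..N})" "F' \<in> linear_span (FF N \<mu> \<nu>)" "0 \<le> s'"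
    "\<And>x y. x \<in> X \<Longrightarrow> y \<in> Y \<Longrightarrow> ereal (f' (x, y)) \<le> ereal (\<Phi>' x + \<Psi>' y + F' (x, y)) + ereal s' * c (x, y)"
    "r' = (\<integral>x. \<Phi>' x \<partial>\<mu>) + (\<integral>y. \<Psi>' y \<partial>\<nu>) + s' * d" using assms(3) unfolding dominates_def by blast
  show ?thesis
  proof (rule dominatesI)
    show "(\<lambda>x. 1 * \<Phi> x + 1 * \<Phi>' x) \<in> C\<^sub>b (top_on {1..N})" "(\<lambda>x. 1 * \<Psi> x + 1 * \<Psi>' x) \<in> C\<^sub>b (top_on {1..N})"
      by (rule Cb_lincomb[OF 1(1) 2(1)] Cb_lincomb[OF 1(2) 2(2)])+
    show "(\<lambda>z. F z + F' z) \<in> linear_span (FF N \<mu> \<nu>)" by (rule linear_span_add[OF 1(3) 2(3)])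
    show "0 \<le> s + s'" using 1(4) 2(4) by simp
    show "r + r' = (\<integral>x. 1 * \<Phi> x + 1 * \<Phi>' x \<partial>\<mu>) + (\<integral>y. 1 * \<Psi> y + 1 * \<Psi>' y \<partial>\<nu>) + (s + s') * d"
      unfolding integral_Cb_lincomb[OF \<mu> 1(1) 2(1)] integral_Cb_lincomb[OF \<nu> 1(2) 2(2)] 1(6) 2(6) by (simp add: algebra_simps)
    fix x y assume xy: "x \<in> X" "y \<in> Y"
    show "ereal (f (x, y) + f' (x, y)) \<le> ereal (1 * \<Phi> x + 1 * \<Phi>' x + (1 * \<Psi> y + 1 * \<Psi>' y) + (F (x, y) + F' (x, y))) + ereal (s + s') * c (x, y)"
      using 1(5)[OF xy] 2(5)[OF xy] 1(4) 2(4) c[of "(x, y)"] xy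
      by (cases "c (x, y)"; cases "s = 0"; cases "s' = 0") (auto simp: algebra_simps)
  qed
qed

lemma dominates_mult:
  assumes c: "\<And>z. z \<in> X \<times> Y \<Longrightarrow> ereal b \<le> c z" and "dominates c d f r" "0 \<le> a"
  shows "dominates c d (\<lambda>z. a * f z) (a * r)"
proof -
  obtain \<Phi> \<Psi> F s where 1: "\<Phi> \<in> C\<^sub>b (top_on {1..N})" "\<Psi> \<in> C\<^sub>b (top_on {1..N})" "F \<in> linear_span (FF N \<mu> \<nu>)" "0 \<le> s"
    "\<And>x y. x \<in> X \<Longrightarrow> y \<in> Y \<Longrightarrow> ereal (f (x, y)) \<le> ereal (\<Phi> x + \<Psi> y + F (x, y)) + ereal s * c (x, y)"
    "r = (\<integral>x. \<Phi> x \<partial>\<mu>) + (\<integral>y. \<Psi> y \<partial>\<nu>) + s * d" using assms(2) unfolding dominates_def by blast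
  show ?thesis
  proof (rule dominatesI)
    show "(\<lambda>x. a * \<Phi> x + 0 * \<Phi> x) \<in> C\<^sub>b (top_on {1..N})" "(\<lambda>x. a * \<Psi> x + 0 * \<Psi> x) \<in> C\<^sub>b (top_on {1..N})"
      by (rule Cb_lincomb[OF 1(1) 1(1)] Cb_lincomb[OF 1(2) 1(2)])+
    show "(\<lambda>z. a * F z) \<in> linear_span (FF N \<mu> \<nu>)" by (rule linear_span_mult[OF 1(3)])
    show "0 \<le> a * s" using 1(4) assms(3) by simp
    show "a * r = (\<integral>x. a * \<Phi> x + 0 * \<Phi> x \<partial>\<mu>) + (\<integral>y. a * \<Psi> y + 0 * \<Psi> y \<partial>\<nu>) + (a * s) * d"
      unfolding integral_Cb_lincomb[OF \<mu> 1(1) 1(1)] integral_Cb_lincomb[OF \<nu> 1(2) 1(2)] 1(6) by (simp add: algebra_simps)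
    fix x y assume xy: "x \<in> X" "y \<in> Y"
    have cb: "ereal b \<le> c (x, y)" using c xy by simp
    show "ereal (a * f (x, y)) \<le> ereal (a * \<Phi> x + 0 * \<Phi> x + (a * \<Psi> y + 0 * \<Psi> y) + a * F (x, y)) + ereal (a * s) * c (x, y)"
    proof (cases "c (x, y)")
      case (real k)
      then have "f (x, y) \<le> \<Phi> x + \<Psi> y + F (x, y) + s * k" using 1(5)[OF xy] by simp
      then have "a * f (x, y) \<le> a * (\<Phi> x + \<Psi> y + F (x, y) + s * k)" using assms(3) by (rule mult_left_mono)
      then show ?thesis using real by (simp add: algebra_simps)
    next
      case PInf
      show ?thesis
      proof (cases "a * s = 0")
        case True
        then show ?thesis
        proof (cases "a = 0")
          case False
          then have s: "s = 0" using True by simp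
          have "f (x, y) \<le> \<Phi> x + \<Psi> y + F (x, y)" using 1(5)[OF xy] by (simp add: s zero_ereal_def[symmetric])
          then have "a * f (x, y) \<le> a * (\<Phi> x + \<Psi> y + F (x, y))" using assms(3) by (rule mult_left_mono)
          then show ?thesis by (simp add: s zero_ereal_def[symmetric] distrib_left)
        qed (simp add: zero_ereal_def[symmetric])
      next
        case False
        then have "0 < a * s" using 1(4) assms(3) by (simp add: less_le)
        then show ?thesis using PInf False by simp
      qed
    qed (use cb in simp)
  qed
qed

text \<open>
For \<open>s > 0\<close>, dividing by \<open>s\<close> turns the inequality into a feasible point of the dual problem for
  \<open>c\<close>, whose value is at most \<open>d\<close>. For \<open>s = 0\<close> it is a feasible point for the cost \<open>0\<close>,
  and weak duality for the product coupling applies.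
\<close>

lemma dominates_lower_bound:
  assumes swc: "successively_weakly_continuous N \<mu>"
    and d: "dual_bound c d"
    and f: "dominates c d f r" "\<And>z. z \<in> X \<times> Y \<Longrightarrow> - B \<le> f z"
  shows "- B \<le> r"
proof -
  obtain \<Phi> \<Psi> F s where 1: "\<Phi> \<in> C\<^sub>b (top_on {1..N})" "\<Psi> \<in> C\<^sub>b (top_on {1..N})" "F \<in> linear_span (FF N \<mu> \<nu>)" "0 \<le> s"
    "\<And>x y. x \<in> X \<Longrightarrow> y \<in> Y \<Longrightarrow> ereal (f (x, y)) \<le> ereal (\<Phi> x + \<Psi> y + F (x, y)) + ereal s * c (x, y)"
    "r = (\<integral>x. \<Phi> x \<partial>\<mu>) + (\<integral>y. \<Psi> y \<partial>\<nu>) + s * d" using f(1) unfolding dominates_def by blast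
  have low: "ereal (- B) \<le> ereal (\<Phi> x + \<Psi> y + F (x, y)) + ereal s * c (x, y)" if "x \<in> X" "y \<in> Y" for x y
    using 1(5)[OF that] f(2)[of "(x, y)"] that by (metis SigmaI ereal_less_eq(3) order_trans)
  show ?thesis
  proof (cases "s = 0")
    case True
    obtain S where S: "S \<in> linear_span (SS N \<mu> \<nu>)" "\<And>x y. x \<in> X \<Longrightarrow> y \<in> Y \<Longrightarrow> F (x, y) = S (x, y)"
      using span_FF_eq_span_SS[OF swc 1(3)] by blast
    have "ereal ((\<integral>x. (-1) * \<Phi> x + (-B) * 1 \<partial>\<mu>) + (\<integral>y. (-1) * \<Psi> y + 0 * 1 \<partial>\<nu>)) \<le> ereal_integral (PX \<Otimes>\<^sub>M PY) (\<lambda>_. 0)"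
    proof (rule weak_duality[OF product_coupling_causal _ _ _ _ S(1), where b = 0])
      show "(\<lambda>x. (-1) * \<Phi> x + (-B) * 1) \<in> C\<^sub>b (top_on {1..N})" "(\<lambda>y. (-1) * \<Psi> y + 0 * 1) \<in> C\<^sub>b (top_on {1..N})"
        by (rule Cb_lincomb[OF 1(1) Cb_const] Cb_lincomb[OF 1(2) Cb_const])+
      show "ereal ((-1) * \<Phi> x + (-B) * 1 + ((-1) * \<Psi> y + 0 * 1)) \<le> 0 + ereal (S (x, y))" if "x \<in> X" "y \<in> Y" for x y
        using low[OF that] S(2)[OF that] True by (simp add: zero_ereal_def[symmetric])
    qed auto
    then show ?thesis
      unfolding integral_Cb_lincomb[OF \<mu> 1(1) Cb_const] integral_Cb_lincomb[OF \<nu> 1(2) Cb_const]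
        integral_const_borel_prob[OF \<mu>] integral_const_borel_prob[OF \<nu>]
      using True 1(6) by (simp add: ereal_integral_def)
  next
    case False
    then have s: "0 < s" using 1(4) by simp
    have "(\<integral>x. (-1/s) * \<Phi> x + (-B/s) * 1 \<partial>\<mu>) + (\<integral>y. (-1/s) * \<Psi> y + 0 * 1 \<partial>\<nu>) \<le> d"
    proof (rule d[unfolded dual_bound_def, rule_format])
      show "(\<lambda>x. (-1/s) * \<Phi> x + (-B/s) * 1) \<in> C\<^sub>b (top_on {1..N})" "(\<lambda>y. (-1/s) * \<Psi> y + 0 * 1) \<in> C\<^sub>b (top_on {1..N})"
        by (rule Cb_lincomb[OF 1(1) Cb_const] Cb_lincomb[OF 1(2) Cb_const])+
      show "(\<lambda>z. (1/s) * F z) \<in> linear_span (FF N \<mu> \<nu>)" by (rule linear_span_mult[OF 1(3)])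
      show "ereal ((-1/s) * \<Phi> x + (-B/s) * 1 + ((-1/s) * \<Psi> y + 0 * 1)) \<le> c (x, y) + ereal ((1/s) * F (x, y))" if "x \<in> X" "y \<in> Y" for x y
      proof (cases "c (x, y)")
        case (real k)
        then have "- B - \<Phi> x - \<Psi> y - F (x, y) \<le> k * s" using low[OF that] by (simp add: mult.commute)
        then have "(- B - \<Phi> x - \<Psi> y - F (x, y)) / s \<le> k" by (simp only: pos_divide_le_eq[OF s])
        then show ?thesis using real by (simp add: diff_divide_distrib)
      next
        case MInf
        then show ?thesis using low[OF that] s by simp
      qed simp
    qed
    then have "(-1/s) * (\<integral>x. \<Phi> x \<partial>\<mu>) + (-B/s) + (-1/s) * (\<integral>y. \<Psi> y \<partial>\<nu>) \<le> d"
      unfolding integral_Cb_lincomb[OF \<mu> 1(1) Cb_const] integral_Cb_lincomb[OF \<nu> 1(2) Cb_const]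
        integral_const_borel_prob[OF \<mu>] integral_const_borel_prob[OF \<nu>] by simp
    then have "(- (\<integral>x. \<Phi> x \<partial>\<mu>) - B - (\<integral>y. \<Psi> y \<partial>\<nu>)) / s \<le> d" by (simp add: diff_divide_distrib)
    then have "- (\<integral>x. \<Phi> x \<partial>\<mu>) - B - (\<integral>y. \<Psi> y \<partial>\<nu>) \<le> d * s" by (simp only: pos_divide_le_eq[OF s])
    then show ?thesis using 1(6) by (simp add: mult.commute)
  qed
qed

text \<open>
Apply the Hahn-Banach theorem to the cheapest price of a bound from above.
\<close>

lemma exists_dual_functional:
  assumes swc: "successively_weakly_continuous N \<mu>" and c: "\<And>z. z \<in> X \<times> Y \<Longrightarrow> ereal b \<le> c z"
    and d: "dual_bound c d"
  shows "\<exists>L. linear_on (bounded_funs (X \<times> Y)) L \<and>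
    (\<forall>f r. f \<in> bounded_funs (X \<times> Y) \<longrightarrow> dominates c d f r \<longrightarrow> L f \<le> r)"
proof -
  let ?V = "bounded_funs (X \<times> Y)"
  define p where "p f = Inf {r. dominates c d f r}" for f
  have ne: "\<exists>r. dominates c d f r" if "f \<in> ?V" for f
  proof -
    obtain B where B: "\<And>z. z \<in> X \<times> Y \<Longrightarrow> \<bar>f z\<bar> \<le> B" using \<open>f \<in> ?V\<close> by (auto simp: bounded_funs_iff)
    show ?thesis
    proof (intro exI dominatesI)
      show "(\<lambda>_. B) \<in> C\<^sub>b (top_on {1..N})" "(\<lambda>_. 0) \<in> C\<^sub>b (top_on {1..N})" by (rule Cb_const)+
      show "(\<lambda>_. 0) \<in> linear_span (FF N \<mu> \<nu>)" by (rule linear_span_zero)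
      show "(0::real) \<le> 0" by simp
      show "ereal (f (x, y)) \<le> ereal (B + 0 + 0) + ereal 0 * c (x, y)" if "x \<in> X" "y \<in> Y" for x y
        using B[of "(x, y)"] that by (simp add: zero_ereal_def[symmetric] abs_le_iff)
    qed (rule refl)
  qed
  have bdd: "bdd_below {r. dominates c d f r}" if "f \<in> ?V" for f
  proof -
    obtain B where B: "\<And>z. z \<in> X \<times> Y \<Longrightarrow> \<bar>f z\<bar> \<le> B" using \<open>f \<in> ?V\<close> by (auto simp: bounded_funs_iff)
    have "- B \<le> f z" if "z \<in> X \<times> Y" for z using B[OF that] by (simp add: abs_le_iff)
    then have "- B \<le> r" if "dominates c d f r" for r by (rule dominates_lower_bound[OF swc d that])
    then show ?thesis by (intro bdd_belowI[of _ "- B"]) auto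
  qed
  have ple: "p f \<le> r" if "f \<in> ?V" "dominates c d f r" for f r
    unfolding p_def using that bdd by (intro cInf_lower) auto
  have lep: "a \<le> p f" if "f \<in> ?V" "\<And>r. dominates c d f r \<Longrightarrow> a \<le> r" for a f
    unfolding p_def using that ne by (intro cInf_greatest) auto
  note add = function_space_add[OF function_space_bounded_funs] and mult = function_space_mult[OF function_space_bounded_funs]
  have "sublinear_on ?V p"
    unfolding sublinear_on_def
  proof safe
    fix f g assume fg: "f \<in> ?V" "g \<in> ?V"
    have "p (\<lambda>x. f x + g x) - r \<le> r'" if "dominates c d f r" "dominates c d g r'" for r r'
      using ple[OF add[OF fg] dominates_add[OF c that]] by simp
    then have "p (\<lambda>x. f x + g x) - r \<le> p g" if "dominates c d f r" for r
      using that fg by (intro lep) auto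
    then have "p (\<lambda>x. f x + g x) - p g \<le> p f"
      using fg by (intro lep) (auto simp: algebra_simps)
    then show "p (\<lambda>x. f x + g x) \<le> p f + p g" by simp
  next
    fix f and a :: real assume f: "f \<in> ?V" and a: "0 \<le> a"
    have *: "p (\<lambda>x. a * f x) \<le> a * r" if "dominates c d f r" for r
      by (rule ple[OF mult[OF f] dominates_mult[OF c that a]])
    show "p (\<lambda>x. a * f x) \<le> a * p f"
    proof (cases "a = 0")
      case True
      then show ?thesis using * ne[OF f] by auto
    next
      case False
      then have "p (\<lambda>x. a * f x) / a \<le> p f"
        using * a f by (intro lep) (auto simp: field_simps)
      then show ?thesis using False a by (auto simp: field_simps)
    qed
  qed
  then obtain L where L: "linear_on ?V L" "\<And>f. f \<in> ?V \<Longrightarrow> L f \<le> p f"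
    using exists_linear_below_sublinear[OF function_space_bounded_funs] by blast
  then show ?thesis using ple by (blast intro: order_trans)
qed

text \<open>
An upper bound of the dual values is attained by a causal coupling: the functional \<open>L\<close> from the
  previous lemma is represented by a measure that inherits marginals, causality and cost from the
  inequalities \<open>L f \<le> r\<close>.
\<close>

theorem exists_causal_coupling_le:
  assumes swc: "successively_weakly_continuous N \<mu>"
    and lsc: "lower_semicontinuous (top_of_set (X \<times> Y)) c" and c: "\<And>z. z \<in> X \<times> Y \<Longrightarrow> ereal b \<le> c z"
    and d: "dual_bound c d"
  shows "\<exists>\<gamma>\<in>causal_couplings N \<mu> \<nu>. ereal_integral \<gamma> c \<le> ereal d"
proof -
  let ?V = "bounded_funs (X \<times> Y)"
  obtain L where lin: "linear_on ?V L" and Lle: "\<And>f r. f \<in> ?V \<Longrightarrow> dominates c d f r \<Longrightarrow> L f \<le> r"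
    using exists_dual_functional[OF swc c d] by blast
  have Lneg: "L (\<lambda>z. - f z) = - L f" if "f \<in> ?V" for f
  proof -
    have "L (\<lambda>z. (-1) * f z) = (-1) * L f" using lin that unfolding linear_on_def by blast
    then show ?thesis by simp
  qed
  have neg: "(\<lambda>z. - f z) \<in> ?V" if "f \<in> ?V" for f
    using function_space_mult[OF function_space_bounded_funs that, of "-1"] by simp
  have Lupper: "L f \<le> (\<integral>x. \<Phi> x \<partial>\<mu>) + (\<integral>y. \<Psi> y \<partial>\<nu>)"
    if "f \<in> ?V" "\<Phi> \<in> C\<^sub>b (top_on {1..N})" "\<Psi> \<in> C\<^sub>b (top_on {1..N})" "F \<in> linear_span (FF N \<mu> \<nu>)"
      "\<And>x y. x \<in> X \<Longrightarrow> y \<in> Y \<Longrightarrow> f (x, y) \<le> \<Phi> x + \<Psi> y + F (x, y)" for f \<Phi> \<Psi> F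
  proof (rule Lle[OF that(1) dominatesI[OF that(2,3,4)]])
    show "(0::real) \<le> 0" by simp
    show "ereal (f (x, y)) \<le> ereal (\<Phi> x + \<Psi> y + F (x, y)) + ereal 0 * c (x, y)" if "x \<in> X" "y \<in> Y" for x y
      using \<open>\<And>x y. x \<in> X \<Longrightarrow> y \<in> Y \<Longrightarrow> f (x, y) \<le> \<Phi> x + \<Psi> y + F (x, y)\<close>[OF that] by (simp add: zero_ereal_def[symmetric])
  qed simp
  have Lsum: "L f = (\<integral>x. \<Phi> x \<partial>\<mu>) + (\<integral>y. \<Psi> y \<partial>\<nu>)"
    if f: "f \<in> ?V" and \<Phi>: "\<Phi> \<in> C\<^sub>b (top_on {1..N})" and \<Psi>: "\<Psi> \<in> C\<^sub>b (top_on {1..N})" and F: "F \<in> linear_span (FF N \<mu> \<nu>)"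
      and eq: "\<And>x y. x \<in> X \<Longrightarrow> y \<in> Y \<Longrightarrow> f (x, y) = \<Phi> x + \<Psi> y + F (x, y)" for f \<Phi> \<Psi> F
  proof (rule antisym)
    show "L f \<le> (\<integral>x. \<Phi> x \<partial>\<mu>) + (\<integral>y. \<Psi> y \<partial>\<nu>)" by (rule Lupper[OF f \<Phi> \<Psi> F]) (simp add: eq)
    have "L (\<lambda>z. - f z) \<le> (\<integral>x. (-1) * \<Phi> x + 0 * \<Phi> x \<partial>\<mu>) + (\<integral>y. (-1) * \<Psi> y + 0 * \<Psi> y \<partial>\<nu>)"
      by (rule Lupper[OF neg[OF f] Cb_lincomb[OF \<Phi> \<Phi>] Cb_lincomb[OF \<Psi> \<Psi>] linear_span_mult[OF F, of "-1"]]) (simp add: eq)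
    then show "(\<integral>x. \<Phi> x \<partial>\<mu>) + (\<integral>y. \<Psi> y \<partial>\<nu>) \<le> L f" by (simp add: Lneg[OF f])
  qed
  interpret L: tight_positive_functional "X \<times> Y" L
  proof
    show "linear_on ?V L" by (rule lin)
    show "0 \<le> L f" if f: "f \<in> ?V" "\<And>z. z \<in> X \<times> Y \<Longrightarrow> 0 \<le> f z" for f
    proof -
      have "L (\<lambda>z. - f z) \<le> (\<integral>x. 0 \<partial>\<mu>) + (\<integral>y. 0 \<partial>\<nu>)"
        by (rule Lupper[OF neg[OF f(1)] Cb_const Cb_const linear_span_zero]) (use f(2) in auto)
      then show ?thesis by (simp add: Lneg[OF f(1)])
    qed
    show "L (\<lambda>_. 1) = 1"
      using Lsum[OF bounded_funs_const Cb_const[of 1] Cb_const[of 0] linear_span_zero]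
      unfolding integral_const_borel_prob[OF \<mu>] integral_const_borel_prob[OF \<nu>] by simp
    fix e :: real assume e: "0 < e"
    obtain \<phi> K where \<phi>: "\<phi> \<in> C\<^sub>b (top_on {1..N})" "(\<integral>x. \<phi> x \<partial>\<mu>) < e/2" "\<And>x. 0 \<le> \<phi> x"
      and K: "compact K" "K \<subseteq> X" "\<And>x. x \<in> X - K \<Longrightarrow> \<phi> x = 1" using exists_tight_cutoff[OF \<mu> half_gt_zero[OF e]] by blast
    obtain \<psi> J where \<psi>: "\<psi> \<in> C\<^sub>b (top_on {1..N})" "(\<integral>x. \<psi> x \<partial>\<nu>) < e/2" "\<And>x. 0 \<le> \<psi> x"
      and J: "compact J" "J \<subseteq> Y" "\<And>x. x \<in> Y - J \<Longrightarrow> \<psi> x = 1" using exists_tight_cutoff[OF \<nu> half_gt_zero[OF e]] by blast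
    \<comment> \<open>Off \<open>K \<times> J\<close> at least one coordinate is outside its compact set, so \<open>\<phi> \<oplus> \<psi>\<close> dominates the indicator.\<close>
    have "L (indicat_real (X \<times> Y - K \<times> J)) \<le> (\<integral>x. \<phi> x \<partial>\<mu>) + (\<integral>x. \<psi> x \<partial>\<nu>)"
    proof (rule Lupper[OF bounded_funs_indicator \<phi>(1) \<psi>(1) linear_span_zero])
      fix x y assume "x \<in> X" "y \<in> Y"
      then show "indicat_real (X \<times> Y - K \<times> J) (x, y) \<le> \<phi> x + \<psi> y + 0"
        using \<phi>(3)[of x] \<psi>(3)[of y] K(3)[of x] J(3)[of y] by (auto simp: indicator_def)
    qed
    then show "\<exists>K. compact K \<and> K \<subseteq> X \<times> Y \<and> L (indicat_real (X \<times> Y - K)) < e"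
      using \<phi>(2) \<psi>(2) K(1,2) J(1,2) by (intro exI[of _ "K \<times> J"]) (auto intro: compact_Times)
  qed
  obtain \<gamma> where \<gamma>p: "prob_space \<gamma>" and \<gamma>s: "sets \<gamma> = sets (restrict_space borel (X \<times> Y))"
    and \<gamma>L: "\<And>f. f \<in> ?V \<Longrightarrow> continuous_on (X \<times> Y) f \<Longrightarrow> (\<integral>z. f z \<partial>\<gamma>) = L f"
    using L.representing_measure by blast
  interpret \<gamma>: prob_space \<gamma> by (rule \<gamma>p)
  have \<gamma>s': "sets \<gamma> = sets (PX \<Otimes>\<^sub>M PY)" by (simp add: \<gamma>s sets_pair_eq_restrict_borel)
  have \<gamma>sp: "space \<gamma> = X \<times> Y" using sets_eq_imp_space_eq[OF \<gamma>s] by (simp add: space_restrict_space)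
  have fst: "fst \<in> \<gamma> \<rightarrow>\<^sub>M PX" and snd: "snd \<in> \<gamma> \<rightarrow>\<^sub>M PY" by (simp_all add: measurable_cong_sets[OF \<gamma>s' refl])
  have hV: "(\<lambda>z. h (fst z)) \<in> ?V" "(\<lambda>z. h (snd z)) \<in> ?V" if hb: "bounded (range h)" for h :: "vec \<Rightarrow> real"
  proof -
    obtain B where "\<And>x. \<bar>h x\<bar> \<le> B" using hb by (auto simp: bounded_iff)
    then show "(\<lambda>z. h (fst z)) \<in> ?V" "(\<lambda>z. h (snd z)) \<in> ?V" unfolding bounded_funs_iff by blast+
  qed
  have "distr \<gamma> PX fst = PX"
  proof (rule distr_eq_on_supp[OF \<mu> \<gamma>p fst])
    fix h :: "vec \<Rightarrow> real" assume h: "continuous_on UNIV h" "bounded (range h)"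
    have hC: "h \<in> C\<^sub>b (top_on {1..N})" by (rule bounded_continuous_Cb[OF h])
    have "(\<integral>z. h (fst z) \<partial>\<gamma>) = L (\<lambda>z. h (fst z))"
      by (rule \<gamma>L[OF hV(1)[OF h(2)] continuous_on_compose2[OF h(1) continuous_on_fst[OF continuous_on_id]]]) simp
    also have "\<dots> = (\<integral>x. h x \<partial>\<mu>) + (\<integral>x. 0 \<partial>\<nu>)" by (rule Lsum[OF hV(1)[OF h(2)] hC Cb_const linear_span_zero]) simp
    finally show "(\<integral>z. h (fst z) \<partial>\<gamma>) = (\<integral>x. h x \<partial>PX)" by (simp only: integral_on_supp[OF \<mu> Cb_measurable[OF \<mu> hC]] integral_const_borel_prob[OF \<nu>] add_0_right)
  qed
  moreover have "distr \<gamma> PY snd = PY"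
  proof (rule distr_eq_on_supp[OF \<nu> \<gamma>p snd])
    fix h :: "vec \<Rightarrow> real" assume h: "continuous_on UNIV h" "bounded (range h)"
    have hC: "h \<in> C\<^sub>b (top_on {1..N})" by (rule bounded_continuous_Cb[OF h])
    have "(\<integral>z. h (snd z) \<partial>\<gamma>) = L (\<lambda>z. h (snd z))"
      by (rule \<gamma>L[OF hV(2)[OF h(2)] continuous_on_compose2[OF h(1) continuous_on_snd[OF continuous_on_id]]]) simp
    also have "\<dots> = (\<integral>x. 0 \<partial>\<mu>) + (\<integral>x. h x \<partial>\<nu>)" by (rule Lsum[OF hV(2)[OF h(2)] Cb_const hC linear_span_zero]) simp
    finally show "(\<integral>z. h (snd z) \<partial>\<gamma>) = (\<integral>x. h x \<partial>PY)" by (simp only: integral_on_supp[OF \<nu> Cb_measurable[OF \<nu> hC]] integral_const_borel_prob[OF \<mu>] add_0_left)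
  qed
  ultimately have \<gamma>c: "\<gamma> \<in> couplings N \<mu> \<nu>" by (simp add: couplings_iff \<gamma>p \<gamma>s')
  have "(\<integral>z. F z \<partial>\<gamma>) = 0" if F: "F \<in> FF N \<mu> \<nu>" for F
  proof -
    note cb = FF_continuous_bounded[OF \<mu> \<nu> swc F]
    have "(\<integral>z. F z \<partial>\<gamma>) = L F" by (rule \<gamma>L[OF cb(2,1)])
    also have "\<dots> = (\<integral>x. 0 \<partial>\<mu>) + (\<integral>x. 0 \<partial>\<nu>)" by (rule Lsum[OF cb(2) Cb_const Cb_const linear_span_base[OF F]]) simp
    finally show ?thesis by simp
  qed
  then have "\<gamma> \<in> causal_couplings N \<mu> \<nu>"
    using causal_if_orthogonal_FF[OF swc \<gamma>c] \<gamma>c by (simp add: causal_couplings_def)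
  moreover have "ereal_integral \<gamma> c \<le> ereal d"
  proof -
    obtain f where f: "\<And>n::nat. continuous_on (X \<times> Y) (f n)" "\<And>n. f n \<in> ?V"
      "\<And>z. z \<in> X \<times> Y \<Longrightarrow> incseq (\<lambda>n. f n z)" "\<And>n z. z \<in> X \<times> Y \<Longrightarrow> b \<le> f n z"
      "\<And>z. z \<in> X \<times> Y \<Longrightarrow> (SUP n. ereal (f n z)) = c z"
      using lsc_eq_SUP_continuous[OF lsc c] by blast
    have "(\<integral>z. f n z \<partial>\<gamma>) \<le> d" for n
    proof -
      have "L (f n) \<le> (\<integral>x. 0 \<partial>\<mu>) + (\<integral>x. 0 \<partial>\<nu>) + 1 * d"
      proof (rule Lle[OF f(2) dominatesI[OF Cb_const Cb_const linear_span_zero]])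
        show "(0::real) \<le> 1" by simp
        fix x y assume "x \<in> X" "y \<in> Y"
        then have "ereal (f n (x, y)) \<le> c (x, y)" using f(5)[of "(x, y)", symmetric] by (auto intro: SUP_upper)
        then show "ereal (f n (x, y)) \<le> ereal (0 + 0 + 0) + ereal 1 * c (x, y)"
          by (simp add: zero_ereal_def[symmetric] one_ereal_def[symmetric])
      qed simp
      then show ?thesis using \<gamma>L[OF f(2,1)] by simp
    qed
    moreover have "integrable \<gamma> (f n)" for n
      by (rule \<gamma>.integrable_bounded_funs[OF coupling_continuous_measurable[OF \<gamma>c f(1)] f(2)]) (simp add: \<gamma>sp)
    moreover have "c \<in> borel_measurable \<gamma>"
      unfolding measurable_cong_sets[OF \<gamma>s refl] by (rule lsc_measurable[OF lsc])
    ultimately show ?thesis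
      using f(3,4,5) by (intro ereal_integral_SUP_le[OF \<gamma>p, where u = f and b = b]) (simp_all add: \<gamma>sp)
  qed
  ultimately show ?thesis by blast
qed

end

theorem theorem2p6:
  fixes N :: nat and \<mu> \<nu> :: "vec measure" and c :: "vec \<times> vec \<Rightarrow> ereal"
  assumes "1 \<le> N"
    and "borel_prob N \<mu>" and "borel_prob N \<nu>"
    and "successively_weakly_continuous N \<mu>"
    and "lower_semicontinuous
           (subtopology (prod_topology (top_on {1..N}) (top_on {1..N})) (supp N \<mu> \<times> supp N \<nu>)) c"
    and "\<exists>b::real. \<forall>z \<in> supp N \<mu> \<times> supp N \<nu>. ereal b \<le> c z"
  shows "(INF \<gamma> \<in> causal_couplings N \<mu> \<nu>. ereal_integral \<gamma> c) =
        dual_value N \<mu> \<nu> c (linear_span (FF N \<mu> \<nu>))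
    \<and> dual_value N \<mu> \<nu> c (linear_span (FF N \<mu> \<nu>)) =
        dual_value N \<mu> \<nu> c (linear_span (SS N \<mu> \<nu>))
    \<and> (\<exists>\<gamma> \<in> causal_couplings N \<mu> \<nu>.
         ereal_integral \<gamma> c = (INF \<gamma>' \<in> causal_couplings N \<mu> \<nu>. ereal_integral \<gamma>' c))"
proof -
  interpret marginals N \<mu> \<nu> using assms(2,3) by unfold_locales
  obtain b where b: "\<And>z. z \<in> X \<times> Y \<Longrightarrow> ereal b \<le> c z" using assms(6) by blast
  note swc = assms(4)
  have "Rspace {1..N} \<times> Rspace {1..N} \<inter> X \<times> Y = X \<times> Y" using supp_subset by blast
  then have "subtopology (prod_topology (top_on {1..N}) (top_on {1..N})) (X \<times> Y) = top_of_set (X \<times> Y)"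
    unfolding top_on_eq subtopology_Times[symmetric]
    by (simp add: subtopology_subtopology del: One_nat_def)
  then have lsc: "lower_semicontinuous (top_of_set (X \<times> Y)) c" using assms(5) by simp
  define DF where "DF = dual_value N \<mu> \<nu> c (linear_span (FF N \<mu> \<nu>))"
  define DS where "DS = dual_value N \<mu> \<nu> c (linear_span (SS N \<mu> \<nu>))"
  have DS_le: "DS \<le> ereal_integral \<gamma> c" if \<gamma>: "\<gamma> \<in> causal_couplings N \<mu> \<nu>" for \<gamma>
    unfolding DS_def dual_value_def
  proof (rule Sup_least, clarify)
    have \<gamma>c: "\<gamma> \<in> couplings N \<mu> \<nu>" using \<gamma> by (simp add: causal_couplings_def)
    have cm: "c \<in> borel_measurable \<gamma>"
      unfolding measurable_cong_sets[OF coupling_sets[OF \<gamma>c, unfolded sets_pair_eq_restrict_borel] refl]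
      by (rule lsc_measurable[OF lsc])
    fix \<Phi> \<Psi> F
    assume "\<Phi> \<in> C\<^sub>b (top_on {1..N})" "\<Psi> \<in> C\<^sub>b (top_on {1..N})" "F \<in> linear_span (SS N \<mu> \<nu>)"
      "\<forall>x\<in>X. \<forall>y\<in>Y. ereal (\<Phi> x + \<Psi> y) \<le> c (x, y) + ereal (F (x, y))"
    then show "ereal ((\<integral>x. \<Phi> x \<partial>\<mu>) + (\<integral>y. \<Psi> y \<partial>\<nu>)) \<le> ereal_integral \<gamma> c"
      by (intro weak_duality[OF \<gamma> cm b]) auto
  qed
  have DF_le_DS: "DF \<le> DS"
    unfolding DF_def DS_def dual_value_def
  proof (rule Sup_subset_mono, clarify)
    fix \<Phi> \<Psi> F
    assume F: "F \<in> linear_span (FF N \<mu> \<nu>)"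
      and le: "\<forall>x\<in>X. \<forall>y\<in>Y. ereal (\<Phi> x + \<Psi> y) \<le> c (x, y) + ereal (F (x, y))"
      and Cb: "\<Phi> \<in> C\<^sub>b (top_on {1..N})" "\<Psi> \<in> C\<^sub>b (top_on {1..N})"
    obtain S where S: "S \<in> linear_span (SS N \<mu> \<nu>)" "\<forall>x\<in>X. \<forall>y\<in>Y. F (x, y) = S (x, y)"
      using span_FF_eq_span_SS[OF swc F] by blast
    have "\<forall>x\<in>X. \<forall>y\<in>Y. ereal (\<Phi> x + \<Psi> y) \<le> c (x, y) + ereal (S (x, y))" using le S(2) by simp
    then show "\<exists>\<Phi>' \<Psi>' F'. ereal ((\<integral>x. \<Phi> x \<partial>\<mu>) + (\<integral>y. \<Psi> y \<partial>\<nu>)) = ereal ((\<integral>x. \<Phi>' x \<partial>\<mu>) + (\<integral>y. \<Psi>' y \<partial>\<nu>)) \<and>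
        \<Phi>' \<in> C\<^sub>b (top_on {1..N}) \<and> \<Psi>' \<in> C\<^sub>b (top_on {1..N}) \<and> F' \<in> linear_span (SS N \<mu> \<nu>) \<and>
        (\<forall>x\<in>X. \<forall>y\<in>Y. ereal (\<Phi>' x + \<Psi>' y) \<le> c (x, y) + ereal (F' (x, y)))"
      using Cb S(1) by blast
  qed
  have DF_upper: "ereal ((\<integral>x. \<Phi> x \<partial>\<mu>) + (\<integral>y. \<Psi> y \<partial>\<nu>)) \<le> DF"
    if "\<Phi> \<in> C\<^sub>b (top_on {1..N})" "\<Psi> \<in> C\<^sub>b (top_on {1..N})" "F \<in> linear_span (FF N \<mu> \<nu>)"
      "\<And>x y. x \<in> X \<Longrightarrow> y \<in> Y \<Longrightarrow> ereal (\<Phi> x + \<Psi> y) \<le> c (x, y) + ereal (F (x, y))" for \<Phi> \<Psi> F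
    unfolding DF_def dual_value_def using that by (intro Sup_upper) blast
  have "\<exists>\<gamma>\<in>causal_couplings N \<mu> \<nu>. ereal_integral \<gamma> c \<le> DF"
  proof (cases DF)
    case (real d)
    then show ?thesis
      using exists_causal_coupling_le[OF swc lsc b, of d] DF_upper by (simp add: dual_bound_def)
  next
    case PInf
    then show ?thesis using product_coupling_causal by auto
  next
    case MInf
    have "ereal ((\<integral>x. b \<partial>\<mu>) + (\<integral>x. 0 \<partial>\<nu>)) \<le> DF"
      using b by (intro DF_upper[OF Cb_const Cb_const linear_span_zero]) (auto simp: zero_ereal_def[symmetric])
    then show ?thesis using MInf by simp
  qed
  then obtain \<gamma> where \<gamma>: "\<gamma> \<in> causal_couplings N \<mu> \<nu>" "ereal_integral \<gamma> c \<le> DF" by blast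
  have "(INF \<gamma>\<in>causal_couplings N \<mu> \<nu>. ereal_integral \<gamma> c) \<le> ereal_integral \<gamma> c" by (rule INF_lower[OF \<gamma>(1)])
  moreover have "DS \<le> (INF \<gamma>\<in>causal_couplings N \<mu> \<nu>. ereal_integral \<gamma> c)" using DS_le by (rule INF_greatest)
  ultimately have "(INF \<gamma>\<in>causal_couplings N \<mu> \<nu>. ereal_integral \<gamma> c) = DF" "DF = DS"
      "ereal_integral \<gamma> c = (INF \<gamma>\<in>causal_couplings N \<mu> \<nu>. ereal_integral \<gamma> c)"
    using \<gamma>(2) DF_le_DS by auto
  then show ?thesis using \<gamma>(1) unfolding DF_def DS_def by blast
qed

end
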